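(* Let $\alpha\in(0,n)$ and let $f\in L^{\frac{n}{n+\alpha}}(\mathbb{R}^n)$ be non-negative. Then $$\sigma_{n,\alpha}\,\|f\|_{\frac{n}{n+\alpha}}\ \ge\ \int_{\mathbb{R}^n}\int_{\mathbb{R}^n}\frac{\min\{f(x),f(y)\}}{|x-y|^{n-\alpha}}\,dx\,dy,$$ where the sharp constant is given by $$\sigma_{n,\alpha}=\frac{n\,2^{\alpha}\,\pi^{\frac{n-\alpha-1}{2}}\,\Gamma\!\left(\frac{\alpha+1}{2}\right)\Gamma\!\left(\frac n2+1\right)^{\frac{\alpha}{n}}}{|\alpha|\,\Gamma\!\left(\frac{n+\alpha}{2}+1\right)}.$$ Equality holds if and only if $f$ is a constant multiple of the characteristic function of a ball.
   Context: For $p>0$, $\|f\|_p=\left(\int_{\mathbb{R}^n}|f(x)|^p\,dx\right)^{1/p}$ (also for $p<1$), and $L^p(\mathbb{R}^n)$ is the set of measurable $f:\mathbb{R}^n\to\mathbb{R}$ with $\|f\|_p<\infty$, where functions equal almost everywhere are identified (so the equality characterization is understood up to null sets). $\Gamma$ is the gamma function and $|\cdot|$ is the Euclidean norm on $\mathbb{R}^n$. *)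

theory Defs
  imports "HOL-Analysis.Analysis"
begin

(* There is no powr on ennreal, so the value infinity is treated separately. *)
definition Lp_norm :: "real \<Rightarrow> (real ^ 'n \<Rightarrow> real) \<Rightarrow> ennreal" where
  "Lp_norm p f =
     (let I = (\<integral>\<^sup>+x. ennreal (\<bar>f x\<bar> powr p) \<partial>lebesgue)
      in if I = \<infinity> then \<infinity> else ennreal (enn2real I powr (1 / p)))"

(* Functions, not classes: identification up to null sets is expressed by AE at each use. *)
definition Lp :: "real \<Rightarrow> (real ^ 'n \<Rightarrow> real) set" where
  "Lp p = {f \<in> borel_measurable lebesgue. Lp_norm p f < \<infinity>}"

(* On the diagonal, a null set, the integrand is 0 because x / 0 = 0. *)
definition min_energy :: "real \<Rightarrow> (real ^ 'n \<Rightarrow> real) \<Rightarrow> ennreal" where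
  "min_energy \<alpha> f =
     (\<integral>\<^sup>+y. \<integral>\<^sup>+x. ennreal (min (f x) (f y) / norm (x - y) powr (real CARD('n) - \<alpha>))
        \<partial>lebesgue \<partial>lebesgue)"

definition sigma_const :: "nat \<Rightarrow> real \<Rightarrow> real" where
  "sigma_const n \<alpha> =
     real n * 2 powr \<alpha> * pi powr ((real n - \<alpha> - 1) / 2) * Gamma ((\<alpha> + 1) / 2)
       * Gamma (real n / 2 + 1) powr (\<alpha> / real n)
     / (\<bar>\<alpha>\<bar> * Gamma ((real n + \<alpha>) / 2 + 1))"

end

theory Submission
  imports Defs "HOL-Probability.Distribution_Functions"
begin

text \<open>
  Write \<open>n\<close> for the dimension, \<open>q = 1/p = (n + \<alpha>)/n > 1\<close>, \<open>k(x, y) = |x - y|\<^sup>-\<^sup>(\<^sup>n\<^sup>-\<^sup>\<alpha>\<^sup>)\<close> and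
  \<open>E(A)\<close> for the integral of \<open>k\<close> over \<open>A \<times> A\<close>. By the layer-cake formula the functional on the right is the
  integral of \<open>E(A\<^sub>t)\<close> over \<open>t > 0\<close>, where \<open>A\<^sub>t = {f > t}\<close>, and the theorem splits into two parts.

  The first part is the isoperimetric inequality \<open>E(A) \<le> \<sigma> |A|\<^sup>q\<close>, with equality for sets of positive finite
  measure exactly if \<open>A\<close> is a ball up to a null set (\<open>riesz_energy_isoperimetric\<close>,
  \<open>riesz_energy_isoperimetric_eq\<close>). It is the Riesz rearrangement inequality for a set and the strictly
  decreasing kernel \<open>k\<close>, proved by polarization, that is, by two-point symmetrization in a hyperplane. A
  polarization does not decrease \<open>E\<close>, and if it preserves a finite \<open>E(A)\<close> then, up to null sets, it
  changes nothing or acts as the reflection (\<open>riesz_energy_polarize_le\<close>, \<open>riesz_energy_polarize_eq\<close>). An average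
  over reflections (\<open>reflect_average\<close>) finds, for a bounded set \<open>A\<close> and the centred ball \<open>B\<close> of the same
  measure, a hyperplane for which polarization lowers \<open>|A - B|\<close> by at least \<open>\<kappa> |A - B|\<^sup>2\<close>. Hence the infimum of
  \<open>|A' - B|\<close> over the sets \<open>A'\<close> that compete with \<open>A\<close> is zero, and \<open>E(A) \<le> E(B)\<close> because \<open>E\<close> is continuous with
  respect to the symmetric difference; no compactness is needed. If \<open>E(A) = E(B)\<close>, the rigidity of
  polarization applies to every hyperplane. A translation moves the medians of \<open>A\<close> in the coordinate directions to
  the origin; then \<open>A\<close> is symmetric in all coordinate hyperplanes, hence \<open>A = -A\<close>, hence no polarization towards
  the origin changes \<open>A\<close>, and the average over reflections forces \<open>|A - B| |B - A| = 0\<close>.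

  The value of \<open>E\<close> on the unit ball follows from its homogeneity. Integration of \<open>E\<close> over the balls of radius
  \<open>sqrt v\<close> against \<open>e\<^sup>-\<^sup>v dv\<close> replaces the indicator of the ball by a Gaussian weight, and after the substitution
  \<open>x = y + z\<close> only the Gaussian measure of half-spaces and the potential of a ball at its centre remain
  (\<open>riesz_energy_unit_ball\<close>).

  The second part is that the integral of \<open>|A\<^sub>t|\<^sup>q\<close> over \<open>t\<close> is at most the norm of \<open>f\<close>. With \<open>J\<close> the integral of
  \<open>f\<^sup>p\<close>, the reverse Hoelder inequality on each level set gives \<open>|A\<^sub>t|\<^sup>q \<le> J\<^sup>q\<^sup>-\<^sup>1 \<integral> f\<^sup>p\<^sup>-\<^sup>1\<close> with the integral over \<open>A\<^sub>t\<close>,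
  and integration in \<open>t\<close> makes the right-hand side \<open>J\<^sup>q\<close>. Equality at a single level \<open>t > 0\<close> of positive measure
  already forces \<open>f\<close> to be a multiple of the indicator of \<open>A\<^sub>t\<close> (\<open>reverse_Hoelder_level\<close>). In the case of equality
  almost every level has equality in both parts, and one level suffices to conclude (\<open>min_form_inequality\<close>).
\<close>

section \<open>Reflections in affine hyperplanes\<close>

lemma nn_integral_lborel_affine:
  fixes f :: "'a::euclidean_space \<Rightarrow> ennreal"
  assumes [measurable]: "f \<in> borel_measurable borel" and "c \<noteq> 0"
  shows "(\<integral>\<^sup>+x. f x \<partial>lborel) = ennreal (\<bar>c\<bar> ^ DIM('a)) * (\<integral>\<^sup>+x. f (t + c *\<^sub>R x) \<partial>lborel)"
  by (subst lborel_affine[OF assms(2), of t])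
    (simp add: nn_integral_density nn_integral_distr nn_integral_cmult)

lemma nn_integral_lborel_translate:
  fixes f :: "'a::euclidean_space \<Rightarrow> ennreal"
  assumes [measurable]: "f \<in> borel_measurable borel"
  shows "(\<integral>\<^sup>+x. f (x + a) \<partial>lborel) = (\<integral>\<^sup>+x. f x \<partial>lborel)"
  by (subst (2) lborel_distr_plus[of a, symmetric]) (simp add: nn_integral_distr add.commute)

text \<open>The reflection in the hyperplane \<open>{x. x \<bullet> w = s}\<close>. The normal \<open>w\<close> need not be a unit vector; for \<open>w = 0\<close>
  the map is the identity.\<close>
definition reflect :: "'a::euclidean_space \<Rightarrow> real \<Rightarrow> 'a \<Rightarrow> 'a" where
  "reflect w s x = x - (2 * ((x \<bullet> w - s) / (w \<bullet> w))) *\<^sub>R w"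

lemma inner_reflect:
  assumes "w \<noteq> 0"
  shows "reflect w s x \<bullet> w = 2 * s - x \<bullet> w"
  using assms by (simp add: reflect_def inner_diff_left field_simps)

lemma reflect_reflect [simp]:
  assumes "w \<noteq> 0"
  shows "reflect w s (reflect w s x) = x"
  unfolding reflect_def[of w s "reflect w s x"] inner_reflect[OF assms]
  by (simp add: reflect_def algebra_simps diff_divide_distrib)

text \<open>If \<open>x\<close> and \<open>y\<close> lie on the same side of the hyperplane, reflecting one of them increases their distance;
  if they lie on opposite sides, it decreases it. All monotonicity of polarization comes from this identity.\<close>
lemma norm_diff_reflect_sq:
  assumes "w \<noteq> 0"
  shows "(norm (x - reflect w s y))\<^sup>2 = (norm (x - y))\<^sup>2 + 4 * ((x \<bullet> w - s) * (y \<bullet> w - s)) / (w \<bullet> w)"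
proof -
  define c where "c = 2 * ((y \<bullet> w - s) / (w \<bullet> w))"
  have cw: "c * (w \<bullet> w) = 2 * (y \<bullet> w - s)"
    using assms by (simp add: c_def)
  have "(norm (x - reflect w s y))\<^sup>2 = ((x - y) + c *\<^sub>R w) \<bullet> ((x - y) + c *\<^sub>R w)"
    unfolding power2_norm_eq_inner by (simp add: reflect_def c_def diff_diff_eq2 diff_add_eq)
  also have "\<dots> = (norm (x - y))\<^sup>2 + c * (2 * ((x - y) \<bullet> w) + c * (w \<bullet> w))"
    by (simp add: power2_norm_eq_inner inner_add_left inner_add_right inner_commute algebra_simps)
  also have "c * (2 * ((x - y) \<bullet> w) + c * (w \<bullet> w)) = c * (2 * (x \<bullet> w - s))"
    by (simp add: cw inner_diff_left)
  also have "\<dots> = 4 * ((x \<bullet> w - s) * (y \<bullet> w - s)) / (w \<bullet> w)"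
    by (simp add: c_def field_simps)
  finally show ?thesis .
qed

lemma norm_reflect_sq:
  assumes "w \<noteq> 0"
  shows "(norm (reflect w s y))\<^sup>2 = (norm y)\<^sup>2 - 4 * s * (y \<bullet> w - s) / (w \<bullet> w)"
  using norm_diff_reflect_sq[OF assms, of 0 s y] by simp

lemma norm_reflect_diff:
  assumes "w \<noteq> 0"
  shows "norm (reflect w s x - reflect w s y) = norm (x - y)"
proof -
  have "(norm (reflect w s x - reflect w s y))\<^sup>2 = (norm (x - y))\<^sup>2"
    using norm_diff_reflect_sq[OF assms, of "reflect w s x" s y] 
      norm_diff_reflect_sq[OF assms, of y s x] assms
    by (simp add: inner_reflect norm_minus_commute field_simps)
  then show ?thesis by simp
qed

lemma norm_diff_reflect_swap:
  assumes "w \<noteq> 0"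
  shows "norm (reflect w s x - y) = norm (x - reflect w s y)"
  using norm_reflect_diff[OF assms, of s x "reflect w s y"] assms by simp

lemma reflect_measurable [measurable]: "reflect (w::'a::euclidean_space) s \<in> borel_measurable borel"
  unfolding reflect_def[abs_def] by measurable

text \<open>The pushforward of Lebesgue measure under an isometry is again translation invariant, so it is a
  multiple of Lebesgue measure, and the unit ball shows that the factor is one. Fubini's theorem and
  the substitution \<open>y \<mapsto> T x - y\<close> carry this out directly.\<close>

lemma distr_lborel_reflect:
  fixes w :: "'a::euclidean_space"
  assumes w: "w \<noteq> 0"
  shows "distr lborel borel (reflect w s) = lborel"
proof (rule measure_eqI)
  fix A :: "'a set" assume "A \<in> sets (distr lborel borel (reflect w s))"
  then have [measurable]: "A \<in> sets borel" by simp
  define T where "T = reflect w s"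
  have [measurable]: "T \<in> borel_measurable borel" by (simp add: T_def)
  let ?B = "ball 0 1 :: 'a set"
  have [measurable]: "?B \<in> sets borel" by simp
  have TT: "T (x + reflect w 0 y) = T x + y" for x y
    using w by (simp add: T_def reflect_def inner_diff_left inner_add_left algebra_simps diff_divide_distrib add_divide_distrib)
  have "norm (T x) = norm (x - T 0)" for x
    using norm_diff_reflect_swap[OF w, of s x 0] by (simp add: T_def)
  then have TB: "indicator ?B (T x) = (indicator (ball (T 0) 1) x :: ennreal)" for x
    by (simp add: indicator_def dist_norm norm_minus_commute)
  have ball_eq: "emeasure lborel (ball (T 0) 1) = emeasure lborel ?B"
    by (simp add: emeasure_ball)
  have minus: "(\<integral>\<^sup>+y. f (a - y) \<partial>lborel) = (\<integral>\<^sup>+y. f y \<partial>lborel)"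
    if "f \<in> borel_measurable borel" for f :: "'a \<Rightarrow> ennreal" and a
    using nn_integral_lborel_affine[OF that, of "-1" a] by simp
  have "(\<integral>\<^sup>+x. indicator A (T x) \<partial>lborel) * emeasure lborel ?B
      = (\<integral>\<^sup>+x. \<integral>\<^sup>+y. indicator A (T x) * indicator ?B y \<partial>lborel \<partial>lborel)"
    by (subst nn_integral_cmult) (simp_all add: nn_integral_multc borel_measurable_indicator)
  also have "\<dots> = (\<integral>\<^sup>+x. \<integral>\<^sup>+y. indicator A (T x) * indicator ?B (T x - y) \<partial>lborel \<partial>lborel)"
    by (rule nn_integral_cong, rule minus[symmetric]) measurable
  also have "\<dots> = (\<integral>\<^sup>+y. \<integral>\<^sup>+x. indicator A (T x) * indicator ?B (T x - y) \<partial>lborel \<partial>lborel)"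
    by (rule lborel_pair.Fubini') measurable
  also have "\<dots> = (\<integral>\<^sup>+y. \<integral>\<^sup>+x. indicator A (T (x + reflect w 0 y)) * indicator ?B (T (x + reflect w 0 y) - y) \<partial>lborel \<partial>lborel)"
    by (rule nn_integral_cong, rule nn_integral_lborel_translate[symmetric]) measurable
  also have "\<dots> = (\<integral>\<^sup>+y. \<integral>\<^sup>+x. indicator A (T x + y) * indicator ?B (T x) \<partial>lborel \<partial>lborel)"
    by (simp add: TT)
  also have "\<dots> = (\<integral>\<^sup>+x. \<integral>\<^sup>+y. indicator A (T x + y) * indicator ?B (T x) \<partial>lborel \<partial>lborel)"
    by (rule lborel_pair.Fubini'[symmetric]) measurable
  also have "\<dots> = (\<integral>\<^sup>+x. (\<integral>\<^sup>+y. indicator A (y + T x) \<partial>lborel) * indicator ?B (T x) \<partial>lborel)"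
    by (simp add: nn_integral_multc add.commute)
  also have "\<dots> = emeasure lborel A * emeasure lborel ?B"
    by (simp add: nn_integral_lborel_translate TB ball_eq nn_integral_cmult_indicator)
  finally have "(\<integral>\<^sup>+x. indicator A (T x) \<partial>lborel) = emeasure lborel A"
    using unit_ball_vol_pos[of "real DIM('a)", OF of_nat_0_le_iff]
    by (subst (asm) mult.commute, subst (asm) (2) mult.commute)
      (auto simp add: ennreal_mult_cancel_left emeasure_ball ennreal_eq_0_iff)
  moreover have "(\<integral>\<^sup>+x. indicator A (T x) \<partial>lborel) = emeasure (distr lborel borel T) A"
    using nn_integral_distr[of T lborel borel "indicator A"] by simp
  ultimately show "emeasure (distr lborel borel (reflect w s)) A = emeasure lborel A"
    by (simp add: T_def)
qed simp

lemma nn_integral_reflect: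
  fixes w :: "'a::euclidean_space"
  assumes "w \<noteq> 0" and [measurable]: "g \<in> borel_measurable borel"
  shows "(\<integral>\<^sup>+x. g (reflect w s x) \<partial>lborel) = (\<integral>\<^sup>+x. g x \<partial>lborel)"
  by (subst (2) distr_lborel_reflect[OF assms(1), of s, symmetric]) (simp add: nn_integral_distr)

section \<open>The Riesz energy of a set and its growth under polarization\<close>

text \<open>The kernel \<open>|x - y|\<^sup>-\<^sup>(\<^sup>n\<^sup>-\<^sup>\<alpha>\<^sup>)\<close> with values in the extended non-negative reals. For \<open>\<alpha> < n\<close> it is \<open>0\<close> on the
  diagonal, by the convention \<open>1 / 0 = 0\<close>, so that monotonicity in the distance needs \<open>x \<noteq> y\<close>.\<close>
definition riesz_kernel :: "real \<Rightarrow> 'a::euclidean_space \<Rightarrow> 'a \<Rightarrow> ennreal" where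
  "riesz_kernel \<alpha> x y = ennreal (1 / norm (x - y) powr (real DIM('a) - \<alpha>))"

text \<open>The energy \<open>E(A)\<close>, the integral of the kernel over \<open>A \<times> A\<close>.\<close>
definition riesz_energy :: "real \<Rightarrow> ('a::euclidean_space) set \<Rightarrow> ennreal" where
  "riesz_energy \<alpha> A = (\<integral>\<^sup>+y. \<integral>\<^sup>+x. indicator A x * indicator A y * riesz_kernel \<alpha> x y \<partial>lborel \<partial>lborel)"

text \<open>The polarization of \<open>A\<close> towards the half-space \<open>{x. x \<bullet> w < s}\<close>: of each pair of mirror points, a single
  point of \<open>A\<close> is placed in that half-space. Points of the hyperplane are their own mirror images and
  may be counted on either side.\<close>
definition polarize :: "'a::euclidean_space \<Rightarrow> real \<Rightarrow> 'a set \<Rightarrow> 'a set" where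
  "polarize w s A = {x. if x \<bullet> w < s then x \<in> A \<or> reflect w s x \<in> A else x \<in> A \<and> reflect w s x \<in> A}"

lemma riesz_kernel_measurable [measurable (raw)]:
  assumes [measurable]: "f \<in> borel_measurable M" "g \<in> borel_measurable M"
  shows "(\<lambda>x. riesz_kernel \<alpha> (f x) (g x)) \<in> borel_measurable M"
  unfolding riesz_kernel_def by measurable

lemma riesz_kernel_commute: "riesz_kernel \<alpha> x y = riesz_kernel \<alpha> y x"
  by (simp add: riesz_kernel_def norm_minus_commute)

lemma riesz_kernel_le:
  fixes x y u v :: "'a::euclidean_space"
  assumes "\<alpha> < real DIM('a)" "x \<noteq> y" "norm (x - y) \<le> norm (u - v)"
  shows "riesz_kernel \<alpha> u v \<le> riesz_kernel \<alpha> x y"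
  unfolding riesz_kernel_def using assms
  by (intro ennreal_leI divide_left_mono powr_mono2 mult_pos_pos) (auto intro!: powr_mono2)

lemma riesz_kernel_less:
  fixes x y u v :: "'a::euclidean_space"
  assumes "\<alpha> < real DIM('a)" "x \<noteq> y" "norm (x - y) < norm (u - v)"
  shows "riesz_kernel \<alpha> u v < riesz_kernel \<alpha> x y"
proof -
  have "norm (x - y) powr (real DIM('a) - \<alpha>) < norm (u - v) powr (real DIM('a) - \<alpha>)"
    using assms by (intro powr_less_mono2) auto
  moreover have "0 < norm (x - y) powr (real DIM('a) - \<alpha>)"
    using assms by simp
  moreover have "u \<noteq> v" using assms(3) norm_ge_zero[of "x - y"] by (metis cancel_comm_monoid_add_class.diff_cancel norm_zero not_less)
  then have "0 < norm (u - v) powr (real DIM('a) - \<alpha>)"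
    by simp
  ultimately show ?thesis
    unfolding riesz_kernel_def by (intro ennreal_lessI divide_strict_left_mono) auto
qed

lemma polarize_measurable [measurable]:
  assumes [measurable]: "A \<in> sets borel"
  shows "polarize w s A \<in> sets borel"
proof -
  have "polarize w s A = {x \<in> space borel. if x \<bullet> w < s then x \<in> A \<or> reflect w s x \<in> A else x \<in> A \<and> reflect w s x \<in> A}"
    by (simp add: polarize_def)
  also have "\<dots> \<in> sets borel" 
    using reflect_measurable[of w s] by measurable
  finally show ?thesis .
qed

text \<open>Averaging over the four combinations of reflections replaces a splitting of the space into two half-spaces
  and avoids a separate treatment of the hyperplane.\<close>
lemma nn_integral_symmetrize_pair:
  fixes w :: "'a::euclidean_space"
  assumes w: "w \<noteq> 0" and F[measurable]: "case_prod F \<in> borel_measurable (borel \<Otimes>\<^sub>M borel)"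
  shows "4 * (\<integral>\<^sup>+y. \<integral>\<^sup>+x. F x y \<partial>lborel \<partial>lborel) =
    (\<integral>\<^sup>+y. \<integral>\<^sup>+x. (F x y + F (reflect w s x) (reflect w s y)) + (F (reflect w s x) y + F x (reflect w s y)) \<partial>lborel \<partial>lborel)"
    (is "4 * ?I = ?J")
proof -
  let ?r = "reflect w s"
  have 1: "(\<integral>\<^sup>+x. F (?r x) y \<partial>lborel) = (\<integral>\<^sup>+x. F x y \<partial>lborel)" for y
    by (rule nn_integral_reflect[OF w, of "\<lambda>x. F x y"]) measurable
  have 2: "(\<integral>\<^sup>+y. \<integral>\<^sup>+x. F x (?r y) \<partial>lborel \<partial>lborel) = ?I"
    by (rule nn_integral_reflect[OF w, of "\<lambda>y. \<integral>\<^sup>+x. F x y \<partial>lborel"]) measurable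
  have "?J = (?I + (\<integral>\<^sup>+y. \<integral>\<^sup>+x. F (?r x) (?r y) \<partial>lborel \<partial>lborel)) 
    + ((\<integral>\<^sup>+y. \<integral>\<^sup>+x. F (?r x) y \<partial>lborel \<partial>lborel) + (\<integral>\<^sup>+y. \<integral>\<^sup>+x. F x (?r y) \<partial>lborel \<partial>lborel))"
    by (simp add: nn_integral_add)
  also have "\<dots> = ?I + ?I + (?I + ?I)"
    unfolding 1 2 by (simp add: 2)
  also have "\<dots> = 4 * ?I"
    by (metis (no_types, lifting) mult_2 mult.assoc numeral_Bit0 distrib_right)
  finally show ?thesis by simp
qed

lemma riesz_kernel_reflect:
  assumes "w \<noteq> 0"
  shows "riesz_kernel \<alpha> (reflect w s x) (reflect w s y) = riesz_kernel \<alpha> x y"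
    and "riesz_kernel \<alpha> (reflect w s x) y = riesz_kernel \<alpha> x (reflect w s y)"
  using assms by (simp_all add: riesz_kernel_def norm_reflect_diff norm_diff_reflect_swap)

lemma riesz_kernel_reflect_le:
  fixes x :: "'a::euclidean_space"
  assumes "\<alpha> < real DIM('a)" "w \<noteq> 0" 
  shows "x \<noteq> y \<Longrightarrow> 0 \<le> (x \<bullet> w - s) * (y \<bullet> w - s) \<Longrightarrow> riesz_kernel \<alpha> x (reflect w s y) \<le> riesz_kernel \<alpha> x y"
    and "x \<noteq> reflect w s y \<Longrightarrow> (x \<bullet> w - s) * (y \<bullet> w - s) \<le> 0 \<Longrightarrow> riesz_kernel \<alpha> x y \<le> riesz_kernel \<alpha> x (reflect w s y)"
    and "x \<noteq> y \<Longrightarrow> 0 < (x \<bullet> w - s) * (y \<bullet> w - s) \<Longrightarrow> riesz_kernel \<alpha> x (reflect w s y) < riesz_kernel \<alpha> x y"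
proof -
  have w: "0 < w \<bullet> w" using assms by simp
  note n = norm_diff_reflect_sq[OF assms(2), of x s y]
  show "riesz_kernel \<alpha> x (reflect w s y) \<le> riesz_kernel \<alpha> x y" if "x \<noteq> y" "0 \<le> (x \<bullet> w - s) * (y \<bullet> w - s)"
  proof (rule riesz_kernel_le[OF assms(1) that(1)])
    have "0 \<le> 4 * ((x \<bullet> w - s) * (y \<bullet> w - s)) / (w \<bullet> w)" using w that(2) by (intro divide_nonneg_pos) auto
    then have "(norm (x - y))\<^sup>2 \<le> (norm (x - reflect w s y))\<^sup>2" using n by simp
    then show "norm (x - y) \<le> norm (x - reflect w s y)" by (rule power2_le_imp_le) simp
  qed
  show "riesz_kernel \<alpha> x (reflect w s y) < riesz_kernel \<alpha> x y" if "x \<noteq> y" "0 < (x \<bullet> w - s) * (y \<bullet> w - s)"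
  proof (rule riesz_kernel_less[OF assms(1) that(1)])
    have "0 < 4 * ((x \<bullet> w - s) * (y \<bullet> w - s)) / (w \<bullet> w)" using w that(2) by (intro divide_pos_pos) auto
    then have "(norm (x - y))\<^sup>2 < (norm (x - reflect w s y))\<^sup>2" using n by simp
    then show "norm (x - y) < norm (x - reflect w s y)" by (rule power2_less_imp_less) simp
  qed
  show "riesz_kernel \<alpha> x y \<le> riesz_kernel \<alpha> x (reflect w s y)" if "x \<noteq> reflect w s y" "(x \<bullet> w - s) * (y \<bullet> w - s) \<le> 0"
  proof (rule riesz_kernel_le[OF assms(1) that(1)])
    have "4 * ((x \<bullet> w - s) * (y \<bullet> w - s)) / (w \<bullet> w) \<le> 0" using w that(2) by (intro divide_nonpos_pos) auto
    then have "(norm (x - reflect w s y))\<^sup>2 \<le> (norm (x - y))\<^sup>2" using n by simp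
    then show "norm (x - reflect w s y) \<le> norm (x - y)" by (rule power2_le_imp_le) simp
  qed
qed

lemma polarize_reflect_iff:
  assumes "w \<noteq> 0"
  shows "reflect w s x \<in> polarize w s A \<longleftrightarrow> 
    (if s < x \<bullet> w then x \<in> A \<or> reflect w s x \<in> A else x \<in> A \<and> reflect w s x \<in> A)"
  using assms by (auto simp: polarize_def inner_reflect)

lemma reflect_on_hyperplane: "x \<bullet> w = s \<Longrightarrow> reflect w s x = x"
  by (simp add: reflect_def)

text \<open>The points of the half-space \<open>{x. x \<bullet> w < s}\<close> at which \<open>A\<close> contains the point but not its mirror image, and
  those at which it contains only the mirror image. Polarization moves mass exactly on the second
  set, and its energy gain comes from pairs with one point in each.\<close>
definition gain_set :: "'a::euclidean_space \<Rightarrow> real \<Rightarrow> 'a set \<Rightarrow> 'a set" where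
  "gain_set w s A = {x. x \<bullet> w < s \<and> x \<in> A \<and> reflect w s x \<notin> A}"
definition loss_set :: "'a::euclidean_space \<Rightarrow> real \<Rightarrow> 'a set \<Rightarrow> 'a set" where
  "loss_set w s A = {x. x \<bullet> w < s \<and> x \<notin> A \<and> reflect w s x \<in> A}"

lemma gain_loss_measurable [measurable]:
  assumes [measurable]: "A \<in> sets borel"
  shows "gain_set w s A \<in> sets borel" "loss_set w s A \<in> sets borel"
proof -
  have "gain_set w s A = {x \<in> space borel. x \<bullet> w < s \<and> x \<in> A \<and> reflect w s x \<notin> A}"
    "loss_set w s A = {x \<in> space borel. x \<bullet> w < s \<and> x \<notin> A \<and> reflect w s x \<in> A}"
    by (simp_all add: gain_set_def loss_set_def)
  moreover have "{x \<in> space borel. x \<bullet> w < s \<and> x \<in> A \<and> reflect w s x \<notin> A} \<in> sets borel" 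
    "{x \<in> space borel. x \<bullet> w < s \<and> x \<notin> A \<and> reflect w s x \<in> A} \<in> sets borel" by measurable
  ultimately show "gain_set w s A \<in> sets borel" "loss_set w s A \<in> sets borel" by simp_all
qed

text \<open>The rearrangement inequality for two pairs of \<open>0\<close>-\<open>1\<close> values: \<open>a, a'\<close> and \<open>b, b'\<close> tell whether two points and
  their mirror images belong to the set, \<open>K\<close> and \<open>L\<close> are the kernel on the same side and across. The last summand on the left
  records the gain in the one configuration that is needed later; \<open>p\<close> and \<open>q\<close> switch it off elsewhere.\<close>
lemma rearrange_bool:
  fixes K L :: ennreal
  assumes "L \<le> K"
  shows "(of_bool (a \<and> b) * K + of_bool (a' \<and> b') * K) + (of_bool (a' \<and> b) * L + of_bool (a \<and> b') * L)
      + of_bool (p \<and> q \<and> (a \<and> \<not> a') \<and> (\<not> b \<and> b')) * (K - L)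
    \<le> (of_bool ((a \<or> a') \<and> (b \<or> b')) * K + of_bool ((a \<and> a') \<and> (b \<and> b')) * K)
      + (of_bool ((a \<and> a') \<and> (b \<or> b')) * L + of_bool ((a \<or> a') \<and> (b \<and> b')) * L)"
proof -
  have e: "L + (K - L) = K" by (rule add_diff_inverse_ennreal[OF assms])
  show ?thesis using assms
    by (cases a; cases a'; cases b; cases b'; cases p; cases q) (simp_all add: add_ac e)
qed

text \<open>The four-point form of the energy inequality, including the gain term. All positions of \<open>x\<close> and \<open>y\<close>
  relative to the hyperplane are covered, since the integrals run over the whole space.\<close>
lemma polarize_pointwise:
  fixes x y w :: "'a::euclidean_space" and A :: "'a set" and s :: real
  assumes n: "\<alpha> < real DIM('a)" and w: "w \<noteq> 0"
  defines "F \<equiv> \<lambda>A x y. indicator A x * indicator A y * riesz_kernel \<alpha> x y"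
    and "r \<equiv> reflect w s"
  shows "(F A x y + F A (r x) (r y)) + (F A (r x) y + F A x (r y)) + 
     indicator (gain_set w s A) x * indicator (loss_set w s A) y * (riesz_kernel \<alpha> x y - riesz_kernel \<alpha> x (r y))
   \<le> (F (polarize w s A) x y + F (polarize w s A) (r x) (r y)) + (F (polarize w s A) (r x) y + F (polarize w s A) x (r y))"
proof -
  define K where "K = riesz_kernel \<alpha> x y"
  define L where "L = riesz_kernel \<alpha> x (r y)"
  have k: "riesz_kernel \<alpha> x y = K" "riesz_kernel \<alpha> (r x) (r y) = K"
    "riesz_kernel \<alpha> (r x) y = L" "riesz_kernel \<alpha> x (r y) = L"
    using riesz_kernel_reflect[OF w] by (simp_all add: K_def L_def r_def)
  have p: "z \<in> polarize w s A \<longleftrightarrow> (if z \<bullet> w < s then z \<in> A \<or> r z \<in> A else z \<in> A \<and> r z \<in> A)"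
    "r z \<in> polarize w s A \<longleftrightarrow> (if s < z \<bullet> w then z \<in> A \<or> r z \<in> A else z \<in> A \<and> r z \<in> A)" for z
    using polarize_reflect_iff[OF w] by (auto simp: polarize_def r_def)
  have h: "z \<bullet> w = s \<Longrightarrow> r z = z" for z by (simp add: reflect_on_hyperplane r_def)
  have lower: "z \<in> polarize w s A \<longleftrightarrow> z \<in> A \<or> r z \<in> A" "r z \<in> polarize w s A \<longleftrightarrow> z \<in> A \<and> r z \<in> A"
    if "z \<bullet> w \<le> s" for z using that p[of z] h[of z] by (auto simp: less_le)
  have upper: "z \<in> polarize w s A \<longleftrightarrow> z \<in> A \<and> r z \<in> A" "r z \<in> polarize w s A \<longleftrightarrow> z \<in> A \<or> r z \<in> A"
    if "s \<le> z \<bullet> w" for z using that p[of z] h[of z] by (auto simp: less_le)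
  have rr: "r (r z) = z" for z using w by (simp add: r_def)
  have ind: "F B u v = of_bool (u \<in> B \<and> v \<in> B) * riesz_kernel \<alpha> u v" for B u v
    by (simp add: F_def indicator_def)
  have gl: "indicator (gain_set w s A) x * indicator (loss_set w s A) y =
    (of_bool (x \<bullet> w < s \<and> y \<bullet> w < s \<and> (x \<in> A \<and> r x \<notin> A) \<and> (y \<notin> A \<and> r y \<in> A)) :: ennreal)"
    by (simp add: gain_set_def loss_set_def indicator_def r_def)
  \<comment> \<open>The first two cases are those in which the convention on the diagonal invalidates a comparison of \<open>K\<close> and \<open>L\<close>.\<close>
  consider "x = y" | "x = r y" "x \<noteq> y" | "x \<noteq> y" "x \<noteq> r y" by blast
  then show ?thesis
  proof cases
    case 1
    have "\<not> ((x \<in> A \<and> r x \<notin> A) \<and> (y \<notin> A \<and> r y \<in> A))" using 1 by blast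
    then show ?thesis
      unfolding ind gl k using 1 lower[of x] upper[of x] by (cases "x \<bullet> w \<le> s") (auto simp: add_ac)
  next
    case 2
    then have y: "y = r x" using rr by simp
    have yw: "y \<bullet> w = 2 * s - x \<bullet> w" using inner_reflect[OF w] by (simp add: y r_def)
    have pol: "y \<in> polarize w s A \<longleftrightarrow> r x \<in> polarize w s A" "r y \<in> polarize w s A \<longleftrightarrow> x \<in> polarize w s A"
      by (simp_all add: y rr)
    have "\<not> (x \<bullet> w < s \<and> y \<bullet> w < s)" using yw by simp
    then show ?thesis
      unfolding ind gl k pol using lower[of x] upper[of x] y rr by (cases "x \<bullet> w \<le> s") (auto simp: add_ac)
  next
    case 3
    have same: "L \<le> K" if "0 \<le> (x \<bullet> w - s) * (y \<bullet> w - s)"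
      unfolding K_def L_def r_def by (rule riesz_kernel_reflect_le(1)[OF n w 3(1) that])
    have opp: "K \<le> L" if "(x \<bullet> w - s) * (y \<bullet> w - s) \<le> 0"
      unfolding K_def L_def r_def by (rule riesz_kernel_reflect_le(2)[OF n w _ that]) (use 3 in \<open>simp add: r_def\<close>)
    consider "x \<bullet> w \<le> s" "y \<bullet> w \<le> s" | "s \<le> x \<bullet> w" "s \<le> y \<bullet> w" | "x \<bullet> w \<le> s" "s \<le> y \<bullet> w" | "s \<le> x \<bullet> w" "y \<bullet> w \<le> s"
      by linarith
    then show ?thesis
    proof cases
      case 1
      with same have "L \<le> K" by (simp add: mult_nonpos_nonpos)
      then show ?thesis
        unfolding ind gl k lower[OF 1(1)] lower[OF 1(2)] by (rule rearrange_bool)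
    next
      case 2
      with same have "L \<le> K" by simp
      have "\<not> x \<bullet> w < s" using 2 by simp
      with \<open>L \<le> K\<close> show ?thesis
        unfolding ind gl k upper[OF 2(1)] upper[OF 2(2)]
        by (cases "x \<in> A"; cases "r x \<in> A"; cases "y \<in> A"; cases "r y \<in> A")
          (simp_all add: add_ac)
    next
      case 3
      with opp have "K \<le> L" by (simp add: mult_nonpos_nonneg)
      have "\<not> y \<bullet> w < s" using 3 by simp
      with \<open>K \<le> L\<close> show ?thesis
        unfolding ind gl k lower[OF 3(1)] upper[OF 3(2)]
        by (cases "x \<in> A"; cases "r x \<in> A"; cases "y \<in> A"; cases "r y \<in> A")
          (simp_all add: add_ac)
    next
      case 4
      with opp have "K \<le> L" by (simp add: mult_nonneg_nonpos)
      have "\<not> x \<bullet> w < s" using 4 by simp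
      with \<open>K \<le> L\<close> show ?thesis
        unfolding ind gl k upper[OF 4(1)] lower[OF 4(2)]
        by (cases "x \<in> A"; cases "r x \<in> A"; cases "y \<in> A"; cases "r y \<in> A")
          (simp_all add: add_ac)
    qed
  qed
qed


lemma riesz_energy_symmetrize:
  fixes w :: "'a::euclidean_space" and \<alpha> s :: real
  assumes w: "w \<noteq> 0" and A[measurable]: "A \<in> sets borel"
  defines "F \<equiv> \<lambda>x y. indicator A x * indicator A y * riesz_kernel \<alpha> x y"
    and "r \<equiv> reflect w s"
  shows "4 * riesz_energy \<alpha> A = (\<integral>\<^sup>+y. \<integral>\<^sup>+x. (F x y + F (r x) (r y)) + (F (r x) y + F x (r y)) \<partial>lborel \<partial>lborel)"
  unfolding riesz_energy_def r_def F_def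
  by (rule nn_integral_symmetrize_pair[OF w]) measurable

lemma riesz_energy_polarize_gain:
  fixes w :: "'a::euclidean_space" and s :: real
  assumes n: "\<alpha> < real DIM('a)" and w: "w \<noteq> 0" and A[measurable]: "A \<in> sets borel"
  shows "4 * riesz_energy \<alpha> A + (\<integral>\<^sup>+y. \<integral>\<^sup>+x. indicator (gain_set w s A) x * indicator (loss_set w s A) y *
      (riesz_kernel \<alpha> x y - riesz_kernel \<alpha> x (reflect w s y)) \<partial>lborel \<partial>lborel)
    \<le> 4 * riesz_energy \<alpha> (polarize w s A)" (is "_ + ?G \<le> _")
proof -
  let ?r = "reflect w s"
  let ?F = "\<lambda>A x y. indicator A x * indicator A y * riesz_kernel \<alpha> x y"
  let ?S = "\<lambda>A x y. (?F A x y + ?F A (?r x) (?r y)) + (?F A (?r x) y + ?F A x (?r y))"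
  let ?g = "\<lambda>x y. indicator (gain_set w s A) x * indicator (loss_set w s A) y *
      (riesz_kernel \<alpha> x y - riesz_kernel \<alpha> x (?r y))"
  have "4 * riesz_energy \<alpha> A + ?G = (\<integral>\<^sup>+y. \<integral>\<^sup>+x. ?S A x y \<partial>lborel \<partial>lborel) + ?G"
    by (simp only: riesz_energy_symmetrize[OF w A, of \<alpha> s])
  also have "\<dots> = (\<integral>\<^sup>+y. (\<integral>\<^sup>+x. ?S A x y \<partial>lborel) + (\<integral>\<^sup>+x. ?g x y \<partial>lborel) \<partial>lborel)"
    by (rule nn_integral_add[symmetric]) measurable
  also have "\<dots> = (\<integral>\<^sup>+y. \<integral>\<^sup>+x. ?S A x y + ?g x y \<partial>lborel \<partial>lborel)"
    by (intro nn_integral_cong nn_integral_add[symmetric]) measurable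
  also have "\<dots> \<le> (\<integral>\<^sup>+y. \<integral>\<^sup>+x. ?S (polarize w s A) x y \<partial>lborel \<partial>lborel)"
    by (intro nn_integral_mono polarize_pointwise[OF n w])
  also have "\<dots> = 4 * riesz_energy \<alpha> (polarize w s A)"
    by (rule riesz_energy_symmetrize[OF w, symmetric]) measurable
  finally show ?thesis .
qed

lemma riesz_energy_polarize_le:
  fixes w :: "'a::euclidean_space"
  assumes "\<alpha> < real DIM('a)" "w \<noteq> 0" "A \<in> sets borel"
  shows "riesz_energy \<alpha> A \<le> riesz_energy \<alpha> (polarize w s A)"
proof -
  have "4 * riesz_energy \<alpha> A \<le> 4 * riesz_energy \<alpha> (polarize w s A)"
    using riesz_energy_polarize_gain[OF assms, of s] by (rule order_trans[rotated]) simp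
  then show ?thesis
    by (simp add: ennreal_mult_le_mult_iff)
qed

text \<open>Rigidity: if polarization does not increase a finite energy, then one of the two sets between which energy would
  be gained is null.\<close>
lemma riesz_energy_polarize_eq:
  fixes w :: "'a::euclidean_space"
  assumes n: "\<alpha> < real DIM('a)" and w: "w \<noteq> 0" and A[measurable]: "A \<in> sets borel"
    and le: "riesz_energy \<alpha> (polarize w s A) \<le> riesz_energy \<alpha> A" and fin: "riesz_energy \<alpha> A < \<infinity>"
  shows "gain_set w s A \<in> null_sets lborel \<or> loss_set w s A \<in> null_sets lborel"
proof -
  let ?k = "\<lambda>x y. riesz_kernel \<alpha> x y - riesz_kernel \<alpha> x (reflect w s y)"
  let ?g = "\<lambda>x y. indicator (gain_set w s A) x * indicator (loss_set w s A) y * ?k x y"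
  have "4 * riesz_energy \<alpha> A + (\<integral>\<^sup>+y. \<integral>\<^sup>+x. ?g x y \<partial>lborel \<partial>lborel) \<le> 4 * riesz_energy \<alpha> A + 0"
    using order_trans[OF riesz_energy_polarize_gain[OF n w A, of s] mult_left_mono[OF le, of 4]]
    unfolding add_0_right by simp
  moreover have "4 * riesz_energy \<alpha> A < \<infinity>"
    using fin by (simp add: ennreal_mult_less_top)
  ultimately have "(\<integral>\<^sup>+y. \<integral>\<^sup>+x. ?g x y \<partial>lborel \<partial>lborel) = 0"
    using ennreal_add_left_cancel_le[of "4 * riesz_energy \<alpha> A"] by auto
  then have "AE y in lborel. (\<integral>\<^sup>+x. ?g x y \<partial>lborel) = 0"
    by (subst (asm) nn_integral_0_iff_AE) measurable
  then have "AE y in lborel. AE x in lborel. ?g x y = 0"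
    by eventually_elim (subst (asm) nn_integral_0_iff_AE, measurable)
  then have *: "AE y in lborel. y \<in> loss_set w s A \<longrightarrow> (AE x in lborel. x \<notin> gain_set w s A)"
  proof eventually_elim
    case (elim y)
    show ?case
    proof
      assume y: "y \<in> loss_set w s A"
      from elim show "AE x in lborel. x \<notin> gain_set w s A"
      proof eventually_elim
        case (elim x)
        show ?case
        proof
          assume x: "x \<in> gain_set w s A"
          have "x \<noteq> y" using x y by (auto simp: gain_set_def loss_set_def)
          then have "riesz_kernel \<alpha> x (reflect w s y) < riesz_kernel \<alpha> x y"
            using x y by (intro riesz_kernel_reflect_le[OF n w] mult_neg_neg) (auto simp: gain_set_def loss_set_def)
          then have "?k x y \<noteq> 0"
            by (metis diff_eq_0_iff_ennreal not_le ennreal_less_top order_less_le riesz_kernel_def)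
          with elim x y show False by simp
        qed
      qed
    qed
  qed
  show ?thesis
  proof (cases "AE x in lborel. x \<notin> gain_set w s A")
    case True
    then show ?thesis by (simp add: AE_iff_null_sets)
  next
    case False
    with * have "AE y in lborel. y \<notin> loss_set w s A" by (auto elim: eventually_mono)
    then show ?thesis by (simp add: AE_iff_null_sets)
  qed
qed

section \<open>Averaging over reflections\<close>

text \<open>Reflections are parametrized by a normal \<open>w\<close> with \<open>1 \<le> |w| \<le> 2\<close> and a level \<open>s\<close>. For fixed \<open>x\<close> the substitutions
  \<open>s = x \<bullet> w - |w|\<^sup>2 t\<close> and \<open>y = x - 2 t w\<close> turn the measure of the parameters that send \<open>x\<close> into \<open>Q\<close> into an integral over
  \<open>y \<in> Q\<close> of an explicit density, which is bounded below on bounded sets. Letting \<open>w\<close> range over an annulus, and not over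
  the sphere, keeps all changes of variables linear.\<close>

lemma reflect_measurable_all [measurable (raw)]:
  assumes [measurable]: "w \<in> borel_measurable M" "s \<in> borel_measurable M" "f \<in> borel_measurable M"
  shows "(\<lambda>z. reflect (w z :: 'a::euclidean_space) (s z) (f z)) \<in> borel_measurable M"
  unfolding reflect_def by measurable

lemma reflect_average:
  fixes P Q :: "'a::euclidean_space set"
  assumes [measurable]: "P \<in> sets borel" "Q \<in> sets borel"
    and PR: "P \<subseteq> ball 0 R" and QR: "Q \<subseteq> ball 0 R"
    and PQ: "\<And>x y. x \<in> P \<Longrightarrow> y \<in> Q \<Longrightarrow> norm y < norm x" and R: "0 < R"
  shows "ennreal (1 / (4 * (2 * R) ^ (DIM('a) - 1))) * emeasure lborel P * emeasure lborel Q \<le>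
    (\<integral>\<^sup>+w. \<integral>\<^sup>+s. indicator (cball 0 2 - ball 0 1) w * indicator {0..2 * R} s * emeasure lborel {x \<in> P. reflect w s x \<in> Q} \<partial>lborel \<partial>lborel)"
proof -
  let ?W = "cball 0 2 - ball 0 1 :: 'a set"
  let ?K = "ennreal (1 / (4 * (2 * R) ^ (DIM('a) - 1)))"
  have [measurable]: "?W \<in> sets borel" by simp
  \<comment> \<open>For \<open>D = |x - y|\<close> the direction \<open>(x - y) / (2 t)\<close> lies in the annulus if \<open>D/4 \<le> t \<le> D/2\<close>.\<close>
  have t_integral: "?K \<le> (\<integral>\<^sup>+t. indicator {0<..} t * ennreal ((1 / (2 * t)) ^ DIM('a)) * indicator ?W ((1 / (2 * t)) *\<^sub>R (x - y)) \<partial>lborel)"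
    if "x \<in> P" "y \<in> Q" for x y
  proof -
    define D where "D = norm (x - y)"
    have D0: "0 < D" using PQ[OF that] by (auto simp: D_def)
    have "norm x < R" "norm y < R" using that PR QR by auto
    then have D2: "D \<le> 2 * R" unfolding D_def using norm_triangle_ineq4[of x y] by linarith
    have n: "D ^ DIM('a) = D ^ (DIM('a) - 1) * D" 
      by (simp add: power_eq_if)
    have "1 / (4 * (2 * R) ^ (DIM('a) - 1)) \<le> 1 / (4 * D ^ (DIM('a) - 1))"
      using D0 D2 R by (intro divide_left_mono mult_left_mono power_mono mult_pos_pos) auto
    also have "\<dots> = (1 / D) ^ DIM('a) * (D / 2 - D / 4)"
      using D0 by (simp add: n power_one_over field_simps)
    finally have "?K \<le> ennreal ((1 / D) ^ DIM('a)) * ennreal (D / 2 - D / 4)"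
      using D0 by (subst ennreal_mult[symmetric]) (auto intro!: ennreal_leI)
    also have "\<dots> = (\<integral>\<^sup>+t. ennreal ((1 / D) ^ DIM('a)) * indicator {D/4..D/2} t \<partial>lborel)"
      using D0 by (subst nn_integral_cmult_indicator) auto
    also have "\<dots> \<le> (\<integral>\<^sup>+t. indicator {0<..} t * ennreal ((1 / (2 * t)) ^ DIM('a)) * indicator ?W ((1 / (2 * t)) *\<^sub>R (x - y)) \<partial>lborel)"
    proof (rule nn_integral_mono)
      fix t :: real
      show "ennreal ((1 / D) ^ DIM('a)) * indicator {D/4..D/2} t
        \<le> indicator {0<..} t * ennreal ((1 / (2 * t)) ^ DIM('a)) * indicator ?W ((1 / (2 * t)) *\<^sub>R (x - y))"
      proof (cases "t \<in> {D/4..D/2}")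
        case True
        then have t: "0 < t" "D \<le> 4 * t" "2 * t \<le> D" using D0 by auto
        have "norm ((1 / (2 * t)) *\<^sub>R (x - y)) = D / (2 * t)" using t by (simp add: D_def)
        then have "1 \<le> norm ((1 / (2 * t)) *\<^sub>R (x - y))" "norm ((1 / (2 * t)) *\<^sub>R (x - y)) \<le> 2"
          using t by (simp_all add: pos_le_divide_eq pos_divide_le_eq del: norm_scaleR)
        then have "(1 / (2 * t)) *\<^sub>R (x - y) \<in> ?W" by (simp del: norm_scaleR)
        moreover have "(1 / D) ^ DIM('a) \<le> (1 / (2 * t)) ^ DIM('a)"
          using t D0 by (intro power_mono divide_left_mono) auto
        ultimately show ?thesis using t True by (simp add: ennreal_leI)
      qed simp
    qed
    finally show ?thesis .
  qed
  have inner: "?K * emeasure lborel Q \<le> (\<integral>\<^sup>+w. \<integral>\<^sup>+s. indicator ?W w * indicator {0..2 * R} s * indicator Q (reflect w s x) \<partial>lborel \<partial>lborel)"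
    if x: "x \<in> P" for x
  proof -
    have "?K * emeasure lborel Q = (\<integral>\<^sup>+y. ?K * indicator Q y \<partial>lborel)"
      by (simp add: nn_integral_cmult_indicator)
    also have "\<dots> \<le> (\<integral>\<^sup>+y. \<integral>\<^sup>+t. indicator {0<..} t * ennreal ((1 / (2 * t)) ^ DIM('a)) * indicator ?W ((1 / (2 * t)) *\<^sub>R (x - y)) * indicator Q y \<partial>lborel \<partial>lborel)"
    proof (rule nn_integral_mono)
      fix y
      show "?K * indicator Q y \<le> (\<integral>\<^sup>+t. indicator {0<..} t * ennreal ((1 / (2 * t)) ^ DIM('a)) * indicator ?W ((1 / (2 * t)) *\<^sub>R (x - y)) * indicator Q y \<partial>lborel)"
        using t_integral[OF x, of y] by (cases "y \<in> Q") auto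
    qed
    also have "\<dots> = (\<integral>\<^sup>+t. \<integral>\<^sup>+y. indicator {0<..} t * ennreal ((1 / (2 * t)) ^ DIM('a)) * indicator ?W ((1 / (2 * t)) *\<^sub>R (x - y)) * indicator Q y \<partial>lborel \<partial>lborel)"
      by (rule lborel_pair.Fubini') measurable
    also have "\<dots> = (\<integral>\<^sup>+t. \<integral>\<^sup>+w. indicator {0<..} t * indicator ?W w * indicator Q (x - (2 * t) *\<^sub>R w) \<partial>lborel \<partial>lborel)"
    proof (rule nn_integral_cong)
      fix t :: real
      show "(\<integral>\<^sup>+y. indicator {0<..} t * ennreal ((1 / (2 * t)) ^ DIM('a)) * indicator ?W ((1 / (2 * t)) *\<^sub>R (x - y)) * indicator Q y \<partial>lborel)
         = (\<integral>\<^sup>+w. indicator {0<..} t * indicator ?W w * indicator Q (x - (2 * t) *\<^sub>R w) \<partial>lborel)"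
      proof (cases "0 < t")
        case True
        have "(\<integral>\<^sup>+w. indicator ?W w * indicator Q (x - (2 * t) *\<^sub>R w) \<partial>lborel)
           = ennreal ((1 / (2 * t)) ^ DIM('a)) * (\<integral>\<^sup>+y. indicator ?W ((1 / (2 * t)) *\<^sub>R x + (- (1 / (2 * t))) *\<^sub>R y) * indicator Q (x - (2 * t) *\<^sub>R ((1 / (2 * t)) *\<^sub>R x + (- (1 / (2 * t))) *\<^sub>R y)) \<partial>lborel)"
          using True by (subst nn_integral_lborel_affine[where c="- (1 / (2 * t))" and t="(1 / (2 * t)) *\<^sub>R x"]) auto
        also have "\<dots> = ennreal ((1 / (2 * t)) ^ DIM('a)) * (\<integral>\<^sup>+y. indicator ?W ((1 / (2 * t)) *\<^sub>R (x - y)) * indicator Q y \<partial>lborel)"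
          using True by (simp add: scaleR_diff_right)
        finally show ?thesis using True by (simp add: nn_integral_cmult[symmetric] mult.assoc)
      qed simp
    qed
    also have "\<dots> = (\<integral>\<^sup>+w. \<integral>\<^sup>+t. indicator {0<..} t * indicator ?W w * indicator Q (x - (2 * t) *\<^sub>R w) \<partial>lborel \<partial>lborel)"
      by (rule lborel_pair.Fubini'[symmetric]) measurable
    also have "\<dots> \<le> (\<integral>\<^sup>+w. \<integral>\<^sup>+s. indicator ?W w * indicator {0..2 * R} s * indicator Q (reflect w s x) \<partial>lborel \<partial>lborel)"
    proof (rule nn_integral_mono)
      fix w :: 'a
      show "(\<integral>\<^sup>+t. indicator {0<..} t * indicator ?W w * indicator Q (x - (2 * t) *\<^sub>R w) \<partial>lborel)
        \<le> (\<integral>\<^sup>+s. indicator ?W w * indicator {0..2 * R} s * indicator Q (reflect w s x) \<partial>lborel)"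
      proof (cases "w \<in> ?W")
        case True
        then have w: "1 \<le> norm w" "norm w \<le> 2" "w \<noteq> 0" by auto
        have ww: "w \<bullet> w = (norm w)\<^sup>2" "1 \<le> w \<bullet> w" using w(1) by (simp_all add: power2_norm_eq_inner[symmetric] one_le_power)
        have refl: "reflect w (x \<bullet> w + (- (w \<bullet> w)) * t) x = x - (2 * t) *\<^sub>R w" for t
          using w by (simp add: reflect_def)
        have "(\<integral>\<^sup>+t. indicator {0<..} t * indicator Q (x - (2 * t) *\<^sub>R w) \<partial>lborel)
          \<le> (\<integral>\<^sup>+t. indicator {0..2 * R} (x \<bullet> w + (- (w \<bullet> w)) * t) * indicator Q (x - (2 * t) *\<^sub>R w) \<partial>lborel)"
        proof (rule nn_integral_mono)
          fix t :: real
          have "x \<bullet> w + (- (w \<bullet> w)) * t \<in> {0..2 * R}" if "0 < t" and y: "x - (2 * t) *\<^sub>R w \<in> Q"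
          proof -
            define y where "y = x - (2 * t) *\<^sub>R w"
            have yQ: "y \<in> Q" using y by (simp add: y_def)
            have s: "x \<bullet> w + (- (w \<bullet> w)) * t = (1 / 2) * ((x + y) \<bullet> w)"
              by (simp add: y_def inner_add_left inner_diff_left)
            \<comment> \<open>Since \<open>|y| < |x|\<close>, the hyperplane that exchanges \<open>x\<close> and \<open>y\<close> leaves the origin on the side of \<open>y\<close>, so \<open>s > 0\<close>.\<close>
            have "(norm x)\<^sup>2 - (norm y)\<^sup>2 = (x - y) \<bullet> (x + y)"
              by (simp add: power2_norm_eq_inner algebra_simps inner_diff_left inner_add_right inner_commute)
            also have "\<dots> = 2 * t * ((x + y) \<bullet> w)"
              by (simp add: y_def inner_commute)
            finally have "2 * t * ((x + y) \<bullet> w) > 0"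
              using PQ[OF x yQ] by (smt (verit) norm_ge_zero power_strict_mono pos2)
            then have "0 < (x + y) \<bullet> w" using that(1) by (simp add: zero_less_mult_iff)
            moreover have "(x + y) \<bullet> w \<le> 4 * R"
            proof -
              have "norm x < R" "norm y < R" using x yQ PR QR by auto
              then have "norm (x + y) \<le> 2 * R" using norm_triangle_ineq[of x y] by linarith
              then have "norm (x + y) * norm w \<le> (2 * R) * 2" using w R by (intro mult_mono) auto
              then show ?thesis using norm_cauchy_schwarz[of "x + y" w] by linarith
            qed
            ultimately show ?thesis unfolding s by auto
          qed
          then show "indicator {0<..} t * indicator Q (x - (2 * t) *\<^sub>R w)
            \<le> (indicator {0..2 * R} (x \<bullet> w + (- (w \<bullet> w)) * t) * indicator Q (x - (2 * t) *\<^sub>R w) :: ennreal)"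
            by (auto simp: indicator_def)
        qed
        also have "\<dots> \<le> ennreal \<bar>- (w \<bullet> w)\<bar> * \<dots>"
          using ww(2) mult_right_mono[of 1 "ennreal \<bar>- (w \<bullet> w)\<bar>"] by simp
        also have "\<dots> = (\<integral>\<^sup>+s. indicator {0..2 * R} s * indicator Q (reflect w s x) \<partial>lborel)"
          using w by (subst nn_integral_real_affine[where c="- (w \<bullet> w)" and t="x \<bullet> w"]) (simp_all only: refl, auto)
        finally show ?thesis using True by simp
      qed simp
    qed
    finally show ?thesis .
  qed
  have "?K * emeasure lborel P * emeasure lborel Q = (\<integral>\<^sup>+x. ?K * emeasure lborel Q * indicator P x \<partial>lborel)"
    by (subst nn_integral_cmult_indicator) (auto simp: mult_ac)
  also have "\<dots> \<le> (\<integral>\<^sup>+x. \<integral>\<^sup>+w. \<integral>\<^sup>+s. indicator ?W w * indicator {0..2 * R} s * indicator Q (reflect w s x) * indicator P x \<partial>lborel \<partial>lborel \<partial>lborel)"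
  proof (rule nn_integral_mono)
    fix x
    show "?K * emeasure lborel Q * indicator P x \<le> (\<integral>\<^sup>+w. \<integral>\<^sup>+s. indicator ?W w * indicator {0..2 * R} s * indicator Q (reflect w s x) * indicator P x \<partial>lborel \<partial>lborel)"
      using inner[of x] by (cases "x \<in> P") auto
  qed
  also have "\<dots> = (\<integral>\<^sup>+w. \<integral>\<^sup>+x. \<integral>\<^sup>+s. indicator ?W w * indicator {0..2 * R} s * indicator Q (reflect w s x) * indicator P x \<partial>lborel \<partial>lborel \<partial>lborel)"
    by (rule lborel_pair.Fubini') measurable
  also have "\<dots> = (\<integral>\<^sup>+w. \<integral>\<^sup>+s. \<integral>\<^sup>+x. indicator ?W w * indicator {0..2 * R} s * indicator Q (reflect w s x) * indicator P x \<partial>lborel \<partial>lborel \<partial>lborel)"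
    by (rule nn_integral_cong, rule lborel_pair.Fubini') measurable
  also have "\<dots> = (\<integral>\<^sup>+w. \<integral>\<^sup>+s. indicator ?W w * indicator {0..2 * R} s * emeasure lborel {x \<in> P. reflect w s x \<in> Q} \<partial>lborel \<partial>lborel)"
  proof (intro nn_integral_cong)
    fix w :: 'a and s :: real
    have [measurable]: "{x \<in> P. reflect w s x \<in> Q} \<in> sets borel"
    proof -
      have "{x \<in> P. reflect w s x \<in> Q} = {x \<in> space borel. x \<in> P \<and> reflect w s x \<in> Q}" by auto
      also have "\<dots> \<in> sets borel" by measurable
      finally show ?thesis .
    qed
    have "(\<integral>\<^sup>+x. indicator ?W w * indicator {0..2 * R} s * indicator Q (reflect w s x) * indicator P x \<partial>lborel)
      = (\<integral>\<^sup>+x. indicator ?W w * indicator {0..2 * R} s * indicator {x \<in> P. reflect w s x \<in> Q} x \<partial>lborel)"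
      by (intro nn_integral_cong) (auto simp: indicator_def)
    then show "(\<integral>\<^sup>+x. indicator ?W w * indicator {0..2 * R} s * indicator Q (reflect w s x) * indicator P x \<partial>lborel)
      = indicator ?W w * indicator {0..2 * R} s * emeasure lborel {x \<in> P. reflect w s x \<in> Q}"
      by (simp add: nn_integral_cmult_indicator)
  qed
  finally show ?thesis .
qed

text \<open>If every reflection moved less than the claimed portion of \<open>P\<close> into \<open>Q\<close>, integrating over the bounded
  parameter domain would contradict the preceding lower bound. The constant \<open>\<kappa>\<close> depends only on \<open>R\<close> and the dimension.\<close>
lemma exists_good_reflection:
  fixes R :: real
  assumes R: "0 < R"
  shows "\<exists>\<kappa>>0. \<forall>P Q :: 'a::euclidean_space set. P \<in> sets borel \<longrightarrow> Q \<in> sets borel \<longrightarrow> P \<subseteq> ball 0 R \<longrightarrow> Q \<subseteq> ball 0 R \<longrightarrow>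
    (\<forall>x\<in>P. \<forall>y\<in>Q. norm y < norm x) \<longrightarrow>
    (\<exists>w s. w \<noteq> 0 \<and> 0 \<le> s \<and> \<kappa> * measure lborel P * measure lborel Q \<le> measure lborel {x \<in> P. reflect w s x \<in> Q})"
proof -
  let ?W = "cball 0 2 - ball 0 1 :: 'a set"
  define K where "K = 1 / (4 * (2 * R) ^ (DIM('a) - 1))"
  define V where "V = measure lborel ?W"
  define \<kappa> where "\<kappa> = K / (V * (2 * R) + 1)"
  have K: "0 < K" using R by (simp add: K_def)
  have V: "0 \<le> V" by (simp add: V_def)
  have pos: "0 < V * (2 * R) + 1" using V R by (simp add: add_nonneg_pos)
  have kap: "0 < \<kappa>" using K pos by (simp add: \<kappa>_def)
  have bnd: "emeasure lborel S = ennreal (measure lborel S)" if "S \<subseteq> ball 0 r" for S :: "'a set" and r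
  proof (rule emeasure_eq_ennreal_measure)
    show "emeasure lborel S \<noteq> top"
      using emeasure_bounded_finite[OF bounded_subset[OF bounded_ball that]] by simp
  qed
  have emV: "emeasure lborel ?W = ennreal V"
    unfolding V_def by (rule bnd[of _ 3]) auto
  show ?thesis
  proof (intro exI[of _ \<kappa>] conjI kap allI impI)
    fix P Q :: "'a set"
    assume [measurable]: "P \<in> sets borel" "Q \<in> sets borel" and PR: "P \<subseteq> ball 0 R" and QR: "Q \<subseteq> ball 0 R"
      and PQ: "\<forall>x\<in>P. \<forall>y\<in>Q. norm y < norm x"
    define p where "p = measure lborel P"
    define q where "q = measure lborel Q"
    show "\<exists>w s. w \<noteq> 0 \<and> 0 \<le> s \<and> \<kappa> * measure lborel P * measure lborel Q \<le> measure lborel {x \<in> P. reflect w s x \<in> Q}"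
    proof (rule ccontr)
      assume "\<not> ?thesis"
      then have no: "measure lborel {x \<in> P. reflect w s x \<in> Q} < \<kappa> * p * q" if "w \<noteq> 0" "0 \<le> s" for w s
        using that by (force simp: p_def q_def)
      obtain b :: 'a where "b \<in> Basis" using nonempty_Basis by blast
      then have "b \<noteq> 0" by auto
      then have "0 < \<kappa> * p * q"
        using le_less_trans[OF measure_nonneg no[of b 0]] by simp
      then have pq: "0 < p * q" using kap by (simp add: mult.assoc zero_less_mult_iff)
      have "ennreal (K * (p * q)) = ennreal K * emeasure lborel P * emeasure lborel Q"
        using K by (simp add: bnd[OF PR] bnd[OF QR] p_def q_def ennreal_mult mult.assoc)
      also have "\<dots> \<le> (\<integral>\<^sup>+w. \<integral>\<^sup>+s. indicator ?W w * indicator {0..2 * R} s * emeasure lborel {x \<in> P. reflect w s x \<in> Q} \<partial>lborel \<partial>lborel)"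
        unfolding K_def using PQ by (intro reflect_average PR QR R) auto
      also have "\<dots> \<le> (\<integral>\<^sup>+w. \<integral>\<^sup>+s. ennreal (\<kappa> * p * q) * indicator ?W w * indicator {0..2 * R} s \<partial>lborel \<partial>lborel)"
      proof (intro nn_integral_mono)
        fix w :: 'a and s :: real
        have "emeasure lborel {x \<in> P. reflect w s x \<in> Q} \<le> ennreal (\<kappa> * p * q)" if "w \<in> ?W" "0 \<le> s"
        proof -
          have "{x \<in> P. reflect w s x \<in> Q} \<subseteq> ball 0 R" using PR by auto
          moreover have "w \<noteq> 0" using that by auto
          ultimately show ?thesis using no[of w s] that by (simp add: bnd ennreal_leI)
        qed
        then show "indicator ?W w * indicator {0..2 * R} s * emeasure lborel {x \<in> P. reflect w s x \<in> Q}
           \<le> ennreal (\<kappa> * p * q) * indicator ?W w * indicator {0..2 * R} s"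
          by (auto simp: indicator_def)
      qed
      also have "\<dots> = (\<integral>\<^sup>+w. ennreal (\<kappa> * p * q) * ennreal (2 * R) * indicator ?W w \<partial>lborel)"
        using R by (intro nn_integral_cong, subst nn_integral_cmult_indicator) (auto simp: mult_ac)
      also have "\<dots> = ennreal (\<kappa> * p * q) * ennreal (2 * R) * ennreal V"
        by (subst nn_integral_cmult_indicator) (auto simp: emV)
      also have "\<dots> = ennreal (\<kappa> * (V * (2 * R)) * (p * q))"
        using R V pq kap \<open>0 < \<kappa> * p * q\<close> by (simp add: ennreal_mult[symmetric] mult_ac)
      finally have "K * (p * q) \<le> \<kappa> * (V * (2 * R)) * (p * q)"
        using R V pq kap by (subst (asm) ennreal_le_iff) (auto simp: mult.assoc)
      then have "K \<le> \<kappa> * (V * (2 * R))" using pq by (rule mult_right_le_imp_le)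
      also have "\<dots> < \<kappa> * (V * (2 * R) + 1)" using kap by simp
      also have "\<dots> = K" using pos by (simp add: \<kappa>_def)
      finally show False by simp
    qed
  qed
qed

section \<open>The potential of a ball\<close>

lemma nn_integral_powr_from_0:
  fixes a c :: real
  assumes "-1 < a" "0 \<le> c"
  shows "(\<integral>\<^sup>+t. ennreal (t powr a) * indicator {0..c} t \<partial>lborel) = ennreal (c powr (a + 1) / (a + 1))"
  using nn_integral_has_integral_lebesgue'[OF _ has_integral_powr_from_0[OF assms]] by simp

text \<open>Layer-cake formula in the radius: \<open>|z|\<^sup>\<alpha>\<^sup>-\<^sup>n\<close> is \<open>\<rho>\<^sup>\<alpha>\<^sup>-\<^sup>n\<close> plus the integral of \<open>(n - \<alpha>) s\<^sup>\<alpha>\<^sup>-\<^sup>n\<^sup>-\<^sup>1\<close> over \<open>|z| \<le> s \<le> \<rho>\<close>, which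
  reduces the potential to the volumes of balls.\<close>
lemma riesz_potential_cball:
  fixes y :: "'a::euclidean_space"
  assumes \<alpha>: "0 < \<alpha>" "\<alpha> < real DIM('a)" and \<rho>: "0 < \<rho>"
  shows "(\<integral>\<^sup>+x. indicator (cball y \<rho>) x * riesz_kernel \<alpha> x y \<partial>lborel)
    = ennreal (real DIM('a) * unit_ball_vol (real DIM('a)) * \<rho> powr \<alpha> / \<alpha>)"
proof -
  define n where "n = real DIM('a)"
  define \<omega> where "\<omega> = unit_ball_vol n"
  have \<omega>: "0 < \<omega>" by (simp add: \<omega>_def n_def)
  have na: "0 < n - \<alpha>" using \<alpha> by (simp add: n_def)
  have vol: "emeasure lborel (cball (0::'a) s) = ennreal (\<omega> * s powr n)" if "0 < s" for s
    using that by (simp add: emeasure_cball \<omega>_def n_def powr_realpow)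
  let ?g = "\<lambda>s. ennreal ((n - \<alpha>) * s powr (\<alpha> - n - 1))"
  let ?C = "cball 0 \<rho> :: 'a set"
  have [measurable]: "?C \<in> sets borel" "cball y \<rho> \<in> sets borel" by simp_all
  have layer: "indicator ?C z * riesz_kernel \<alpha> z 0 = 
      ennreal (\<rho> powr (\<alpha> - n)) * indicator ?C z + (\<integral>\<^sup>+s. ?g s * indicator {norm z..\<rho>} s \<partial>lborel)"
    if z: "z \<noteq> 0" for z :: 'a
  proof (cases "norm z \<le> \<rho>")
    case True
    have "(\<integral>\<^sup>+s. ?g s * indicator {norm z..\<rho>} s \<partial>lborel) = ennreal (- (\<rho> powr (\<alpha> - n)) - (- (norm z powr (\<alpha> - n))))"
    proof (rule nn_integral_FTC_Icc)
      show "((\<lambda>s. - (s powr (\<alpha> - n))) has_real_derivative (n - \<alpha>) * s powr (\<alpha> - n - 1)) (at s)"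
        if "s \<in> {norm z..\<rho>}" for s
      proof -
        have "0 < s" using that z by (meson atLeastAtMost_iff less_le_trans zero_less_norm_iff)
        then show ?thesis
          using DERIV_minus[OF has_real_derivative_powr[of s "\<alpha> - n"]] by (simp add: minus_mult_left)
      qed
    qed (use True na in auto)
    moreover have "riesz_kernel \<alpha> z 0 = ennreal (norm z powr (\<alpha> - n))"
      using powr_minus_divide[of "norm z" "n - \<alpha>"] by (simp add: riesz_kernel_def n_def)
    moreover have "\<rho> powr (\<alpha> - n) \<le> norm z powr (\<alpha> - n)"
      using True z na by (intro powr_mono2') auto
    ultimately show ?thesis
      using True by (simp add: ennreal_plus[symmetric] del: ennreal_plus)
  qed simp
  have "(\<integral>\<^sup>+x. indicator (cball y \<rho>) x * riesz_kernel \<alpha> x y \<partial>lborel) = (\<integral>\<^sup>+z. indicator (cball y \<rho>) (z + y) * riesz_kernel \<alpha> (z + y) y \<partial>lborel)"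
    by (rule nn_integral_lborel_translate[symmetric]) measurable
  also have "\<dots> = (\<integral>\<^sup>+z. indicator ?C z * riesz_kernel \<alpha> z 0 \<partial>lborel)"
    by (intro nn_integral_cong) (simp add: riesz_kernel_def indicator_def dist_norm)
  also have "\<dots> = (\<integral>\<^sup>+z. ennreal (\<rho> powr (\<alpha> - n)) * indicator ?C z + (\<integral>\<^sup>+s. ?g s * indicator {norm z..\<rho>} s \<partial>lborel) \<partial>lborel)"
    by (rule nn_integral_cong_AE, rule eventually_mono[OF AE_lborel_singleton[of 0]]) (rule layer)
  also have "\<dots> = (\<integral>\<^sup>+z. ennreal (\<rho> powr (\<alpha> - n)) * indicator ?C z \<partial>lborel) + (\<integral>\<^sup>+z. \<integral>\<^sup>+s. ?g s * indicator {norm (z::'a)..\<rho>} s \<partial>lborel \<partial>lborel)"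
  proof (rule nn_integral_add)
    show "(\<lambda>z::'a. \<integral>\<^sup>+s. ?g s * indicator {norm (z::'a)..\<rho>} s \<partial>lborel) \<in> borel_measurable lborel"
      unfolding indicator_def atLeastAtMost_iff by measurable
  qed measurable
  also have "(\<integral>\<^sup>+z. \<integral>\<^sup>+s. ?g s * indicator {norm (z::'a)..\<rho>} s \<partial>lborel \<partial>lborel) = (\<integral>\<^sup>+s. \<integral>\<^sup>+z. ?g s * indicator {norm (z::'a)..\<rho>} s \<partial>lborel \<partial>lborel)"
    unfolding indicator_def atLeastAtMost_iff by (rule lborel_pair.Fubini') measurable
  also have "\<dots> = (\<integral>\<^sup>+s. ennreal (\<omega> * (n - \<alpha>)) * (ennreal (s powr (\<alpha> - 1)) * indicator {0..\<rho>} s) \<partial>lborel)"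
  proof (rule nn_integral_cong_AE, rule eventually_mono[OF AE_lborel_singleton[of 0]])
    fix s :: real assume s: "s \<noteq> 0"
    show "(\<integral>\<^sup>+z. ?g s * indicator {norm (z::'a)..\<rho>} s \<partial>lborel) = ennreal (\<omega> * (n - \<alpha>)) * (ennreal (s powr (\<alpha> - 1)) * indicator {0..\<rho>} s)"
    proof (cases "0 < s \<and> s \<le> \<rho>")
      case True
      then have "(\<integral>\<^sup>+z. ?g s * indicator {norm (z::'a)..\<rho>} s \<partial>lborel) = (\<integral>\<^sup>+z. ?g s * indicator (cball (0::'a) s) z \<partial>lborel)"
        by (intro nn_integral_cong) (simp add: indicator_def)
      also have "\<dots> = ?g s * ennreal (\<omega> * s powr n)"
        using True by (simp add: nn_integral_cmult_indicator vol)
      also have "\<dots> = ennreal (\<omega> * (n - \<alpha>) * (s powr (\<alpha> - n - 1) * s powr n))"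
        using na \<omega> by (simp add: ennreal_mult[symmetric] mult_ac)
      also have "s powr (\<alpha> - n - 1) * s powr n = s powr (\<alpha> - 1)"
        by (simp add: powr_add[symmetric])
      finally show ?thesis using True na \<omega> by (simp add: ennreal_mult)
    next
      case False
      then have "indicator {norm (z::'a)..\<rho>} s = (0::ennreal)" for z
        using s norm_ge_zero[of z] unfolding indicator_def by (auto simp del: norm_ge_zero)
      then show ?thesis using False s by simp
    qed
  qed
  also have "\<dots> = ennreal (\<omega> * (n - \<alpha>)) * ennreal (\<rho> powr \<alpha> / \<alpha>)"
    using nn_integral_powr_from_0[of "\<alpha> - 1" \<rho>] \<alpha> \<rho> by (simp add: nn_integral_cmult)
  also have "(\<integral>\<^sup>+z. ennreal (\<rho> powr (\<alpha> - n)) * indicator ?C z \<partial>lborel) = ennreal (\<rho> powr (\<alpha> - n)) * ennreal (\<omega> * \<rho> powr n)"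
    using \<rho> by (simp add: nn_integral_cmult_indicator vol)
  also have "\<dots> + ennreal (\<omega> * (n - \<alpha>)) * ennreal (\<rho> powr \<alpha> / \<alpha>) = ennreal (\<omega> * (\<rho> powr (\<alpha> - n) * \<rho> powr n) + \<omega> * (n - \<alpha>) * (\<rho> powr \<alpha> / \<alpha>))"
    using \<omega> na \<alpha> by (simp add: ennreal_mult[symmetric] ennreal_plus[symmetric] mult_ac del: ennreal_plus)
  also have "\<rho> powr (\<alpha> - n) * \<rho> powr n = \<rho> powr \<alpha>"
    by (simp add: powr_add[symmetric])
  also have "\<omega> * \<rho> powr \<alpha> + \<omega> * (n - \<alpha>) * (\<rho> powr \<alpha> / \<alpha>) = n * \<omega> * \<rho> powr \<alpha> / \<alpha>"
    using \<alpha> by (simp add: field_simps)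
  finally show ?thesis by (simp add: n_def \<omega>_def)
qed

lemma riesz_potential_le:
  fixes y :: "'a::euclidean_space"
  assumes \<alpha>: "0 < \<alpha>" "\<alpha> < real DIM('a)" and [measurable]: "A \<in> sets borel"
  shows "(\<integral>\<^sup>+x. indicator A x * riesz_kernel \<alpha> x y \<partial>lborel)
    \<le> ennreal (real DIM('a) * unit_ball_vol (real DIM('a)) / \<alpha>) + emeasure lborel A"
proof -
  have [measurable]: "cball y 1 \<in> sets borel" by simp
  have "(\<integral>\<^sup>+x. indicator A x * riesz_kernel \<alpha> x y \<partial>lborel)
    \<le> (\<integral>\<^sup>+x. indicator (cball y 1) x * riesz_kernel \<alpha> x y + indicator A x \<partial>lborel)"
  proof (rule nn_integral_mono)
    fix x
    show "indicator A x * riesz_kernel \<alpha> x y \<le> indicator (cball y 1) x * riesz_kernel \<alpha> x y + indicator A x"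
    proof (cases "x \<in> cball y 1")
      case True
      then show ?thesis by (cases "x \<in> A") (auto intro: add_increasing2)
    next
      case False
      then have "1 < norm (x - y)" by (simp add: dist_norm norm_minus_commute)
      then have "1 \<le> norm (x - y) powr (real DIM('a) - \<alpha>)"
        using \<alpha> by (intro ge_one_powr_ge_zero) auto
      moreover from this have "0 < norm (x - y) powr (real DIM('a) - \<alpha>)"
        using zero_less_one by (rule less_le_trans[rotated])
      ultimately have "riesz_kernel \<alpha> x y \<le> 1"
        by (simp add: riesz_kernel_def del: powr_gt_zero)
      then show ?thesis using False by (cases "x \<in> A") auto
    qed
  qed
  also have "\<dots> = (\<integral>\<^sup>+x. indicator (cball y 1) x * riesz_kernel \<alpha> x y \<partial>lborel) + emeasure lborel A"
    by (simp add: nn_integral_add)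
  finally show ?thesis using riesz_potential_cball[OF \<alpha>, of 1 y] by simp
qed

text \<open>The mutual energy, the integral of the kernel over \<open>A \<times> B\<close>.\<close>
definition riesz_mutual :: "real \<Rightarrow> 'a::euclidean_space set \<Rightarrow> 'a set \<Rightarrow> ennreal" where
  "riesz_mutual \<alpha> A B = (\<integral>\<^sup>+y. \<integral>\<^sup>+x. indicator A x * indicator B y * riesz_kernel \<alpha> x y \<partial>lborel \<partial>lborel)"

lemma riesz_mutual_commute:
  assumes [measurable]: "A \<in> sets borel" "B \<in> sets borel"
  shows "riesz_mutual \<alpha> A B = riesz_mutual \<alpha> B A"
  unfolding riesz_mutual_def
  by (subst lborel_pair.Fubini') (auto simp: riesz_kernel_commute mult_ac)

lemma riesz_mutual_le:
  fixes A B :: "'a::euclidean_space set"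
  assumes \<alpha>: "0 < \<alpha>" "\<alpha> < real DIM('a)" and [measurable]: "A \<in> sets borel" "B \<in> sets borel"
  shows "riesz_mutual \<alpha> A B \<le> (ennreal (real DIM('a) * unit_ball_vol (real DIM('a)) / \<alpha>) + emeasure lborel A) * emeasure lborel B"
    (is "_ \<le> ?C * _")
proof -
  have "riesz_mutual \<alpha> A B = (\<integral>\<^sup>+y. (\<integral>\<^sup>+x. indicator A x * riesz_kernel \<alpha> x y \<partial>lborel) * indicator B y \<partial>lborel)"
    unfolding riesz_mutual_def by (subst nn_integral_multc[symmetric]) (auto simp: mult_ac)
  also have "\<dots> \<le> (\<integral>\<^sup>+y. ?C * indicator B y \<partial>lborel)"
    by (intro nn_integral_mono mult_right_mono riesz_potential_le[OF \<alpha>]) auto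
  finally show ?thesis by (simp add: nn_integral_cmult_indicator)
qed

lemma riesz_energy_finite:
  fixes A :: "'a::euclidean_space set"
  assumes \<alpha>: "0 < \<alpha>" "\<alpha> < real DIM('a)" and A: "A \<in> sets borel" and fin: "emeasure lborel A < \<infinity>"
  shows "riesz_energy \<alpha> A < \<infinity>"
proof -
  have "riesz_energy \<alpha> A = riesz_mutual \<alpha> A A" by (simp add: riesz_energy_def riesz_mutual_def)
  also have "\<dots> \<le> (ennreal (real DIM('a) * unit_ball_vol (real DIM('a)) / \<alpha>) + emeasure lborel A) * emeasure lborel A"
    by (rule riesz_mutual_le[OF \<alpha> A A])
  also have "\<dots> < \<infinity>" using fin by (simp add: ennreal_mult_less_top)
  finally show ?thesis .
qed

lemma riesz_energy_mono: "A \<subseteq> B \<Longrightarrow> riesz_energy \<alpha> A \<le> riesz_energy \<alpha> B"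
  unfolding riesz_energy_def
  by (intro nn_integral_mono mult_right_mono mult_mono) (auto simp: indicator_def)

text \<open>Continuity of the energy: replacing \<open>A\<close> by \<open>B\<close> lowers the energy by at most \<open>|A - B|\<close> times a constant that depends only on
  \<open>|A|\<close>, \<open>\<alpha>\<close> and the dimension.\<close>
lemma riesz_energy_le_Diff:
  fixes A B :: "'a::euclidean_space set"
  assumes \<alpha>: "0 < \<alpha>" "\<alpha> < real DIM('a)" and [measurable]: "A \<in> sets borel" "B \<in> sets borel"
  shows "riesz_energy \<alpha> A \<le> riesz_energy \<alpha> B +
    2 * ((ennreal (real DIM('a) * unit_ball_vol (real DIM('a)) / \<alpha>) + emeasure lborel A) * emeasure lborel (A - B))"
proof -
  have "riesz_energy \<alpha> A \<le> (\<integral>\<^sup>+y. \<integral>\<^sup>+x. indicator B x * indicator B y * riesz_kernel \<alpha> x y +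
     (indicator A x * indicator (A - B) y * riesz_kernel \<alpha> x y + indicator (A - B) x * indicator A y * riesz_kernel \<alpha> x y) \<partial>lborel \<partial>lborel)"
    unfolding riesz_energy_def by (intro nn_integral_mono) (auto simp: indicator_def)
  also have "\<dots> = riesz_energy \<alpha> B + (riesz_mutual \<alpha> A (A - B) + riesz_mutual \<alpha> (A - B) A)"
    unfolding riesz_energy_def riesz_mutual_def by (simp add: nn_integral_add)
  also have "riesz_mutual \<alpha> (A - B) A = riesz_mutual \<alpha> A (A - B)"
    by (rule riesz_mutual_commute) measurable
  also have "riesz_energy \<alpha> B + (riesz_mutual \<alpha> A (A - B) + riesz_mutual \<alpha> A (A - B)) = riesz_energy \<alpha> B + 2 * riesz_mutual \<alpha> A (A - B)"
    by (simp add: mult_2)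
  also have "\<dots> \<le> riesz_energy \<alpha> B +
    2 * ((ennreal (real DIM('a) * unit_ball_vol (real DIM('a)) / \<alpha>) + emeasure lborel A) * emeasure lborel (A - B))"
    by (intro add_left_mono mult_left_mono riesz_mutual_le[OF \<alpha>]) auto
  finally show ?thesis .
qed

section \<open>The Riesz inequality for sets\<close>

lemma nn_integral_symmetrize:
  fixes w :: "'a::euclidean_space"
  assumes w: "w \<noteq> 0" and [measurable]: "f \<in> borel_measurable borel"
  shows "(\<integral>\<^sup>+x. f x + f (reflect w s x) \<partial>lborel) = 2 * (\<integral>\<^sup>+x. f x \<partial>lborel)"
  using nn_integral_reflect[OF w, of f s] by (simp add: nn_integral_add mult_2)

lemma polarize_below:
  "x \<bullet> w \<le> s \<Longrightarrow> x \<in> polarize w s A \<longleftrightarrow> x \<in> A \<or> reflect w s x \<in> A"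
  by (auto simp: polarize_def reflect_on_hyperplane)

lemma polarize_above:
  "s \<le> x \<bullet> w \<Longrightarrow> x \<in> polarize w s A \<longleftrightarrow> x \<in> A \<and> reflect w s x \<in> A"
  by (auto simp: polarize_def reflect_on_hyperplane)

lemma emeasure_polarize:
  fixes w :: "'a::euclidean_space"
  assumes w: "w \<noteq> 0" and [measurable]: "A \<in> sets borel"
  shows "emeasure lborel (polarize w s A) = emeasure lborel A"
proof -
  have "2 * emeasure lborel (polarize w s A) = (\<integral>\<^sup>+x. indicator (polarize w s A) x + indicator (polarize w s A) (reflect w s x) \<partial>lborel)"
    by (subst nn_integral_symmetrize[OF w]) auto
  also have "\<dots> = (\<integral>\<^sup>+x. indicator A x + indicator A (reflect w s x) \<partial>lborel)"
  proof (rule nn_integral_cong)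
    fix x
    have "reflect w s x \<bullet> w = 2 * s - x \<bullet> w" by (rule inner_reflect[OF w])
    then show "indicator (polarize w s A) x + indicator (polarize w s A) (reflect w s x) = (indicator A x + indicator A (reflect w s x) :: ennreal)"
      using w by (cases "x \<bullet> w \<le> s") (auto simp: indicator_def polarize_below polarize_above)
  qed
  also have "\<dots> = 2 * emeasure lborel A"
    by (subst nn_integral_symmetrize[OF w]) auto
  finally show ?thesis by (simp add: ennreal_mult_cancel_left)
qed

lemma norm_reflect_ge:
  assumes "w \<noteq> 0" "0 \<le> s" "x \<bullet> w \<le> s"
  shows "norm x \<le> norm (reflect w s x)"
proof (rule power2_le_imp_le)
  have "4 * s * (x \<bullet> w - s) / (w \<bullet> w) \<le> 0"
    using assms by (intro divide_nonpos_nonneg mult_nonneg_nonpos) auto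
  then show "(norm x)\<^sup>2 \<le> (norm (reflect w s x))\<^sup>2"
    using norm_reflect_sq[OF assms(1), of s x] by simp
qed simp

lemma polarize_subset_ball:
  fixes w :: "'a::euclidean_space"
  assumes "w \<noteq> 0" "0 \<le> s" "A \<subseteq> ball 0 R"
  shows "polarize w s A \<subseteq> ball 0 R"
proof
  fix x assume x: "x \<in> polarize w s A"
  show "x \<in> ball 0 R"
  proof (cases "x \<bullet> w \<le> s")
    case True
    then have "norm x \<le> norm (reflect w s x)" by (rule norm_reflect_ge[OF assms(1,2)])
    moreover have "x \<in> A \<or> reflect w s x \<in> A" using x polarize_below[OF True] by blast
    ultimately show ?thesis using assms(3) by force
  next
    case False
    then show ?thesis using x assms(3) polarize_above[of s x w A] by auto
  qed
qed

text \<open>A polarization towards the centre moves each point of \<open>A - B\<close> whose mirror image lies in \<open>B - A\<close> into the ball,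
  and never moves a point out of it.\<close>
lemma emeasure_polarize_Diff_ball:
  fixes w :: "'a::euclidean_space" and r :: real
  assumes w: "w \<noteq> 0" "0 \<le> s" and [measurable]: "A \<in> sets borel"
  defines "B \<equiv> ball 0 r"
  shows "emeasure lborel (polarize w s A - B) + emeasure lborel {x \<in> A - B. reflect w s x \<in> B - A} \<le> emeasure lborel (A - B)"
proof -
  define T where "T = {x \<in> A - B. reflect w s x \<in> B - A}"
  have [measurable]: "B \<in> sets borel" by (simp add: B_def)
  have "T = {x \<in> space borel. x \<in> A - B \<and> reflect w s x \<in> B - A}" by (auto simp: T_def)
  also have "\<dots> \<in> sets borel" by measurable
  finally have [measurable]: "T \<in> sets borel" .
  let ?P = "polarize w s A - B"
  have "2 * (emeasure lborel ?P + emeasure lborel T) = (\<integral>\<^sup>+x. indicator ?P x + indicator ?P (reflect w s x) \<partial>lborel) + (\<integral>\<^sup>+x. indicator T x + indicator T (reflect w s x) \<partial>lborel)"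
    by (subst (1 2) nn_integral_symmetrize[OF w(1)]) (auto simp: distrib_left)
  also have "\<dots> = (\<integral>\<^sup>+x. (indicator ?P x + indicator ?P (reflect w s x)) + (indicator T x + indicator T (reflect w s x)) \<partial>lborel)"
    by (rule nn_integral_add[symmetric]) measurable
  also have "\<dots> \<le> (\<integral>\<^sup>+x. indicator (A - B) x + indicator (A - B) (reflect w s x) \<partial>lborel)"
  proof (rule nn_integral_mono)
    fix x
    let ?r = "reflect w s x"
    have rw: "?r \<bullet> w = 2 * s - x \<bullet> w" by (rule inner_reflect[OF w(1)])
    show "(indicator ?P x + indicator ?P ?r) + (indicator T x + indicator T ?r) \<le> (indicator (A - B) x + indicator (A - B) ?r :: ennreal)"
    proof (cases "x \<bullet> w \<le> s")
      case True
      have "?r \<in> B \<Longrightarrow> x \<in> B" using norm_reflect_ge[OF w True] by (simp add: B_def)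
      moreover have "s \<le> ?r \<bullet> w" using True rw by simp
      ultimately show ?thesis
        using w True by (auto simp: indicator_def polarize_below polarize_above T_def)
    next
      case False
      then have le: "?r \<bullet> w \<le> s" using rw by simp
      have "x \<in> B \<Longrightarrow> ?r \<in> B" using norm_reflect_ge[OF w le] w by (simp add: B_def)
      then show ?thesis
        using w False le by (auto simp: indicator_def polarize_below polarize_above T_def)
    qed
  qed
  also have "\<dots> = 2 * emeasure lborel (A - B)"
    by (subst nn_integral_symmetrize[OF w(1)]) auto
  finally have "2 * (emeasure lborel ?P + emeasure lborel T) \<le> 2 * emeasure lborel (A - B)" .
  then have "emeasure lborel ?P + emeasure lborel T \<le> emeasure lborel (A - B)"
    by (subst (asm) ennreal_mult_le_mult_iff) auto
  then show ?thesis by (simp only: T_def)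
qed

lemma emeasure_Diff_sym:
  assumes [measurable]: "A \<in> sets M" "B \<in> sets M" and eq: "emeasure M A = emeasure M B" and fin: "emeasure M A < \<infinity>"
  shows "emeasure M (A - B) = emeasure M (B - A)"
proof -
  have "emeasure M (A \<inter> B) + emeasure M (A - B) = emeasure M A"
    by (subst plus_emeasure) (auto intro: arg_cong[where f="emeasure M"])
  also have "\<dots> = emeasure M (A \<inter> B) + emeasure M (B - A)"
    unfolding eq by (subst plus_emeasure) (auto intro: arg_cong[where f="emeasure M"])
  finally have "emeasure M (A \<inter> B) + emeasure M (A - B) = emeasure M (A \<inter> B) + emeasure M (B - A)" .
  moreover have "emeasure M (A \<inter> B) \<noteq> top"
    using emeasure_mono[of "A \<inter> B" A M] fin by (auto simp: top_unique)
  ultimately show ?thesis by (simp add: ennreal_add_left_cancel)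
qed

text \<open>Instead of a convergent sequence of polarizations, consider the class \<open>S\<close> of all sets in a fixed ball with the measure of
  \<open>A\<close> and at least its energy. Polarization acts on \<open>S\<close>, and one further step from a near-minimizer of \<open>|C - B|\<close> would
  go below a positive infimum.\<close>
lemma riesz_energy_bounded_le_ball:
  fixes A :: "'a::euclidean_space set"
  assumes \<alpha>: "0 < \<alpha>" "\<alpha> < real DIM('a)" and A[measurable]: "A \<in> sets borel" and AR: "A \<subseteq> ball 0 R"
    and vol: "emeasure lborel A = emeasure lborel (ball (0::'a) r)"
  shows "riesz_energy \<alpha> A \<le> riesz_energy \<alpha> (ball (0::'a) r)"
proof -
  define B where "B = ball (0::'a) r"
  have [measurable]: "B \<in> sets borel" by (simp add: B_def)
  define R' where "R' = max R (max r 1)"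
  have R': "0 < R'" "R \<le> R'" "r \<le> R'" by (auto simp: R'_def)
  have BR: "B \<subseteq> ball 0 R'" unfolding B_def using R'(3) by (rule subset_ball)
  define S where "S = {C :: 'a set. C \<in> sets borel \<and> C \<subseteq> ball 0 R' \<and> emeasure lborel C = emeasure lborel B \<and> riesz_energy \<alpha> A \<le> riesz_energy \<alpha> C}"
  have AS: "A \<in> S" unfolding S_def B_def using A AR vol subset_ball[OF R'(2), of "0::'a"] by blast
  have finB: "emeasure lborel B < \<infinity>" unfolding B_def by (rule emeasure_bounded_finite[OF bounded_ball])
  have fm: "emeasure lborel D = ennreal (measure lborel D)" if "D \<subseteq> C" "C \<in> S" for D C
  proof (rule emeasure_eq_ennreal_measure)
    have C: "C \<in> sets lborel" "emeasure lborel C = emeasure lborel B" using that(2) unfolding S_def by simp_all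
    have "emeasure lborel D \<le> emeasure lborel C" by (rule emeasure_mono[OF that(1) C(1)])
    also have "\<dots> < top" unfolding C(2) using finB by simp
    finally show "emeasure lborel D \<noteq> top" by simp
  qed
  define \<delta> where "\<delta> = (INF C\<in>S. measure lborel (C - B))"
  have bdd: "bdd_below ((\<lambda>C. measure lborel (C - B)) ` S)" by (intro bdd_belowI2[of _ 0]) simp
  have \<delta>_le: "\<delta> \<le> measure lborel (C - B)" if "C \<in> S" for C
    unfolding \<delta>_def by (rule cINF_lower[OF bdd that])
  have \<delta>_ge: "0 \<le> \<delta>" unfolding \<delta>_def using AS by (intro cINF_greatest) auto
  have ex: "\<exists>C\<in>S. measure lborel (C - B) < \<delta> + \<epsilon>" if "0 < \<epsilon>" for \<epsilon>
  proof -
    have "(INF C\<in>S. measure lborel (C - B)) < \<delta> + \<epsilon>" unfolding \<delta>_def[symmetric] using that by simp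
    then show ?thesis using AS by (subst (asm) cINF_less_iff[OF _ bdd]) blast+
  qed
  have "\<delta> = 0"
  proof (rule ccontr)
    assume "\<delta> \<noteq> 0"
    with \<delta>_ge have \<delta>0: "0 < \<delta>" by simp
    from exists_good_reflection[OF R'(1), where 'a='a] obtain \<kappa> where \<kappa>: "0 < \<kappa>"
      and good: "\<And>P Q :: 'a set. \<lbrakk>P \<in> sets borel; Q \<in> sets borel; P \<subseteq> ball 0 R'; Q \<subseteq> ball 0 R'; \<forall>x\<in>P. \<forall>y\<in>Q. norm y < norm x\<rbrakk>
        \<Longrightarrow> \<exists>w s. w \<noteq> 0 \<and> 0 \<le> s \<and> \<kappa> * measure lborel P * measure lborel Q \<le> measure lborel {x \<in> P. reflect w s x \<in> Q}"
      by blast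
    obtain C where C: "C \<in> S" "measure lborel (C - B) < \<delta> + \<kappa> * \<delta>\<^sup>2"
      using ex[of "\<kappa> * \<delta>\<^sup>2"] \<kappa> \<delta>0 by auto
    have [measurable]: "C \<in> sets borel" using C by (simp add: S_def)
    have CR: "C \<subseteq> ball 0 R'" "emeasure lborel C = emeasure lborel B" using C by (auto simp: S_def)
    define d where "d = measure lborel (C - B)"
    have "emeasure lborel (C - B) = emeasure lborel (B - C)"
      by (rule emeasure_Diff_sym) (use CR finB in auto)
    then have d2: "measure lborel (B - C) = d" by (simp add: d_def measure_def)
    have "\<forall>x\<in>C - B. \<forall>y\<in>B - C. norm y < norm x" by (auto simp: B_def)
    moreover have "C - B \<subseteq> ball 0 R'" "B - C \<subseteq> ball 0 R'" using CR(1) BR by blast+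
    ultimately obtain w s where ws: "w \<noteq> 0" "0 \<le> s" "\<kappa> * d * d \<le> measure lborel {x \<in> C - B. reflect w s x \<in> B - C}"
      using good[OF sets.Diff[OF \<open>C \<in> sets borel\<close> \<open>B \<in> sets borel\<close>] sets.Diff[OF \<open>B \<in> sets borel\<close> \<open>C \<in> sets borel\<close>]]
      unfolding d2 d_def[symmetric] by blast
    let ?T = "{x \<in> C - B. reflect w s x \<in> B - C}"
    let ?C' = "polarize w s C"
    have "riesz_energy \<alpha> A \<le> riesz_energy \<alpha> C" using C(1) by (simp add: S_def)
    also have "\<dots> \<le> riesz_energy \<alpha> ?C'" by (rule riesz_energy_polarize_le[OF \<alpha>(2) ws(1)]) simp
    finally have C': "?C' \<in> S"
      using polarize_subset_ball[OF ws(1,2) CR(1)] emeasure_polarize[OF ws(1), of C s] CR(2) by (simp add: S_def)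
    have "emeasure lborel (?C' - B) + emeasure lborel ?T \<le> emeasure lborel (C - B)"
      unfolding B_def by (rule emeasure_polarize_Diff_ball[OF ws(1,2)]) simp
    then have "measure lborel (?C' - B) + measure lborel ?T \<le> d"
    proof -
      have "emeasure lborel (?C' - B) = ennreal (measure lborel (?C' - B))"
        by (rule fm[OF Diff_subset C'])
      moreover have "emeasure lborel ?T = ennreal (measure lborel ?T)"
        by (rule fm[OF _ C(1)]) blast
      moreover have "emeasure lborel (C - B) = ennreal d"
        unfolding d_def by (rule fm[OF Diff_subset C(1)])
      moreover note \<open>emeasure lborel (?C' - B) + emeasure lborel ?T \<le> emeasure lborel (C - B)\<close>
      ultimately have "ennreal (measure lborel (?C' - B)) + ennreal (measure lborel ?T) \<le> ennreal d" by (simp only:)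
      then show ?thesis
        by (subst (asm) ennreal_plus[symmetric]) (simp_all only: measure_nonneg ennreal_le_iff d_def)
    qed
    moreover have "\<kappa> * \<delta>\<^sup>2 \<le> \<kappa> * d * d"
    proof -
      have "\<delta> * \<delta> \<le> d * d" using \<delta>_le[OF C(1)] \<delta>0 unfolding d_def by (intro mult_mono) auto
      then show ?thesis using \<kappa> by (simp only: power2_eq_square mult.assoc mult_left_mono less_imp_le)
    qed
    ultimately have "measure lborel (?C' - B) < \<delta>" using C(2) ws(3) by (simp add: d_def)
    then show False using \<delta>_le[OF C'] by simp
  qed
  define c where "c = real DIM('a) * unit_ball_vol (real DIM('a)) / \<alpha> + measure lborel B"
  have c: "0 \<le> c" using \<alpha> by (simp add: c_def)
  have cB: "ennreal (real DIM('a) * unit_ball_vol (real DIM('a)) / \<alpha>) + emeasure lborel B = ennreal c"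
  proof -
    have "emeasure lborel B = ennreal (measure lborel B)"
      using finB by (intro emeasure_eq_ennreal_measure) simp
    then show ?thesis using \<alpha> unfolding c_def by (simp only:) (intro ennreal_plus[symmetric], auto)
  qed
  show ?thesis
  proof (rule ennreal_le_epsilon)
    fix e :: real assume e: "0 < e"
    define \<epsilon> where "\<epsilon> = e / (2 * c + 1)"
    have "0 < \<epsilon>" using e c by (simp add: \<epsilon>_def)
    then obtain C where C: "C \<in> S" "measure lborel (C - B) < \<epsilon>" using ex[of \<epsilon>] \<open>\<delta> = 0\<close> by auto
    have CB: "C \<in> sets borel" "emeasure lborel C = emeasure lborel B" using C by (auto simp: S_def)
    have "riesz_energy \<alpha> A \<le> riesz_energy \<alpha> C" using C by (simp add: S_def)
    also have "\<dots> \<le> riesz_energy \<alpha> B + 2 * (ennreal c * emeasure lborel (C - B))"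
      using riesz_energy_le_Diff[OF \<alpha> CB(1) \<open>B \<in> sets borel\<close>] unfolding CB(2) cB .
    also have "2 * (ennreal c * emeasure lborel (C - B)) = ennreal (2 * (c * measure lborel (C - B)))"
      unfolding fm[OF Diff_subset C(1)] using c by (simp add: ennreal_mult)
    also have "\<dots> \<le> ennreal e"
    proof (rule ennreal_leI)
      have "2 * (c * measure lborel (C - B)) \<le> 2 * (c * \<epsilon>)" using c C(2) by (intro mult_left_mono) auto
      also have "\<dots> \<le> (2 * c + 1) * \<epsilon>" using \<open>0 < \<epsilon>\<close> by (simp add: algebra_simps)
      also have "\<dots> = e" using c by (simp add: \<epsilon>_def)
      finally show "2 * (c * measure lborel (C - B)) \<le> e" .
    qed
    finally show "riesz_energy \<alpha> A \<le> riesz_energy \<alpha> (ball (0::'a) r) + ennreal e"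
      unfolding B_def by (simp only: add_left_mono)
  qed
qed

lemma exists_ball_of_measure:
  assumes "m < \<infinity>"
  shows "\<exists>r\<ge>0. emeasure lborel (ball (c::'a::euclidean_space) r) = m"
proof -
  have \<omega>: "unit_ball_vol (real DIM('a)) \<noteq> 0" "0 \<le> unit_ball_vol (real DIM('a))" 
    using unit_ball_vol_pos[OF of_nat_0_le_iff, of "DIM('a)"] by linarith+
  obtain t where t: "m = ennreal t" "0 \<le> t" using assms by (cases m) auto
  define r where "r = root DIM('a) (t / unit_ball_vol (real DIM('a)))"
  have "r ^ DIM('a) = t / unit_ball_vol (real DIM('a))" "0 \<le> r"
    using t \<omega> by (auto simp: r_def)
  then show ?thesis using \<omega> t by (intro exI[of _ r]) (auto simp add: emeasure_ball)
qed

lemma exists_ball_small_Diff: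
  fixes A :: "'a::euclidean_space set"
  assumes A[measurable]: "A \<in> sets borel" and fin: "emeasure lborel A < \<infinity>" and e: "0 < \<epsilon>"
  shows "\<exists>k::nat. emeasure lborel (A - ball 0 (real k)) < \<epsilon>"
proof -
  have "(\<lambda>k. emeasure lborel (A - ball 0 (real k))) \<longlonglongrightarrow> emeasure lborel (\<Inter>k. A - ball 0 (real k))"
  proof (rule Lim_emeasure_decseq)
    show "decseq (\<lambda>k. A - ball 0 (real k))" by (auto simp: decseq_def)
    show "emeasure lborel (A - ball 0 (real k)) \<noteq> \<infinity>" for k
      using emeasure_mono[of "A - ball 0 (real k)" A lborel] fin by (auto simp: top_unique)
  qed auto
  moreover have "(\<Inter>k. A - ball 0 (real k)) = {}"
    using reals_Archimedean2 by (auto simp: not_less[symmetric]) 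
  ultimately have "(\<lambda>k. emeasure lborel (A - ball 0 (real k))) \<longlonglongrightarrow> 0"
    by (simp only: emeasure_empty)
  then have "\<forall>\<^sub>F k in sequentially. emeasure lborel (A - ball 0 (real k)) < \<epsilon>"
    using e by (rule order_tendstoD)
  then show ?thesis by (auto simp: eventually_sequentially)
qed

theorem riesz_energy_le_ball:
  fixes A :: "'a::euclidean_space set"
  assumes \<alpha>: "0 < \<alpha>" "\<alpha> < real DIM('a)" and A[measurable]: "A \<in> sets borel" and fin: "emeasure lborel A < \<infinity>"
    and vol: "emeasure lborel A = emeasure lborel (ball (0::'a) r)"
  shows "riesz_energy \<alpha> A \<le> riesz_energy \<alpha> (ball (0::'a) r)"
proof (rule ennreal_le_epsilon)
  fix e :: real assume e: "0 < e"
  define c where "c = real DIM('a) * unit_ball_vol (real DIM('a)) / \<alpha> + measure lborel A"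
  have c: "0 \<le> c" using \<alpha> by (simp add: c_def)
  have cA: "ennreal (real DIM('a) * unit_ball_vol (real DIM('a)) / \<alpha>) + emeasure lborel A = ennreal c"
    using \<alpha> fin by (simp add: c_def emeasure_eq_ennreal_measure)
  define \<epsilon> where "\<epsilon> = e / (2 * c + 1)"
  have \<epsilon>: "0 < \<epsilon>" using e c by (simp add: \<epsilon>_def)
  obtain k :: nat where k: "emeasure lborel (A - ball 0 (real k)) < ennreal \<epsilon>"
    using exists_ball_small_Diff[OF A fin, of "ennreal \<epsilon>"] \<epsilon> by auto
  define A' where "A' = A \<inter> ball 0 (real k)"
  have [measurable]: "A' \<in> sets borel" by (simp add: A'_def)
  have A'le: "emeasure lborel A' \<le> emeasure lborel (ball (0::'a) r)"
    unfolding vol[symmetric] by (rule emeasure_mono) (auto simp: A'_def)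
  then have "emeasure lborel A' < \<infinity>" using fin vol by simp
  then obtain r' where r': "0 \<le> r'" "emeasure lborel (ball (0::'a) r') = emeasure lborel A'"
    using exists_ball_of_measure[of "emeasure lborel A'" "0::'a"] by auto
  have sub: "ball (0::'a) r' \<subseteq> ball 0 r"
  proof (cases "r' \<le> r")
    case False
    then have "max r 0 < r' \<or> r' = 0" using r'(1) by auto
    then show ?thesis
    proof
      assume lt: "max r 0 < r'"
      have "emeasure lborel (ball (0::'a) r) \<le> emeasure lborel (ball (0::'a) (max r 0))"
        by (intro emeasure_mono subset_ball) auto
      also have "\<dots> < emeasure lborel (ball (0::'a) r')"
        using lt by (simp add: emeasure_ball ennreal_less_iff power_strict_mono)
      finally show ?thesis using A'le r'(2) by simp
    qed simp
  qed (rule subset_ball)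
  have AA': "A - A' = A - ball 0 (real k)" by (auto simp: A'_def)
  have "riesz_energy \<alpha> A \<le> riesz_energy \<alpha> A' + 2 * (ennreal c * emeasure lborel (A - A'))"
    using riesz_energy_le_Diff[OF \<alpha> A, of A'] by (simp add: cA)
  also have "riesz_energy \<alpha> A' \<le> riesz_energy \<alpha> (ball (0::'a) r')"
    by (rule riesz_energy_bounded_le_ball[OF \<alpha>, of _ "real k"]) (auto simp: A'_def r')
  also have "\<dots> \<le> riesz_energy \<alpha> (ball (0::'a) r)"
    by (rule riesz_energy_mono[OF sub])
  also have "2 * (ennreal c * emeasure lborel (A - A')) \<le> 2 * (ennreal c * ennreal \<epsilon>)"
    using k unfolding AA' by (intro mult_left_mono) auto
  also have "\<dots> = ennreal (2 * (c * \<epsilon>))" using c \<epsilon> by (simp add: ennreal_mult)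
  also have "\<dots> \<le> ennreal e"
  proof (rule ennreal_leI)
    have "2 * (c * \<epsilon>) \<le> (2 * c + 1) * \<epsilon>" using \<epsilon> by (simp add: algebra_simps)
    also have "\<dots> = e" using c by (simp add: \<epsilon>_def)
    finally show "2 * (c * \<epsilon>) \<le> e" .
  qed
  finally show "riesz_energy \<alpha> A \<le> riesz_energy \<alpha> (ball (0::'a) r) + ennreal e"
    by (simp add: add_left_mono add_right_mono)
qed

section \<open>Sets with maximal Riesz energy are balls\<close>

lemma AE_reflect:
  fixes w :: "'a::euclidean_space"
  assumes "w \<noteq> 0" "AE x in lborel. P x"
  shows "AE x in lborel. P (reflect w s x)"
proof (rule AE_distrD[of "reflect w s" lborel borel])
  show "AE x in distr lborel borel (reflect w s). P x"
    unfolding distr_lborel_reflect[OF assms(1)] by (rule assms(2))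
qed simp

lemma emeasure_reflect:
  fixes w :: "'a::euclidean_space"
  assumes "w \<noteq> 0" "A \<in> sets borel"
  shows "emeasure lborel {x. reflect w s x \<in> A} = emeasure lborel A"
proof -
  have "emeasure lborel A = emeasure (distr lborel borel (reflect w s)) A"
    by (simp only: distr_lborel_reflect[OF assms(1)])
  also have "\<dots> = emeasure lborel {x. reflect w s x \<in> A}"
    using assms(2) by (simp add: emeasure_distr vimage_def)
  finally show ?thesis ..
qed

lemma halfspace_Int_measurable [measurable]:
  fixes w :: "'a::euclidean_space"
  assumes [measurable]: "A \<in> sets borel"
  shows "{x \<in> A. x \<bullet> w < s} \<in> sets borel" "{x \<in> A. s < x \<bullet> w} \<in> sets borel"
proof -
  have "{x \<in> A. x \<bullet> w < s} = {x \<in> space borel. x \<in> A \<and> x \<bullet> w < s}"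
    "{x \<in> A. s < x \<bullet> w} = {x \<in> space borel. x \<in> A \<and> s < x \<bullet> w}" by auto
  moreover have "{x \<in> space borel. x \<in> A \<and> x \<bullet> w < s} \<in> sets borel"
    "{x \<in> space borel. x \<in> A \<and> s < x \<bullet> w} \<in> sets borel" by measurable
  ultimately show "{x \<in> A. x \<bullet> w < s} \<in> sets borel" "{x \<in> A. s < x \<bullet> w} \<in> sets borel" by simp_all
qed

text \<open>The set of points of \<open>A\<close> below the hyperplane and the mirror image of the points of \<open>A\<close> above it share the points
  whose mirror image is also in \<open>A\<close>; the rest are the gain and the loss set.\<close>
lemma gain_loss_balance:
  fixes w :: "'a::euclidean_space"
  assumes w: "w \<noteq> 0" and A[measurable]: "A \<in> sets borel" and fin: "emeasure lborel A < \<infinity>"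
  shows "emeasure lborel (gain_set w s A) + emeasure lborel {x \<in> A. s < x \<bullet> w} =
    emeasure lborel (loss_set w s A) + emeasure lborel {x \<in> A. x \<bullet> w < s}"
proof -
  define Bo where "Bo = {x. x \<bullet> w < s \<and> x \<in> A \<and> reflect w s x \<in> A}"
  have "Bo = {x \<in> space borel. x \<bullet> w < s \<and> x \<in> A \<and> reflect w s x \<in> A}" by (simp add: Bo_def)
  also have "\<dots> \<in> sets borel" by measurable
  finally have [measurable]: "Bo \<in> sets borel" .
  have [measurable]: "gain_set w s A \<in> sets borel" "loss_set w s A \<in> sets borel"
    by (rule gain_loss_measurable, rule A)+
  have "{x \<in> A. x \<bullet> w < s} = gain_set w s A \<union> Bo" by (auto simp: Bo_def gain_set_def)
  then have 1: "emeasure lborel {x \<in> A. x \<bullet> w < s} = emeasure lborel (gain_set w s A) + emeasure lborel Bo"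
    by (simp only:) (rule plus_emeasure[symmetric], auto simp: Bo_def gain_set_def)
  have m: "{x \<in> A. s < x \<bullet> w} \<in> sets borel" by (rule halfspace_Int_measurable[OF A])
  have "emeasure lborel {x \<in> A. s < x \<bullet> w} = emeasure lborel {x. reflect w s x \<in> {x \<in> A. s < x \<bullet> w}}"
    by (rule emeasure_reflect[OF w m, symmetric])
  also have "{x. reflect w s x \<in> {x \<in> A. s < x \<bullet> w}} = loss_set w s A \<union> Bo"
    using inner_reflect[OF w] by (auto simp: Bo_def loss_set_def)
  also have "emeasure lborel \<dots> = emeasure lborel (loss_set w s A) + emeasure lborel Bo"
    by (rule plus_emeasure[symmetric]) (auto simp: Bo_def loss_set_def)
  finally have 2: "emeasure lborel {x \<in> A. s < x \<bullet> w} = emeasure lborel (loss_set w s A) + emeasure lborel Bo" .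
  show ?thesis unfolding 1 2 by (simp only: add_ac)
qed

lemma halfspace_measure_finite:
  assumes "A \<in> sets borel" "emeasure lborel A < \<infinity>"
  shows "emeasure lborel {x \<in> A. P x} \<noteq> top"
proof -
  have "emeasure lborel {x \<in> A. P x} \<le> emeasure lborel A" using assms(1) by (intro emeasure_mono) auto
  then show ?thesis using assms(2) by (auto simp: top_unique)
qed

lemma loss_null:
  fixes w :: "'a::euclidean_space"
  assumes w: "w \<noteq> 0" and A: "A \<in> sets borel" and fin: "emeasure lborel A < \<infinity>"
    and D: "gain_set w s A \<in> null_sets lborel \<or> loss_set w s A \<in> null_sets lborel"
    and le: "emeasure lborel {x \<in> A. s < x \<bullet> w} \<le> emeasure lborel {x \<in> A. x \<bullet> w < s}"
  shows "loss_set w s A \<in> null_sets lborel"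
  using D
proof
  assume "gain_set w s A \<in> null_sets lborel"
  then have "emeasure lborel {x \<in> A. s < x \<bullet> w} = emeasure lborel {x \<in> A. x \<bullet> w < s} + emeasure lborel (loss_set w s A)"
    using gain_loss_balance[OF w A fin, of s] by (simp add: null_setsD1 add.commute)
  then have "emeasure lborel {x \<in> A. x \<bullet> w < s} + emeasure lborel (loss_set w s A) \<le> emeasure lborel {x \<in> A. x \<bullet> w < s} + 0"
    using le by (simp only: add_0_right)
  then have "emeasure lborel (loss_set w s A) \<le> 0"
    using halfspace_measure_finite[OF A fin, of "\<lambda>x. x \<bullet> w < s"] unfolding ennreal_add_left_cancel_le by simp
  then have "emeasure lborel (loss_set w s A) = 0" by simp
  then show ?thesis using gain_loss_measurable(2)[OF A, of w s] by (intro null_setsI) auto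
qed

text \<open>If the hyperplane halves \<open>A\<close>, gain and loss set have the same measure; since one of them is null, both are.\<close>
lemma AE_reflect_invariant:
  fixes w :: "'a::euclidean_space"
  assumes w: "w \<noteq> 0" and A: "A \<in> sets borel" and fin: "emeasure lborel A < \<infinity>"
    and D: "gain_set w s A \<in> null_sets lborel \<or> loss_set w s A \<in> null_sets lborel"
    and eq: "emeasure lborel {x \<in> A. x \<bullet> w < s} = emeasure lborel {x \<in> A. s < x \<bullet> w}"
  shows "AE x in lborel. x \<in> A \<longleftrightarrow> reflect w s x \<in> A"
proof -
  have "emeasure lborel {x \<in> A. s < x \<bullet> w} + emeasure lborel (gain_set w s A)
    = emeasure lborel {x \<in> A. s < x \<bullet> w} + emeasure lborel (loss_set w s A)"
    using gain_loss_balance[OF w A fin, of s] unfolding eq by (simp only: add.commute)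
  then have "emeasure lborel (gain_set w s A) = emeasure lborel (loss_set w s A)"
    unfolding ennreal_add_left_cancel using halfspace_measure_finite[OF A fin, of "\<lambda>x. s < x \<bullet> w"]
    by (elim disjE) simp_all
  then have "gain_set w s A \<in> null_sets lborel" "loss_set w s A \<in> null_sets lborel"
    using D gain_loss_measurable[OF A, of w s] by (auto simp: null_sets_def)
  then have "AE x in lborel. x \<notin> gain_set w s A" "AE x in lborel. x \<notin> loss_set w s A"
    by (simp_all only: AE_not_in)
  then have *: "AE x in lborel. x \<bullet> w < s \<longrightarrow> (x \<in> A \<longleftrightarrow> reflect w s x \<in> A)"
  proof eventually_elim
    case (elim x)
    then show ?case unfolding gain_set_def loss_set_def mem_Collect_eq by blast
  qed
  show ?thesis
    using * AE_reflect[OF w, where s=s and P="\<lambda>x. x \<bullet> w < s \<longrightarrow> (x \<in> A \<longleftrightarrow> reflect w s x \<in> A)", OF *]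
  proof eventually_elim
    case (elim x)
    have rw: "reflect w s x \<bullet> w = 2 * s - x \<bullet> w" by (rule inner_reflect[OF w])
    consider "x \<bullet> w < s" | "x \<bullet> w = s" | "reflect w s x \<bullet> w < s" using rw by linarith
    then show ?case
    proof cases
      case 1
      then show ?thesis using elim(1) by blast
    next
      case 2
      then show ?thesis by (simp only: reflect_on_hyperplane)
    next
      case 3
      then show ?thesis using elim(2) unfolding reflect_reflect[OF w] by blast
    qed
  qed
qed

text \<open>The composition of the reflections in all coordinate hyperplanes is \<open>x \<mapsto> - x\<close>.\<close>
lemma AE_reflect_all_axes:
  fixes A :: "'a::euclidean_space set"
  assumes sym: "\<And>b. b \<in> Basis \<Longrightarrow> AE x in lborel. x \<in> A \<longleftrightarrow> reflect b 0 x \<in> A"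
  shows "AE x in lborel. x \<in> A \<longleftrightarrow> - x \<in> A"
proof -
  have "AE x in lborel. x \<in> A \<longleftrightarrow> x - (\<Sum>b\<in>S. (2 * (x \<bullet> b)) *\<^sub>R b) \<in> A" if "finite S" "S \<subseteq> Basis" for S
    using that
  proof (induction S rule: finite_induct)
    case (insert c S)
    then have c: "c \<in> Basis" by simp
    then have c0: "c \<noteq> 0" by auto
    have "AE x in lborel. reflect c 0 x \<in> A \<longleftrightarrow> reflect c 0 x - (\<Sum>b\<in>S. (2 * (reflect c 0 x \<bullet> b)) *\<^sub>R b) \<in> A"
      using insert by (intro AE_reflect[OF c0]) auto
    then show ?case
      using sym[OF c]
    proof eventually_elim
      case (elim x)
      have "reflect c 0 x \<bullet> b = x \<bullet> b" if "b \<in> S" for b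
      proof -
        have "c \<bullet> b = 0" using that insert.hyps insert.prems by (intro inner_not_same_Basis) auto
        then show ?thesis by (simp add: reflect_def inner_diff_left)
      qed
      then have "(\<Sum>b\<in>S. (2 * (reflect c 0 x \<bullet> b)) *\<^sub>R b) = (\<Sum>b\<in>S. (2 * (x \<bullet> b)) *\<^sub>R b)"
        by (intro sum.cong) simp_all
      moreover have "reflect c 0 x = x - (2 * (x \<bullet> c)) *\<^sub>R c"
        using c by (simp add: reflect_def)
      ultimately have "reflect c 0 x - (\<Sum>b\<in>S. (2 * (reflect c 0 x \<bullet> b)) *\<^sub>R b)
        = x - (2 * (x \<bullet> c)) *\<^sub>R c - (\<Sum>b\<in>S. (2 * (x \<bullet> b)) *\<^sub>R b)"
        by (simp only:)
      also have "\<dots> = x - (\<Sum>b\<in>insert c S. (2 * (x \<bullet> b)) *\<^sub>R b)"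
        using insert.hyps by (simp add: algebra_simps)
      finally have "reflect c 0 x - (\<Sum>b\<in>S. (2 * (reflect c 0 x \<bullet> b)) *\<^sub>R b) = x - (\<Sum>b\<in>insert c S. (2 * (x \<bullet> b)) *\<^sub>R b)" .
      with elim show ?case by simp
    qed
  qed simp
  from this[of Basis] have "AE x in lborel. x \<in> A \<longleftrightarrow> x - (\<Sum>b\<in>Basis. (2 * (x \<bullet> b)) *\<^sub>R b) \<in> A" by simp
  moreover have "x - (\<Sum>b\<in>Basis. (2 * (x \<bullet> b)) *\<^sub>R b) = - x" for x :: 'a
  proof -
    have "(\<Sum>b\<in>Basis. (2 * (x \<bullet> b)) *\<^sub>R b) = 2 *\<^sub>R (\<Sum>b\<in>Basis. (x \<bullet> b) *\<^sub>R b)"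
      by (simp add: scaleR_sum_right)
    then show ?thesis by (simp add: euclidean_representation scaleR_2)
  qed
  ultimately show ?thesis by simp
qed

lemma emeasure_halfspaces_symmetric:
  fixes A :: "'a::euclidean_space set"
  assumes [measurable]: "A \<in> sets borel" and sym: "AE x in lborel. x \<in> A \<longleftrightarrow> - x \<in> A"
  shows "emeasure lborel {x \<in> A. x \<bullet> w < 0} = emeasure lborel {x \<in> A. 0 < x \<bullet> w}"
proof -
  have m: "{x \<in> A. x \<bullet> w < 0} \<in> sets lborel" "{x \<in> A. 0 < x \<bullet> w} \<in> sets lborel"
    using halfspace_Int_measurable[OF assms(1), where w=w and s=0] by simp_all
  have "emeasure lborel {x \<in> A. x \<bullet> w < 0} = (\<integral>\<^sup>+x. indicator {x \<in> A. x \<bullet> w < 0} x \<partial>lborel)"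
    by (rule nn_integral_indicator[symmetric]) (rule m)
  also have "\<dots> = (\<integral>\<^sup>+x. indicator {x \<in> A. x \<bullet> w < 0} (0 + (-1) *\<^sub>R x) \<partial>lborel)"
    using m by (subst nn_integral_lborel_affine[where c="-1" and t=0]) auto
  also have "\<dots> = (\<integral>\<^sup>+x. indicator {x \<in> A. 0 < x \<bullet> w} x \<partial>lborel)"
    by (rule nn_integral_cong_AE) (use sym in \<open>eventually_elim, auto simp: indicator_def\<close>)
  also have "\<dots> = emeasure lborel {x \<in> A. 0 < x \<bullet> w}"
    by (rule nn_integral_indicator) (rule m)
  finally show ?thesis .
qed

text \<open>The measure of \<open>A\<close> below the level \<open>s\<close> is the distribution function of the finite measure that \<open>A\<close> induces on the
  line. It is continuous because hyperplanes are null sets, so the intermediate value theorem gives a median.\<close>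
lemma median_halfspace:
  fixes A :: "'a::euclidean_space set"
  assumes [measurable]: "A \<in> sets borel" and fin: "emeasure lborel A < \<infinity>" and b: "b \<noteq> 0"
  shows "\<exists>s. emeasure lborel {x \<in> A. x \<bullet> b < s} = emeasure lborel {x \<in> A. s < x \<bullet> b}"
proof -
  define M where "M = distr (density lborel (indicator A)) borel (\<lambda>x. x \<bullet> b)"
  have em: "emeasure M X = emeasure lborel {x \<in> A. x \<bullet> b \<in> X}" if [measurable]: "X \<in> sets borel" for X
  proof -
    have m: "{x \<in> space borel. x \<in> A \<and> x \<bullet> b \<in> X} \<in> sets borel" by measurable
    have "emeasure M X = (\<integral>\<^sup>+x. indicator A x * indicator ((\<lambda>x. x \<bullet> b) -` X) x \<partial>lborel)"
      unfolding M_def using measurable_sets[of "\<lambda>x. x \<bullet> b" borel borel X] that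
      by (subst emeasure_distr) (simp_all add: emeasure_density)
    also have "\<dots> = (\<integral>\<^sup>+x. indicator {x \<in> space borel. x \<in> A \<and> x \<bullet> b \<in> X} x \<partial>lborel)"
      by (intro nn_integral_cong) (auto simp: indicator_def)
    also have "\<dots> = emeasure lborel {x \<in> space borel. x \<in> A \<and> x \<bullet> b \<in> X}"
      using m by (intro nn_integral_indicator) simp
    also have "{x \<in> space borel. x \<in> A \<and> x \<bullet> b \<in> X} = {x \<in> A. x \<bullet> b \<in> X}" by auto
    finally show ?thesis .
  qed
  have sM: "space M = UNIV" "sets M = sets borel" by (simp_all add: M_def)
  have emU: "emeasure M (space M) = emeasure lborel A"
    using em[of UNIV] by (simp add: sM)
  interpret finite_borel_measure M
  proof (intro finite_borel_measure.intro finite_borel_measure_axioms.intro)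
    show "finite_measure M" by (rule finite_measureI) (use emU fin in simp)
  qed (rule sM)
  have hyp: "emeasure M {t} = 0" for t
  proof -
    have "{x. b \<bullet> x = t} \<in> null_sets lborel"
      using negligible_hyperplane[of b t] b closed_hyperplane[of b t]
      by (auto simp: null_sets_completion_iff negligible_iff_null_sets borel_closed)
    then have "emeasure lborel {x. b \<bullet> x = t} = 0" "{x. b \<bullet> x = t} \<in> sets lborel"
      by (rule null_setsD1, rule null_setsD2)
    then have "emeasure lborel {x \<in> A. b \<bullet> x = t} \<le> 0"
      by (metis (no_types, lifting) emeasure_mono mem_Collect_eq subsetI)
    then show ?thesis by (simp add: em inner_commute)
  qed
  have cont: "isCont (cdf M) t" for t
    using hyp[of t] by (simp add: isCont_cdf measure_def)
  define m where "m = measure M (space M)"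
  have "\<exists>t. cdf M t = m / 2"
  proof (cases "m = 0")
    case True
    have "cdf M 0 = m / 2"
      using True cdf_bounded[of 0] cdf_nonneg[of 0] by (simp add: m_def)
    then show ?thesis by blast
  next
    case False
    then have m: "0 < m" unfolding m_def using measure_nonneg[of M "space M"] by linarith
    have "\<forall>\<^sub>F t in at_bot. cdf M t < m / 2" using cdf_lim_at_bot m by (intro order_tendstoD(2)[of _ 0]) auto
    then obtain t1 where t1: "cdf M t1 < m / 2" unfolding eventually_at_bot_linorder by blast
    have "\<forall>\<^sub>F t in at_top. m / 2 < cdf M t" using cdf_lim_at_top m unfolding m_def by (intro order_tendstoD(1)) auto
    then obtain t2 where t2: "m / 2 < cdf M t2" unfolding eventually_at_top_linorder by blast
    have "t1 \<le> t2" using t1 t2 cdf_nondecreasing[of t2 t1] by linarith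
    then show ?thesis using IVT[of "cdf M" t1 "m / 2" t2] t1 t2 cont by auto
  qed
  then obtain t where t: "cdf M t = m / 2" by blast
  have "measure M {..t} = measure M {..<t} + measure M {t}"
    by (subst finite_measure_Union[symmetric]) (auto simp: sM intro: arg_cong[where f="measure M"])
  then have 1: "measure M {..<t} = m / 2" using t hyp[of t] by (simp add: cdf_def measure_def)
  have "measure M (space M) = measure M {..t} + measure M {t<..}"
    by (subst finite_measure_Union[symmetric]) (auto simp: sM intro: arg_cong[where f="measure M"])
  then have 2: "measure M {t<..} = m / 2" using t by (simp add: cdf_def m_def)
  have "emeasure M {..<t} = emeasure M {t<..}"
    by (simp add: emeasure_eq_measure 1 2)
  then show ?thesis by (intro exI[of _ t]) (simp add: em)
qed

text \<open>Every set that satisfies the rigidity alternative for all hyperplanes, and has its medians at the origin, is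
  a centred ball: it is symmetric about the origin, so every half-space containing the origin carries at least as much of
  \<open>A\<close> as its complement. Hence its loss set is null, and averaging over reflections shows that \<open>A - B\<close> or \<open>B - A\<close> is null.\<close>
lemma centered_rigid_is_ball:
  fixes A :: "'a::euclidean_space set"
  assumes A[measurable]: "A \<in> sets borel" and fin: "emeasure lborel A < \<infinity>"
    and D: "\<And>w s. w \<noteq> 0 \<Longrightarrow> gain_set w s A \<in> null_sets lborel \<or> loss_set w s A \<in> null_sets lborel"
    and med: "\<And>b. b \<in> Basis \<Longrightarrow> emeasure lborel {x \<in> A. x \<bullet> b < 0} = emeasure lborel {x \<in> A. 0 < x \<bullet> b}"
    and vol: "emeasure lborel A = emeasure lborel (ball (0::'a) r)"
  shows "AE x in lborel. x \<in> A \<longleftrightarrow> x \<in> ball 0 r"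
proof -
  define B where "B = ball (0::'a) r"
  have B[measurable]: "B \<in> sets borel" by (simp add: B_def)
  have "AE x in lborel. x \<in> A \<longleftrightarrow> - x \<in> A"
  proof (rule AE_reflect_all_axes)
    fix b :: 'a assume b: "b \<in> Basis"
    then have b0: "b \<noteq> 0" by auto
    show "AE x in lborel. x \<in> A \<longleftrightarrow> reflect b 0 x \<in> A"
      by (rule AE_reflect_invariant[OF b0 A fin D[OF b0] med[OF b]])
  qed
  note half = emeasure_halfspaces_symmetric[OF A this]
  have loss: "loss_set w s A \<in> null_sets lborel" if ws: "w \<noteq> 0" "0 \<le> s" for w s
  proof (rule loss_null[OF ws(1) A fin D[OF ws(1)]])
    have m: "{x \<in> A. 0 < x \<bullet> w} \<in> sets lborel" "{x \<in> A. x \<bullet> w < s} \<in> sets lborel"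
      using halfspace_Int_measurable[OF A] by simp_all
    have "emeasure lborel {x \<in> A. s < x \<bullet> w} \<le> emeasure lborel {x \<in> A. 0 < x \<bullet> w}"
      using ws by (intro emeasure_mono m) auto
    also have "\<dots> = emeasure lborel {x \<in> A. x \<bullet> w < 0}" by (rule half[symmetric])
    also have "\<dots> \<le> emeasure lborel {x \<in> A. x \<bullet> w < s}"
      using ws by (intro emeasure_mono m) auto
    finally show "emeasure lborel {x \<in> A. s < x \<bullet> w} \<le> emeasure lborel {x \<in> A. x \<bullet> w < s}" .
  qed
  have prod0: "measure lborel ((A - B) \<inter> ball 0 R) * measure lborel (B - A) = 0" if R: "0 < R" "r \<le> R" for R
  proof -
    obtain \<kappa> where \<kappa>: "0 < \<kappa>" and good: "\<And>P Q :: 'a set. \<lbrakk>P \<in> sets borel; Q \<in> sets borel; P \<subseteq> ball 0 R; Q \<subseteq> ball 0 R; \<forall>x\<in>P. \<forall>y\<in>Q. norm y < norm x\<rbrakk>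
        \<Longrightarrow> \<exists>w s. w \<noteq> 0 \<and> 0 \<le> s \<and> \<kappa> * measure lborel P * measure lborel Q \<le> measure lborel {x \<in> P. reflect w s x \<in> Q}"
      using exists_good_reflection[OF R(1), where 'a='a] by blast
    let ?P = "(A - B) \<inter> ball 0 R" and ?Q = "B - A"
    have 1: "?P \<in> sets borel" "?Q \<in> sets borel" by measurable
    have 2: "?P \<subseteq> ball 0 R" "?Q \<subseteq> ball 0 R" using R(2) by (auto simp: B_def)
    have 3: "\<forall>x\<in>?P. \<forall>y\<in>?Q. norm y < norm x" by (auto simp: B_def)
    obtain w s where ws: "w \<noteq> 0" "0 \<le> s" and le: "\<kappa> * measure lborel ?P * measure lborel ?Q \<le> measure lborel {x \<in> ?P. reflect w s x \<in> ?Q}"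
      using good[OF 1 2 3] by blast
    have "{x \<in> ?P. reflect w s x \<in> ?Q} \<subseteq> {x. reflect w s x \<in> loss_set w s A}"
    proof
      fix x assume x: "x \<in> {x \<in> ?P. reflect w s x \<in> ?Q}"
      then have nrm: "norm (reflect w s x) < norm x" by (auto simp: B_def)
      have "s < x \<bullet> w"
      proof (rule ccontr)
        assume "\<not> ?thesis"
        then have "norm x \<le> norm (reflect w s x)" by (intro norm_reflect_ge[OF ws]) simp
        with nrm show False by simp
      qed
      then show "x \<in> {x. reflect w s x \<in> loss_set w s A}"
        using x ws by (simp add: loss_set_def inner_reflect)
    qed
    moreover have m: "loss_set w s A \<in> sets borel" by (rule gain_loss_measurable(2)[OF A])
    moreover have "{x. reflect w s x \<in> loss_set w s A} \<in> sets lborel"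
      using measurable_sets_borel[OF reflect_measurable m, of w s] by (simp add: vimage_def)
    ultimately have "emeasure lborel {x \<in> ?P. reflect w s x \<in> ?Q} \<le> emeasure lborel {x. reflect w s x \<in> loss_set w s A}"
      by (intro emeasure_mono)
    also have "\<dots> = 0"
      using emeasure_reflect[OF ws(1) m] null_setsD1[OF loss[OF ws]] by simp
    finally have "measure lborel {x \<in> ?P. reflect w s x \<in> ?Q} = 0" by (simp add: measure_def)
    with le \<kappa> have "measure lborel ?P * measure lborel ?Q \<le> 0" by (simp add: mult.assoc mult_le_0_iff)
    then show ?thesis using mult_nonneg_nonneg[OF measure_nonneg[of lborel ?P] measure_nonneg[of lborel ?Q]] by linarith
  qed
  have eq: "emeasure lborel (A - B) = emeasure lborel (B - A)"
    by (rule emeasure_Diff_sym) (use vol fin in \<open>auto simp: B_def\<close>)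
  have fB: "emeasure lborel (B - A) < \<infinity>"
    by (rule emeasure_bounded_finite, rule bounded_subset[OF bounded_ball[of 0 r]]) (auto simp: B_def)
  have "emeasure lborel (A - B) = 0"
  proof (rule ccontr)
    assume nz: "emeasure lborel (A - B) \<noteq> 0"
    then have "0 < emeasure lborel (A - B)" by (simp add: zero_less_iff_neq_zero)
    moreover have "A - B \<in> sets borel" by measurable
    moreover have "emeasure lborel (A - B) < \<infinity>" using eq fB by simp
    ultimately obtain k :: nat where k: "emeasure lborel ((A - B) - ball 0 (real k)) < emeasure lborel (A - B)"
      using exists_ball_small_Diff by blast
    define R where "R = max (real k) (max r 1)"
    have R: "0 < R" "r \<le> R" "real k \<le> R" by (auto simp: R_def)
    have "emeasure lborel ((A - B) - ball 0 R) \<le> emeasure lborel ((A - B) - ball 0 (real k))"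
      using subset_ball[OF R(3), of "0::'a"] by (intro emeasure_mono) auto
    moreover have "emeasure lborel ((A - B) \<inter> ball 0 R) + emeasure lborel ((A - B) - ball 0 R) = emeasure lborel (A - B)"
      by (subst plus_emeasure) (auto intro: arg_cong[where f="emeasure lborel"])
    ultimately have "emeasure lborel ((A - B) \<inter> ball 0 R) \<noteq> 0" using k by auto
    moreover have "emeasure lborel ((A - B) \<inter> ball 0 R) < \<infinity>"
      by (rule emeasure_bounded_finite, rule bounded_subset[OF bounded_ball[of 0 R]]) auto
    ultimately have "measure lborel ((A - B) \<inter> ball 0 R) \<noteq> 0"
      by (simp add: measure_def enn2real_eq_0_iff)
    moreover have "measure lborel (B - A) \<noteq> 0"
      using nz fB by (simp add: eq measure_def enn2real_eq_0_iff)
    ultimately show False using prod0[OF R(1,2)] by simp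
  qed
  then have "A - B \<in> null_sets lborel" "B - A \<in> null_sets lborel" using eq by (auto intro!: null_setsI)
  then have "AE x in lborel. x \<notin> A - B" "AE x in lborel. x \<notin> B - A" by (simp_all only: AE_not_in)
  then show ?thesis by eventually_elim (auto simp: B_def)
qed

lemma riesz_energy_translate:
  fixes A :: "'a::euclidean_space set"
  assumes [measurable]: "A \<in> sets borel"
  shows "riesz_energy \<alpha> {x. x + c \<in> A} = riesz_energy \<alpha> A"
proof -
  have "riesz_energy \<alpha> {x. x + c \<in> A} = (\<integral>\<^sup>+y. \<integral>\<^sup>+x. indicator A (x + c) * indicator A (y + c) * riesz_kernel \<alpha> (x + c) (y + c) \<partial>lborel \<partial>lborel)"
    unfolding riesz_energy_def by (intro nn_integral_cong) (simp add: indicator_def riesz_kernel_def)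
  also have "\<dots> = (\<integral>\<^sup>+y. \<integral>\<^sup>+x. indicator A x * indicator A (y + c) * riesz_kernel \<alpha> x (y + c) \<partial>lborel \<partial>lborel)"
    by (rule nn_integral_cong, rule nn_integral_lborel_translate) measurable
  also have "\<dots> = riesz_energy \<alpha> A"
    unfolding riesz_energy_def by (rule nn_integral_lborel_translate) measurable
  finally show ?thesis .
qed

theorem riesz_energy_eq_ball:
  fixes A :: "'a::euclidean_space set"
  assumes \<alpha>: "0 < \<alpha>" "\<alpha> < real DIM('a)" and A[measurable]: "A \<in> sets borel" and fin: "emeasure lborel A < \<infinity>"
    and vol: "emeasure lborel A = emeasure lborel (ball (0::'a) r)"
    and E: "riesz_energy \<alpha> (ball (0::'a) r) \<le> riesz_energy \<alpha> A"
  shows "\<exists>c. AE x in lborel. x \<in> A \<longleftrightarrow> x \<in> ball c r"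
proof -
  \<comment> \<open>Only the basis directions are centred; symmetry about the origin then centres all other directions as well.\<close>
  have "\<forall>b. \<exists>s. b \<in> (Basis :: 'a set) \<longrightarrow> emeasure lborel {x \<in> A. x \<bullet> b < s} = emeasure lborel {x \<in> A. s < x \<bullet> b}"
  proof
    fix b :: 'a
    show "\<exists>s. b \<in> Basis \<longrightarrow> emeasure lborel {x \<in> A. x \<bullet> b < s} = emeasure lborel {x \<in> A. s < x \<bullet> b}"
    proof (cases "b = 0")
      case False
      then show ?thesis using median_halfspace[OF A fin] by blast
    qed auto
  qed
  then obtain \<mu> where \<mu>: "\<And>b::'a. b \<in> Basis \<Longrightarrow> emeasure lborel {x \<in> A. x \<bullet> b < \<mu> b} = emeasure lborel {x \<in> A. \<mu> b < x \<bullet> b}"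
    using choice[where Q="\<lambda>b s. b \<in> Basis \<longrightarrow> emeasure lborel {x \<in> A. x \<bullet> b < s} = emeasure lborel {x \<in> A. s < x \<bullet> b}"] by blast
  define c :: 'a where "c = (\<Sum>b\<in>Basis. \<mu> b *\<^sub>R b)"
  have c: "c \<bullet> b = \<mu> b" if "b \<in> Basis" for b
    using that by (simp add: c_def)
  have trans: "emeasure lborel {x. x + c \<in> X} = emeasure lborel X" if [measurable]: "X \<in> sets borel" for X
  proof -
    have "emeasure lborel X = emeasure (distr lborel borel ((+) c)) X" by (simp only: lborel_distr_plus)
    also have "\<dots> = emeasure lborel {x. x + c \<in> X}" by (simp add: emeasure_distr vimage_def add.commute)
    finally show ?thesis ..
  qed
  define A0 where "A0 = {x. x + c \<in> A}"
  have "A0 = {x \<in> space borel. x + c \<in> A}" by (simp add: A0_def)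
  also have "\<dots> \<in> sets borel" by measurable
  finally have A0[measurable]: "A0 \<in> sets borel" .
  have emA0: "emeasure lborel A0 = emeasure lborel A" unfolding A0_def by (rule trans[OF A])
  have EA0: "riesz_energy \<alpha> A0 = riesz_energy \<alpha> A"
    unfolding A0_def by (rule riesz_energy_translate[OF A])
  have fin0: "emeasure lborel A0 < \<infinity>" using fin emA0 by simp
  have "AE x in lborel. x \<in> A0 \<longleftrightarrow> x \<in> ball 0 r"
  proof (rule centered_rigid_is_ball[OF A0 fin0])
    show "emeasure lborel A0 = emeasure lborel (ball (0::'a) r)" using emA0 vol by simp
    show "gain_set w s A0 \<in> null_sets lborel \<or> loss_set w s A0 \<in> null_sets lborel" if w: "w \<noteq> 0" for w s
    proof (rule riesz_energy_polarize_eq[OF \<alpha>(2) w A0 _ riesz_energy_finite[OF \<alpha> A0 fin0]])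
      have "riesz_energy \<alpha> (polarize w s A0) \<le> riesz_energy \<alpha> (ball (0::'a) r)"
        by (rule riesz_energy_le_ball[OF \<alpha>]) (use fin0 emA0 vol emeasure_polarize[OF w A0] in simp_all)
      also have "\<dots> \<le> riesz_energy \<alpha> A0" using E EA0 by simp
      finally show "riesz_energy \<alpha> (polarize w s A0) \<le> riesz_energy \<alpha> A0" .
    qed
    show "emeasure lborel {x \<in> A0. x \<bullet> b < 0} = emeasure lborel {x \<in> A0. 0 < x \<bullet> b}" if b: "b \<in> Basis" for b
    proof -
      note m = halfspace_Int_measurable[OF A, where w=b and s="\<mu> b"]
      have "{x \<in> A0. x \<bullet> b < 0} = {x. x + c \<in> {x \<in> A. x \<bullet> b < \<mu> b}}" "{x \<in> A0. 0 < x \<bullet> b} = {x. x + c \<in> {x \<in> A. \<mu> b < x \<bullet> b}}"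
        by (auto simp: A0_def inner_add_left c[OF b])
      then show ?thesis using trans[OF m(1)] trans[OF m(2)] \<mu>[OF b] by simp
    qed
  qed
  then have "AE x in distr lborel borel ((+) (- c)). x \<in> A0 \<longleftrightarrow> x \<in> ball 0 r"
    by (simp only: lborel_distr_plus)
  then have "AE x in lborel. (- c + x \<in> A0) \<longleftrightarrow> (- c + x \<in> ball 0 r)"
    by (intro AE_distrD[of "(+) (- c)" lborel borel]) simp_all
  then have "AE x in lborel. x \<in> A \<longleftrightarrow> x \<in> ball c r"
    by (rule AE_mp, intro AE_I2) (simp add: A0_def dist_norm norm_minus_commute)
  then show ?thesis by blast
qed

section \<open>The energy of a ball\<close>

lemma nn_integral_exp_tail:
  fixes m :: real
  shows "(\<integral>\<^sup>+v. ennreal (exp (- v)) * indicator {m<..} v \<partial>lborel) = ennreal (exp (- m))"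
proof -
  have "(\<integral>\<^sup>+v. ennreal (exp (- v)) * indicator {m<..} v \<partial>lborel) = (\<integral>\<^sup>+v. ennreal (exp (- v)) * indicator {m..} v \<partial>lborel)"
    by (rule nn_integral_cong_AE, rule eventually_mono[OF AE_lborel_singleton[of m]]) (auto simp: indicator_def)
  also have "\<dots> = ennreal (0 - (- exp (- m)))"
  proof (rule nn_integral_FTC_atLeast)
    show "((\<lambda>v. - exp (- v)) has_real_derivative exp (- v)) (at v)" for v :: real
      by (auto intro!: derivative_eq_intros)
    have "((\<lambda>v::real. - exp (- v)) \<longlongrightarrow> - 0) at_top"
      by (intro tendsto_minus filterlim_compose[OF exp_at_bot filterlim_uminus_at_bot_at_top])
    then show "((\<lambda>v::real. - exp (- v)) \<longlongrightarrow> 0) at_top" by simp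
  qed auto
  finally show ?thesis by simp
qed

lemma nn_integral_Gamma:
  fixes s :: real
  assumes "0 < s"
  shows "(\<integral>\<^sup>+v. ennreal (v powr (s - 1) * exp (- v)) * indicator {0<..} v \<partial>lborel) = ennreal (Gamma s)"
  unfolding Gamma_conv_nn_integral_real[OF assms]
  by (rule nn_integral_cong_AE, rule eventually_mono[OF AE_lborel_singleton[of 0]])
    (auto simp: indicator_def exp_minus divide_inverse)

text \<open>Writing \<open>exp (- h\<^sup>2)\<close> as the tail integral of \<open>exp (- v)\<close> over \<open>v > h\<^sup>2\<close> replaces the substitution \<open>v = h\<^sup>2\<close> on an unbounded
  interval.\<close>
lemma nn_integral_half_gaussian_moment:
  fixes \<beta> :: real
  assumes \<beta>: "-1 < \<beta>"
  shows "(\<integral>\<^sup>+h. ennreal (h powr \<beta> * exp (- h\<^sup>2)) * indicator {0<..} h \<partial>lborel) = ennreal (Gamma ((\<beta> + 1) / 2) / 2)"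
proof -
  have "(\<integral>\<^sup>+h. ennreal (h powr \<beta> * exp (- h\<^sup>2)) * indicator {0<..} h \<partial>lborel)
    = (\<integral>\<^sup>+h. \<integral>\<^sup>+v. ennreal (h powr \<beta>) * indicator {0<..} h * (ennreal (exp (- v)) * indicator {h\<^sup>2<..} v) \<partial>lborel \<partial>lborel)"
    by (intro nn_integral_cong, subst nn_integral_cmult) (simp_all add: nn_integral_exp_tail ennreal_mult mult_ac)
  also have "\<dots> = (\<integral>\<^sup>+v. \<integral>\<^sup>+h. ennreal (h powr \<beta>) * indicator {0<..} h * (ennreal (exp (- v)) * indicator {h\<^sup>2<..} v) \<partial>lborel \<partial>lborel)"
    unfolding indicator_def greaterThan_iff by (rule lborel_pair.Fubini') measurable
  also have "\<dots> = (\<integral>\<^sup>+v. ennreal (1 / (\<beta> + 1)) * (ennreal (v powr ((\<beta> + 1) / 2) * exp (- v)) * indicator {0<..} v) \<partial>lborel)"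
  proof (rule nn_integral_cong)
    fix v :: real
    show "(\<integral>\<^sup>+h. ennreal (h powr \<beta>) * indicator {0<..} h * (ennreal (exp (- v)) * indicator {h\<^sup>2<..} v) \<partial>lborel)
      = ennreal (1 / (\<beta> + 1)) * (ennreal (v powr ((\<beta> + 1) / 2) * exp (- v)) * indicator {0<..} v)"
    proof (cases "0 < v")
      case True
      have "(\<integral>\<^sup>+h. ennreal (h powr \<beta>) * indicator {0<..} h * (ennreal (exp (- v)) * indicator {h\<^sup>2<..} v) \<partial>lborel)
        = (\<integral>\<^sup>+h. ennreal (exp (- v)) * (ennreal (h powr \<beta>) * indicator {0..sqrt v} h) \<partial>lborel)"
      proof (rule nn_integral_cong_AE, rule eventually_mono)
        show "AE h in lborel. h \<noteq> 0 \<and> h \<noteq> sqrt v"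
          using AE_lborel_singleton[of "0::real"] AE_lborel_singleton[of "sqrt v"] by eventually_elim simp
        show "ennreal (h powr \<beta>) * indicator {0<..} h * (ennreal (exp (- v)) * indicator {h\<^sup>2<..} v)
          = ennreal (exp (- v)) * (ennreal (h powr \<beta>) * indicator {0..sqrt v} h)" if h: "h \<noteq> 0 \<and> h \<noteq> sqrt v" for h
        proof -
          have "h\<^sup>2 < v \<longleftrightarrow> h < sqrt v" if "0 < h"
            using real_sqrt_less_iff[of "h\<^sup>2" v] that by simp
          then show ?thesis using h by (auto simp: indicator_def mult_ac)
        qed
      qed
      also have "\<dots> = ennreal (exp (- v)) * ennreal (sqrt v powr (\<beta> + 1) / (\<beta> + 1))"
        using nn_integral_powr_from_0[OF \<beta>, of "sqrt v"] True by (simp add: nn_integral_cmult)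
      also have "sqrt v powr (\<beta> + 1) = v powr ((\<beta> + 1) / 2)"
        using True by (simp add: powr_half_sqrt[symmetric] powr_powr)
      finally show ?thesis using True \<beta> by (simp add: ennreal_mult[symmetric] mult_ac)
    next
      case False
      then have "\<not> h\<^sup>2 < v" for h using zero_le_power2[of h] by linarith
      then show ?thesis using False by (simp add: indicator_def)
    qed
  qed
  also have "\<dots> = ennreal (1 / (\<beta> + 1)) * ennreal (Gamma ((\<beta> + 1) / 2 + 1))"
  proof -
    have "0 < (\<beta> + 1) / 2 + 1" using \<beta> by (intro add_nonneg_pos) auto
    then show ?thesis using nn_integral_Gamma[of "(\<beta> + 1) / 2 + 1"] by (simp add: nn_integral_cmult)
  qed
  also have "Gamma ((\<beta> + 1) / 2 + 1) = (\<beta> + 1) / 2 * Gamma ((\<beta> + 1) / 2)"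
    using \<beta> by (intro Gamma_plus1) (auto dest: nonpos_Ints_nonpos)
  also have "ennreal (1 / (\<beta> + 1)) * ennreal ((\<beta> + 1) / 2 * Gamma ((\<beta> + 1) / 2)) = ennreal (Gamma ((\<beta> + 1) / 2) / 2)"
    using \<beta> by (subst ennreal_mult[symmetric]) (auto simp: Gamma_real_pos less_imp_le)
  finally show ?thesis .
qed

lemma nn_integral_gaussian: "(\<integral>\<^sup>+h. ennreal (exp (- h\<^sup>2)) \<partial>lborel) = ennreal (sqrt pi)"
proof -
  let ?g = "\<lambda>h::real. ennreal (exp (- h\<^sup>2)) * indicator {0<..} h"
  have half: "(\<integral>\<^sup>+h. ?g h \<partial>lborel) = ennreal (sqrt pi / 2)"
  proof -
    have "(\<integral>\<^sup>+h. ?g h \<partial>lborel) = (\<integral>\<^sup>+h. ennreal (h powr 0 * exp (- h\<^sup>2)) * indicator {0<..} h \<partial>lborel)"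
      by (intro nn_integral_cong) (auto simp: indicator_def)
    also have "\<dots> = ennreal (sqrt pi / 2)"
      using nn_integral_half_gaussian_moment[of 0] by (simp add: Gamma_one_half_real)
    finally show ?thesis .
  qed
  have "(\<integral>\<^sup>+h. ennreal (exp (- h\<^sup>2)) \<partial>lborel) = (\<integral>\<^sup>+h. ?g h + ?g (0 + (-1) * h) \<partial>lborel)"
    by (rule nn_integral_cong_AE, rule eventually_mono[OF AE_lborel_singleton[of 0]]) (auto simp: indicator_def)
  also have "\<dots> = (\<integral>\<^sup>+h. ?g h \<partial>lborel) + (\<integral>\<^sup>+h. ?g (0 + (-1) * h) \<partial>lborel)"
    by (rule nn_integral_add) measurable
  also have "(\<integral>\<^sup>+h. ?g (0 + (-1) * h) \<partial>lborel) = (\<integral>\<^sup>+h. ?g h \<partial>lborel)"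
    by (subst (2) nn_integral_real_affine[where c="-1" and t=0]) auto
  finally show ?thesis unfolding half by (simp add: ennreal_plus[symmetric] del: ennreal_plus)
qed

lemma gaussian_halfspace_axis:
  assumes b: "b \<in> (Basis :: 'a::euclidean_space set)"
  shows "(\<integral>\<^sup>+y. ennreal (exp (- (norm y)\<^sup>2)) * indicator {t<..} (y \<bullet> b) \<partial>lborel)
    = ennreal (sqrt pi ^ (DIM('a) - 1)) * (\<integral>\<^sup>+h. ennreal (exp (- h\<^sup>2)) * indicator {t<..} h \<partial>lborel)"
proof -
  let ?f = "\<lambda>b' h. if b' = b then ennreal (exp (- h\<^sup>2)) * indicator {t<..} h else ennreal (exp (- h\<^sup>2))"
  have "ennreal (exp (- (norm y)\<^sup>2)) * indicator {t<..} (y \<bullet> b) = (\<Prod>b'\<in>Basis. ?f b' (y \<bullet> b'))" for y :: 'a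
  proof -
    have "(norm y)\<^sup>2 = (\<Sum>b'\<in>Basis. (y \<bullet> b')\<^sup>2)"
      unfolding power2_norm_eq_inner using euclidean_inner[of y y] by (simp add: power2_eq_square)
    then have "exp (- (norm y)\<^sup>2) = (\<Prod>b'\<in>Basis. exp (- (y \<bullet> b')\<^sup>2))"
      by (simp add: exp_sum sum_negf[symmetric])
    then have "ennreal (exp (- (norm y)\<^sup>2)) = (\<Prod>b'\<in>Basis. ennreal (exp (- (y \<bullet> b')\<^sup>2)))"
      by (simp add: prod_ennreal)
    also have "\<dots> = ennreal (exp (- (y \<bullet> b)\<^sup>2)) * (\<Prod>b'\<in>Basis - {b}. ennreal (exp (- (y \<bullet> b')\<^sup>2)))"
      by (rule prod.remove[OF finite_Basis b])
    finally show ?thesis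
      by (subst prod.remove[OF finite_Basis b]) (simp add: mult_ac)
  qed
  then have "(\<integral>\<^sup>+y. ennreal (exp (- (norm y)\<^sup>2)) * indicator {t<..} (y \<bullet> b) \<partial>lborel) = (\<integral>\<^sup>+y. (\<Prod>b'\<in>Basis. ?f b' ((y::'a) \<bullet> b')) \<partial>lborel)"
    by simp
  also have "\<dots> = (\<Prod>b'\<in>(Basis::'a set). (\<integral>\<^sup>+h. ?f b' h \<partial>lborel))"
    by (rule nn_integral_lborel_prod) auto
  also have "\<dots> = (\<integral>\<^sup>+h. ennreal (exp (- h\<^sup>2)) * indicator {t<..} h \<partial>lborel) * (\<Prod>b'\<in>(Basis::'a set) - {b}. (\<integral>\<^sup>+h. ?f b' h \<partial>lborel))"
    by (subst prod.remove[OF finite_Basis b]) simp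
  also have "(\<Prod>b'\<in>(Basis::'a set) - {b}. (\<integral>\<^sup>+h. ?f b' h \<partial>lborel)) = (\<Prod>b'\<in>(Basis::'a set) - {b}. ennreal (sqrt pi))"
    by (rule prod.cong) (simp_all add: nn_integral_gaussian)
  also have "\<dots> = ennreal (sqrt pi ^ (DIM('a) - 1))"
    using b by (simp add: card_Diff_singleton ennreal_power)
  finally show ?thesis by (simp add: mult_ac)
qed

text \<open>A reflection that takes \<open>z\<close> to \<open>- |z| b\<close> for a basis vector \<open>b\<close> reduces the half-space to one that is orthogonal to an axis, where the
  Gaussian factorizes.\<close>
lemma gaussian_halfspace:
  fixes z :: "'a::euclidean_space"
  assumes z: "z \<noteq> 0"
  shows "(\<integral>\<^sup>+y. ennreal (exp (- (norm y)\<^sup>2)) * indicator {..<0} ((norm z)\<^sup>2 + 2 * (z \<bullet> y)) \<partial>lborel)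
    = ennreal (sqrt pi ^ (DIM('a) - 1)) * (\<integral>\<^sup>+h. ennreal (exp (- h\<^sup>2)) * indicator {norm z / 2<..} h \<partial>lborel)"
proof -
  obtain b :: 'a where b: "b \<in> Basis" using nonempty_Basis by blast
  have cond: "(norm z)\<^sup>2 + 2 * (- norm z * (y \<bullet> b)) < 0 \<longleftrightarrow> norm z / 2 < y \<bullet> b" for y
  proof -
    have "(norm z)\<^sup>2 + 2 * (- norm z * (y \<bullet> b)) = norm z * (norm z - 2 * (y \<bullet> b))"
      by (simp add: power2_eq_square algebra_simps)
    then show ?thesis using z by (simp add: mult_less_0_iff) linarith
  qed
  have axis: "(\<integral>\<^sup>+y. ennreal (exp (- (norm y)\<^sup>2)) * indicator {..<0} ((norm z)\<^sup>2 + 2 * (- norm z * (y \<bullet> b))) \<partial>lborel)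
    = ennreal (sqrt pi ^ (DIM('a) - 1)) * (\<integral>\<^sup>+h. ennreal (exp (- h\<^sup>2)) * indicator {norm z / 2<..} h \<partial>lborel)"
    unfolding gaussian_halfspace_axis[OF b, symmetric]
    by (intro nn_integral_cong) (simp only: indicator_def lessThan_iff greaterThan_iff cond)
  show ?thesis
  proof (cases "z = - norm z *\<^sub>R b")
    case True
    then have "z \<bullet> y = - norm z * (y \<bullet> b)" for y
      by (metis inner_commute inner_scaleR_right)
    then show ?thesis using axis by simp
  next
    case False
    define w where "w = z + norm z *\<^sub>R b"
    have w: "w \<noteq> 0" using False by (auto simp: w_def add_eq_0_iff)
    define r where "r = reflect w 0"
    have bb: "b \<bullet> b = 1" using b by simp
    have zz: "z \<bullet> z = norm z * norm z" by (simp add: dot_square_norm power2_eq_square)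
    have ww: "w \<bullet> w = 2 * (z \<bullet> w)"
      by (simp add: w_def inner_add_left inner_add_right bb zz inner_commute)
    have "2 * (z \<bullet> w / (w \<bullet> w)) = (w \<bullet> w) / (w \<bullet> w)" by (simp only: times_divide_eq_right ww)
    also have "\<dots> = 1" by (rule divide_self) (simp add: w)
    finally have two: "2 * (z \<bullet> w / (w \<bullet> w)) = 1" .
    have "r z = z - (2 * (z \<bullet> w / (w \<bullet> w))) *\<^sub>R w" by (simp add: r_def reflect_def)
    then have rz: "r z = - norm z *\<^sub>R b" unfolding two by (simp add: w_def)
    have self: "z \<bullet> r y = - norm z * (y \<bullet> b)" for y
    proof -
      have "z \<bullet> r y = r z \<bullet> y"
        by (simp add: r_def reflect_def inner_diff_left inner_diff_right inner_commute)
      then show ?thesis by (simp add: rz inner_commute)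
    qed
    have nr: "norm (r y) = norm y" for y
      using norm_reflect_sq[OF w, of 0 y] by (simp add: r_def)
    have "(\<integral>\<^sup>+y. ennreal (exp (- (norm y)\<^sup>2)) * indicator {..<0} ((norm z)\<^sup>2 + 2 * (z \<bullet> y)) \<partial>lborel)
      = (\<integral>\<^sup>+y. ennreal (exp (- (norm (r y))\<^sup>2)) * indicator {..<0} ((norm z)\<^sup>2 + 2 * (z \<bullet> r y)) \<partial>lborel)"
      unfolding r_def by (rule nn_integral_reflect[OF w, symmetric]) measurable
    then show ?thesis unfolding nr self axis .
  qed
qed

lemma AE_norm_neq: "AE x in lborel. norm (x::'a::euclidean_space) \<noteq> norm (y::'a)"
proof -
  have "sphere (0::'a) (norm y) \<in> null_sets lborel"
    using negligible_sphere[of "0::'a" "norm y"]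
    by (auto simp: null_sets_completion_iff negligible_iff_null_sets)
  from AE_not_in[OF this] show ?thesis by simp
qed

lemma riesz_energy_ball_scale:
  fixes u :: real
  assumes u: "0 < u"
  shows "riesz_energy \<alpha> (ball (0::'a::euclidean_space) u) = ennreal (u powr (real DIM('a) + \<alpha>)) * riesz_energy \<alpha> (ball (0::'a) 1)"
proof -
  let ?B = "\<lambda>u. ball (0::'a) u"
  have [measurable]: "?B u \<in> sets borel" "?B 1 \<in> sets borel" by simp_all
  have k: "indicator (?B u) (0 + u *\<^sub>R x) * indicator (?B u) (0 + u *\<^sub>R y) * riesz_kernel \<alpha> (0 + u *\<^sub>R x) (0 + u *\<^sub>R y)
    = ennreal (u powr (\<alpha> - real DIM('a))) * (indicator (?B 1) x * indicator (?B 1) y * riesz_kernel \<alpha> x y)" for x y :: 'a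
  proof -
    have 1: "u * norm x < u \<longleftrightarrow> norm x < 1" for x :: 'a using u by simp
    have "norm (u *\<^sub>R x - u *\<^sub>R y) = u * norm (x - y)"
      using u by (simp add: scaleR_diff_right[symmetric])
    then have "riesz_kernel \<alpha> (u *\<^sub>R x) (u *\<^sub>R y) = ennreal (u powr (\<alpha> - real DIM('a)) * (1 / norm (x - y) powr (real DIM('a) - \<alpha>)))"
      using u powr_minus_divide[of u "real DIM('a) - \<alpha>"] by (simp add: riesz_kernel_def powr_mult)
    also have "\<dots> = ennreal (u powr (\<alpha> - real DIM('a))) * riesz_kernel \<alpha> x y"
      unfolding riesz_kernel_def by (rule ennreal_mult) auto
    finally show ?thesis using u by (simp add: indicator_def 1)
  qed
  have "riesz_energy \<alpha> (?B u) = (\<integral>\<^sup>+y. ennreal (\<bar>u\<bar> ^ DIM('a)) * (\<integral>\<^sup>+x. indicator (?B u) (0 + u *\<^sub>R x) * indicator (?B u) y * riesz_kernel \<alpha> (0 + u *\<^sub>R x) y \<partial>lborel) \<partial>lborel)"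
    unfolding riesz_energy_def using u by (intro nn_integral_cong nn_integral_lborel_affine) auto
  also have "\<dots> = ennreal (\<bar>u\<bar> ^ DIM('a)) * (\<integral>\<^sup>+y. ennreal (\<bar>u\<bar> ^ DIM('a)) * (\<integral>\<^sup>+x. indicator (?B u) (0 + u *\<^sub>R x) * indicator (?B u) (0 + u *\<^sub>R y) * riesz_kernel \<alpha> (0 + u *\<^sub>R x) (0 + u *\<^sub>R y) \<partial>lborel) \<partial>lborel)"
    using u by (intro nn_integral_lborel_affine) auto
  also have "\<dots> = ennreal (\<bar>u\<bar> ^ DIM('a)) * (ennreal (\<bar>u\<bar> ^ DIM('a)) * (ennreal (u powr (\<alpha> - real DIM('a))) * riesz_energy \<alpha> (?B 1)))"
    unfolding k riesz_energy_def by (simp add: nn_integral_cmult)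
  also have "\<dots> = ennreal (\<bar>u\<bar> ^ DIM('a) * (\<bar>u\<bar> ^ DIM('a) * u powr (\<alpha> - real DIM('a)))) * riesz_energy \<alpha> (?B 1)"
    using u by (simp add: ennreal_mult mult.assoc)
  also have "\<bar>u\<bar> ^ DIM('a) * (\<bar>u\<bar> ^ DIM('a) * u powr (\<alpha> - real DIM('a))) = u powr (real DIM('a) + \<alpha>)"
    using u by (simp add: powr_realpow[symmetric] powr_add[symmetric])
  finally show ?thesis .
qed

text \<open>Homogeneity of the energy turns the integral of \<open>exp (- v)\<close> times the energy of the ball of radius \<open>sqrt v\<close> into a Gamma function;
  exchanging the integrals turns it into a Gaussian-weighted energy of the whole space.\<close>
lemma riesz_energy_unit_ball_gaussian:
  assumes \<alpha>: "0 < \<alpha>" "\<alpha> < real DIM('a::euclidean_space)"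
  shows "ennreal (Gamma ((real DIM('a) + \<alpha>) / 2 + 1)) * riesz_energy \<alpha> (ball (0::'a) 1)
    = (\<integral>\<^sup>+y. \<integral>\<^sup>+x. riesz_kernel \<alpha> x y * ennreal (exp (- max ((norm (x::'a))\<^sup>2) ((norm y)\<^sup>2))) \<partial>lborel \<partial>lborel)"
proof -
  define s where "s = (real DIM('a) + \<alpha>) / 2"
  have s: "0 < s + 1" unfolding s_def using \<alpha>(1) by (intro add_nonneg_pos divide_nonneg_pos add_nonneg_nonneg) auto
  let ?B = "\<lambda>v. ball (0::'a) (sqrt v)"
  have "ennreal (Gamma (s + 1)) * riesz_energy \<alpha> (ball (0::'a) 1) 
    = (\<integral>\<^sup>+v. (ennreal (v powr s * exp (- v)) * indicator {0<..} v) * riesz_energy \<alpha> (ball (0::'a) 1) \<partial>lborel)"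
    using nn_integral_Gamma[OF s] by (simp add: nn_integral_multc)
  also have "\<dots> = (\<integral>\<^sup>+v. ennreal (exp (- v)) * indicator {0<..} v * riesz_energy \<alpha> (?B v) \<partial>lborel)"
  proof (rule nn_integral_cong)
    fix v :: real
    show "ennreal (v powr s * exp (- v)) * indicator {0<..} v * riesz_energy \<alpha> (ball (0::'a) 1) = ennreal (exp (- v)) * indicator {0<..} v * riesz_energy \<alpha> (?B v)"
    proof (cases "0 < v")
      case True
      have "sqrt v powr (real DIM('a) + \<alpha>) = v powr s"
        using True by (simp add: powr_half_sqrt[symmetric] powr_powr s_def)
      then show ?thesis using True riesz_energy_ball_scale[of "sqrt v" \<alpha>, where 'a='a] by (simp add: ennreal_mult mult_ac)
    qed simp
  qed
  also have "\<dots> = (\<integral>\<^sup>+v. \<integral>\<^sup>+y. \<integral>\<^sup>+x. riesz_kernel \<alpha> x y * (ennreal (exp (- v)) * indicator {max ((norm (x::'a))\<^sup>2) ((norm y)\<^sup>2)<..} v) \<partial>lborel \<partial>lborel \<partial>lborel)"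
  proof (rule nn_integral_cong)
    fix v :: real
    have [measurable]: "?B v \<in> sets borel" by simp
    have i: "indicator {0<..} v * (indicator (?B v) x * indicator (?B v) y) = (indicator {max ((norm x)\<^sup>2) ((norm y)\<^sup>2)<..} v :: ennreal)" for x y :: 'a
    proof (cases "0 < v")
      case True
      have "norm z < sqrt v \<longleftrightarrow> (norm z)\<^sup>2 < v" for z :: 'a
        using real_sqrt_less_iff[of "(norm z)\<^sup>2" v] by simp
      then show ?thesis using True by (auto simp: indicator_def)
    next
      case False
      then have "\<not> (norm x)\<^sup>2 < v" using zero_le_power2[of "norm x"] by linarith
      then show ?thesis using False by (auto simp: indicator_def)
    qed
    have "ennreal (exp (- v)) * indicator {0<..} v * riesz_energy \<alpha> (?B v)
      = (\<integral>\<^sup>+y. \<integral>\<^sup>+x. ennreal (exp (- v)) * indicator {0<..} v * (indicator (?B v) x * indicator (?B v) y * riesz_kernel \<alpha> x y) \<partial>lborel \<partial>lborel)"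
      unfolding riesz_energy_def by (simp add: nn_integral_cmult)
    also have "\<dots> = (\<integral>\<^sup>+y. \<integral>\<^sup>+x. riesz_kernel \<alpha> x y * (ennreal (exp (- v)) * indicator {max ((norm (x::'a))\<^sup>2) ((norm y)\<^sup>2)<..} v) \<partial>lborel \<partial>lborel)"
      unfolding i[symmetric] by (simp only: mult_ac)
    finally show "ennreal (exp (- v)) * indicator {0<..} v * riesz_energy \<alpha> (?B v) = (\<integral>\<^sup>+y. \<integral>\<^sup>+x. riesz_kernel \<alpha> x y * (ennreal (exp (- v)) * indicator {max ((norm (x::'a))\<^sup>2) ((norm y)\<^sup>2)<..} v) \<partial>lborel \<partial>lborel)" .
  qed
  also have "\<dots> = (\<integral>\<^sup>+y. \<integral>\<^sup>+v. \<integral>\<^sup>+x. riesz_kernel \<alpha> x y * (ennreal (exp (- v)) * indicator {max ((norm (x::'a))\<^sup>2) ((norm y)\<^sup>2)<..} v) \<partial>lborel \<partial>lborel \<partial>lborel)"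
    unfolding indicator_def greaterThan_iff by (rule lborel_pair.Fubini') measurable
  also have "\<dots> = (\<integral>\<^sup>+y. \<integral>\<^sup>+x. \<integral>\<^sup>+v. riesz_kernel \<alpha> x y * (ennreal (exp (- v)) * indicator {max ((norm (x::'a))\<^sup>2) ((norm y)\<^sup>2)<..} v) \<partial>lborel \<partial>lborel \<partial>lborel)"
    unfolding indicator_def greaterThan_iff by (rule nn_integral_cong, rule lborel_pair.Fubini') measurable
  also have "\<dots> = (\<integral>\<^sup>+y. \<integral>\<^sup>+x. riesz_kernel \<alpha> x y * ennreal (exp (- max ((norm (x::'a))\<^sup>2) ((norm y)\<^sup>2))) \<partial>lborel \<partial>lborel)"
    by (intro nn_integral_cong) (simp add: nn_integral_cmult nn_integral_exp_tail)
  finally show ?thesis by (simp add: s_def)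
qed

text \<open>By symmetry, the weighted energy is twice its part \<open>J\<close> with \<open>|x| < |y|\<close>. With \<open>x = y + z\<close> that condition reads
  \<open>|z|\<^sup>2 + 2 z \<bullet> y < 0\<close>, a half-space in \<open>y\<close>; integrating first in \<open>y\<close> and then in \<open>z\<close> leaves one-dimensional integrals.\<close>
lemma riesz_energy_unit_ball:
  assumes \<alpha>: "0 < \<alpha>" "\<alpha> < real DIM('a::euclidean_space)"
  shows "ennreal (Gamma ((real DIM('a) + \<alpha>) / 2 + 1)) * riesz_energy \<alpha> (ball (0::'a) 1)
    = ennreal (sqrt pi ^ (DIM('a) - 1) * (real DIM('a) * unit_ball_vol (real DIM('a)) * 2 powr \<alpha> / \<alpha>) * Gamma ((\<alpha> + 1) / 2))"
proof -
  let ?k = "riesz_kernel \<alpha> :: 'a \<Rightarrow> 'a \<Rightarrow> ennreal"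
  let ?e = "\<lambda>y::'a. ennreal (exp (- (norm y)\<^sup>2))"
  define C where "C = real DIM('a) * unit_ball_vol (real DIM('a)) / \<alpha>"
  have C: "0 \<le> C" using \<alpha> by (simp add: C_def)
  let ?c = "ennreal (sqrt pi ^ (DIM('a) - 1))"
  define J where "J = (\<integral>\<^sup>+y. \<integral>\<^sup>+x. ?k x y * ?e y * indicator {..<norm y} (norm x) \<partial>lborel \<partial>lborel)"
  have "(\<integral>\<^sup>+y. \<integral>\<^sup>+x. ?k x y * ennreal (exp (- max ((norm x)\<^sup>2) ((norm y)\<^sup>2))) \<partial>lborel \<partial>lborel)
    = (\<integral>\<^sup>+y. \<integral>\<^sup>+x. ?k x y * ?e y * indicator {..<norm y} (norm x) + ?k x y * ?e x * indicator {..<norm x} (norm y) \<partial>lborel \<partial>lborel)"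
  proof (rule nn_integral_cong, rule nn_integral_cong_AE, rule eventually_mono[OF AE_norm_neq])
    fix x y :: 'a assume "norm x \<noteq> norm y"
    then consider "norm x < norm y" "(norm x)\<^sup>2 \<le> (norm y)\<^sup>2" | "norm y < norm x" "(norm y)\<^sup>2 \<le> (norm x)\<^sup>2"
      by (meson less_imp_le linorder_neqE_linordered_idom norm_ge_zero power_mono)
    then show "?k x y * ennreal (exp (- max ((norm x)\<^sup>2) ((norm y)\<^sup>2))) = ?k x y * ?e y * indicator {..<norm y} (norm x) + ?k x y * ?e x * indicator {..<norm x} (norm y)"
      by cases (simp_all add: max_def)
  qed
  also have "\<dots> = J + (\<integral>\<^sup>+y. \<integral>\<^sup>+x. ?k x y * ?e x * indicator {..<norm x} (norm y) \<partial>lborel \<partial>lborel)"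
    unfolding J_def indicator_def lessThan_iff by (simp add: nn_integral_add)
  also have "(\<integral>\<^sup>+y. \<integral>\<^sup>+x. ?k x y * ?e x * indicator {..<norm x} (norm y) \<partial>lborel \<partial>lborel) = (\<integral>\<^sup>+x. \<integral>\<^sup>+y. ?k x y * ?e x * indicator {..<norm x} (norm y) \<partial>lborel \<partial>lborel)"
    unfolding indicator_def lessThan_iff by (rule lborel_pair.Fubini') measurable
  also have "\<dots> = J" unfolding J_def by (simp add: riesz_kernel_commute)
  finally have EJ: "ennreal (Gamma ((real DIM('a) + \<alpha>) / 2 + 1)) * riesz_energy \<alpha> (ball (0::'a) 1) = 2 * J"
    unfolding riesz_energy_unit_ball_gaussian[OF \<alpha>] by (simp add: mult_2)
  have "J = (\<integral>\<^sup>+y. \<integral>\<^sup>+z. ?k z 0 * (?e y * indicator {..<0} ((norm z)\<^sup>2 + 2 * (z \<bullet> y))) \<partial>lborel \<partial>lborel)"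
  proof -
    have "(\<integral>\<^sup>+x. ?k x y * ?e y * indicator {..<norm y} (norm x) \<partial>lborel) = (\<integral>\<^sup>+z. ?k (z + y) y * ?e y * indicator {..<norm y} (norm (z + y)) \<partial>lborel)" for y
      unfolding indicator_def lessThan_iff by (rule nn_integral_lborel_translate[symmetric]) measurable
    moreover have "norm (z + y) < norm y \<longleftrightarrow> (norm z)\<^sup>2 + 2 * (z \<bullet> y) < 0" for z y :: 'a
    proof -
      have "norm (z + y) < norm y \<longleftrightarrow> (norm (z + y))\<^sup>2 < (norm y)\<^sup>2"
        using real_sqrt_less_iff[of "(norm (z + y))\<^sup>2" "(norm y)\<^sup>2"] by simp
      also have "(norm (z + y))\<^sup>2 = (norm z)\<^sup>2 + 2 * (z \<bullet> y) + (norm y)\<^sup>2"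
        by (simp add: power2_norm_eq_inner inner_add_left inner_add_right inner_commute)
      finally show ?thesis by simp
    qed
    ultimately show ?thesis
      unfolding J_def by (simp add: riesz_kernel_def indicator_def mult_ac)
  qed
  also have "\<dots> = (\<integral>\<^sup>+z. \<integral>\<^sup>+y. ?k z 0 * (?e y * indicator {..<0} ((norm z)\<^sup>2 + 2 * (z \<bullet> y))) \<partial>lborel \<partial>lborel)"
    by (rule lborel_pair.Fubini') measurable
  also have "\<dots> = (\<integral>\<^sup>+z. ?c * (\<integral>\<^sup>+h. ?k z 0 * (ennreal (exp (- h\<^sup>2)) * indicator {norm (z::'a) / 2<..} h) \<partial>lborel) \<partial>lborel)"
  proof (rule nn_integral_cong_AE, rule eventually_mono[OF AE_lborel_singleton[of 0]])
    fix z :: 'a assume "z \<noteq> 0"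
    then show "(\<integral>\<^sup>+y. ?k z 0 * (?e y * indicator {..<0} ((norm z)\<^sup>2 + 2 * (z \<bullet> y))) \<partial>lborel)
      = ?c * (\<integral>\<^sup>+h. ?k z 0 * (ennreal (exp (- h\<^sup>2)) * indicator {norm (z::'a) / 2<..} h) \<partial>lborel)"
      by (subst (1 2) nn_integral_cmult) (simp_all add: gaussian_halfspace mult.left_commute)
  qed
  also have "\<dots> = ?c * (\<integral>\<^sup>+z. \<integral>\<^sup>+h. ?k z 0 * (ennreal (exp (- h\<^sup>2)) * indicator {norm (z::'a) / 2<..} h) \<partial>lborel \<partial>lborel)"
    unfolding indicator_def greaterThan_iff by (rule nn_integral_cmult) measurable
  also have "(\<integral>\<^sup>+z. \<integral>\<^sup>+h. ?k z 0 * (ennreal (exp (- h\<^sup>2)) * indicator {norm (z::'a) / 2<..} h) \<partial>lborel \<partial>lborel)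
    = (\<integral>\<^sup>+h. \<integral>\<^sup>+z. ?k z 0 * (ennreal (exp (- h\<^sup>2)) * indicator {norm (z::'a) / 2<..} h) \<partial>lborel \<partial>lborel)"
    unfolding indicator_def greaterThan_iff by (rule lborel_pair.Fubini') measurable
  also have "\<dots> = (\<integral>\<^sup>+h. ennreal (C * 2 powr \<alpha>) * (ennreal (h powr \<alpha> * exp (- h\<^sup>2)) * indicator {0<..} h) \<partial>lborel)"
  proof (rule nn_integral_cong)
    fix h :: real
    show "(\<integral>\<^sup>+z. ?k z 0 * (ennreal (exp (- h\<^sup>2)) * indicator {norm (z::'a) / 2<..} h) \<partial>lborel) = ennreal (C * 2 powr \<alpha>) * (ennreal (h powr \<alpha> * exp (- h\<^sup>2)) * indicator {0<..} h)"
    proof (cases "0 < h")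
      case True
      obtain b :: 'a where b: "b \<in> Basis" using nonempty_Basis by blast
      have [measurable]: "cball (0::'a) (2 * h) \<in> sets borel" by simp
      have "norm ((2 * h) *\<^sub>R b) = 2 * h" using True b by simp
      then have ne: "AE z in lborel. norm (z::'a) \<noteq> 2 * h" using AE_norm_neq[of "(2 * h) *\<^sub>R b"] by simp
      have "(\<integral>\<^sup>+z. ?k z 0 * (ennreal (exp (- h\<^sup>2)) * indicator {norm (z::'a) / 2<..} h) \<partial>lborel)
        = (\<integral>\<^sup>+z. ennreal (exp (- h\<^sup>2)) * (indicator (cball 0 (2 * h)) z * ?k z 0) \<partial>lborel)"
      proof (rule nn_integral_cong_AE, rule eventually_mono[OF ne])
        fix z :: 'a assume "norm z \<noteq> 2 * h"
        then have "norm z / 2 < h \<longleftrightarrow> norm z \<le> 2 * h" by linarith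
        then show "?k z 0 * (ennreal (exp (- h\<^sup>2)) * indicator {norm (z::'a) / 2<..} h) = ennreal (exp (- h\<^sup>2)) * (indicator (cball 0 (2 * h)) z * ?k z 0)"
          by (simp add: indicator_def mult_ac)
      qed
      also have "\<dots> = ennreal (exp (- h\<^sup>2)) * ennreal (C * (2 * h) powr \<alpha>)"
        using riesz_potential_cball[OF \<alpha>, of "2 * h" 0] True by (simp add: nn_integral_cmult C_def)
      also have "\<dots> = ennreal (C * 2 powr \<alpha> * (h powr \<alpha> * exp (- h\<^sup>2)))"
        using True C by (simp add: ennreal_mult[symmetric] powr_mult mult_ac)
      finally show ?thesis using True C by (simp add: ennreal_mult)
    next
      case False
      then have "\<not> norm z / 2 < h" for z :: 'a using norm_ge_zero[of z] by linarith
      then show ?thesis using False by (simp add: indicator_def)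
    qed
  qed
  also have "\<dots> = ennreal (C * 2 powr \<alpha>) * ennreal (Gamma ((\<alpha> + 1) / 2) / 2)"
    using nn_integral_half_gaussian_moment[of \<alpha>] \<alpha> by (simp add: nn_integral_cmult)
  finally have J: "J = ?c * (ennreal (C * 2 powr \<alpha>) * ennreal (Gamma ((\<alpha> + 1) / 2) / 2))" .
  have G: "0 < Gamma ((\<alpha> + 1) / 2)" using \<alpha> by (intro Gamma_real_pos) simp
  have "2 * J = ennreal 2 * (?c * (ennreal (C * 2 powr \<alpha>) * ennreal (Gamma ((\<alpha> + 1) / 2) / 2)))" by (simp add: J)
  also have "\<dots> = ennreal (2 * (sqrt pi ^ (DIM('a) - 1) * (C * 2 powr \<alpha> * (Gamma ((\<alpha> + 1) / 2) / 2))))"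
    using C G by (simp only: ennreal_mult[symmetric] mult_nonneg_nonneg zero_le_power real_sqrt_ge_zero pi_ge_zero powr_ge_zero zero_le_numeral divide_nonneg_nonneg less_imp_le)
  finally show ?thesis unfolding EJ by (simp add: C_def mult_ac)
qed

section \<open>The isoperimetric inequality for the Riesz energy\<close>

lemma sigma_const_pos:
  assumes "0 < \<alpha>" "0 < n"
  shows "0 < sigma_const n \<alpha>"
proof -
  have "0 < Gamma (real n / 2 + 1)" "0 < Gamma ((\<alpha> + 1) / 2)" "0 < Gamma ((real n + \<alpha>) / 2 + 1)"
    using assms by (intro Gamma_real_pos add_nonneg_pos; simp)+
  moreover from this(1) have "0 < Gamma (real n / 2 + 1) powr (\<alpha> / real n)"
    by (subst powr_gt_zero) (rule less_imp_neq[symmetric])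
  ultimately show ?thesis
    unfolding sigma_const_def using assms by (intro divide_pos_pos mult_pos_pos) auto
qed

lemma riesz_energy_ball:
  assumes \<alpha>: "0 < \<alpha>" "\<alpha> < real DIM('a::euclidean_space)" and r: "0 \<le> r"
  shows "riesz_energy \<alpha> (ball (0::'a) r)
    = ennreal (sigma_const DIM('a) \<alpha> * measure lborel (ball (0::'a) r) powr ((real DIM('a) + \<alpha>) / real DIM('a)))"
proof (cases "r = 0")
  case True
  then show ?thesis by (simp add: riesz_energy_def)
next
  case False
  then have r: "0 < r" using r by simp
  define n where "n = real DIM('a)"
  have n: "0 < n" by (simp add: n_def)
  define \<omega> where "\<omega> = unit_ball_vol n"
  have \<omega>: "0 < \<omega>" unfolding \<omega>_def using n by (intro unit_ball_vol_pos) simp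
  define G where "G = Gamma ((n + \<alpha>) / 2 + 1)"
  have G: "0 < G" unfolding G_def using n \<alpha> by (intro Gamma_real_pos add_nonneg_pos divide_nonneg_pos add_nonneg_nonneg) auto
  define H where "H = Gamma ((\<alpha> + 1) / 2)"
  have H: "0 < H" unfolding H_def using \<alpha> by (intro Gamma_real_pos) simp
  have sp: "sqrt pi ^ (DIM('a) - 1) = pi powr ((n - 1) / 2)"
    by (simp add: powr_half_sqrt[symmetric] powr_realpow[symmetric] powr_powr n_def of_nat_diff)
  obtain e where e: "riesz_energy \<alpha> (ball (0::'a) 1) = ennreal e" "0 \<le> e"
    using riesz_energy_finite[OF \<alpha>, of "ball (0::'a) 1"] emeasure_bounded_finite[OF bounded_ball, of "0::'a" 1]
    by (cases "riesz_energy \<alpha> (ball (0::'a) 1)") auto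
  have "ennreal (G * e) = ennreal (pi powr ((n - 1) / 2) * (n * \<omega> * 2 powr \<alpha> / \<alpha>) * H)"
    using riesz_energy_unit_ball[OF \<alpha>] e(2) G by (simp add: e(1) ennreal_mult G_def H_def n_def \<omega>_def sp[unfolded n_def, symmetric])
  then have "G * e = pi powr ((n - 1) / 2) * (n * \<omega> * 2 powr \<alpha> / \<alpha>) * H"
    using G e(2) n \<omega> H \<alpha> by (subst (asm) ennreal_inj) auto
  then have e_eq: "e = pi powr ((n - 1) / 2) * (n * \<omega> * 2 powr \<alpha> / \<alpha>) * H / G"
    using G by (subst nonzero_eq_divide_eq) (simp_all add: mult.commute[of e G])
  have vol: "measure lborel (ball (0::'a) r) = \<omega> * r powr n"
    using r by (simp add: content_ball \<omega>_def n_def powr_realpow)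
  have "(\<omega> * r powr n) powr ((n + \<alpha>) / n) = \<omega> powr (1 + \<alpha> / n) * r powr (n + \<alpha>)"
  proof -
    have "n * ((n + \<alpha>) / n) = n + \<alpha>" using n by simp
    moreover have "(n + \<alpha>) / n = 1 + \<alpha> / n" using n by (simp add: add_divide_distrib)
    ultimately show ?thesis by (metis powr_mult powr_powr)
  qed
  also have "\<omega> powr (1 + \<alpha> / n) = \<omega> * \<omega> powr (\<alpha> / n)"
    using \<omega> by (simp add: powr_add)
  also have "\<omega> powr (\<alpha> / n) = pi powr (\<alpha> / 2) / Gamma (n / 2 + 1) powr (\<alpha> / n)"
    using n by (simp add: \<omega>_def unit_ball_vol_def powr_divide powr_powr)
  finally have volq: "(\<omega> * r powr n) powr ((n + \<alpha>) / n) = \<omega> * (pi powr (\<alpha> / 2) / Gamma (n / 2 + 1) powr (\<alpha> / n)) * r powr (n + \<alpha>)" .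
  have gn: "0 < Gamma (n / 2 + 1) powr (\<alpha> / n)"
  proof -
    have "0 < Gamma (n / 2 + 1)" using n by (intro Gamma_real_pos) simp
    then show ?thesis by simp
  qed
  have pp: "pi powr ((n - \<alpha> - 1) / 2) * pi powr (\<alpha> / 2) = pi powr ((n - 1) / 2)"
    by (simp add: powr_add[symmetric] field_simps)
  have "sigma_const DIM('a) \<alpha> * (\<omega> * r powr n) powr ((n + \<alpha>) / n) = 
     (pi powr ((n - \<alpha> - 1) / 2) * pi powr (\<alpha> / 2)) * (n * \<omega> * 2 powr \<alpha> / \<alpha>) * H / G * r powr (n + \<alpha>)"
    unfolding volq sigma_const_def n_def[symmetric] G_def[symmetric] H_def[symmetric]
    using gn \<alpha> G by (simp add: field_simps)
  also have "\<dots> = e * r powr (n + \<alpha>)" unfolding pp e_eq ..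
  finally have "sigma_const DIM('a) \<alpha> * measure lborel (ball (0::'a) r) powr ((n + \<alpha>) / n) = e * r powr (n + \<alpha>)"
    unfolding vol .
  then show ?thesis
    using riesz_energy_ball_scale[OF r, of \<alpha>, where 'a='a] e by (simp add: n_def ennreal_mult mult.commute)
qed

lemma emeasure_eq_ball0:
  assumes "emeasure lborel (A::'a::euclidean_space set) < \<infinity>"
  obtains r where "0 \<le> r" "emeasure lborel A = emeasure lborel (ball (0::'a) r)" "measure lborel A = measure lborel (ball (0::'a) r)"
  using exists_ball_of_measure[OF assms, of "0::'a"] by (metis measure_def)

theorem riesz_energy_isoperimetric:
  fixes A :: "'a::euclidean_space set"
  assumes \<alpha>: "0 < \<alpha>" "\<alpha> < real DIM('a)" and A: "A \<in> sets borel" and fin: "emeasure lborel A < \<infinity>"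
  shows "riesz_energy \<alpha> A \<le> ennreal (sigma_const DIM('a) \<alpha> * measure lborel A powr ((real DIM('a) + \<alpha>) / real DIM('a)))"
proof -
  obtain r where r: "0 \<le> r" "emeasure lborel A = emeasure lborel (ball (0::'a) r)" "measure lborel A = measure lborel (ball (0::'a) r)"
    using emeasure_eq_ball0[OF fin] .
  show ?thesis unfolding r(3) riesz_energy_ball[OF \<alpha> r(1), symmetric] by (rule riesz_energy_le_ball[OF \<alpha> A fin r(2)])
qed

theorem riesz_energy_isoperimetric_eq:
  fixes A :: "'a::euclidean_space set"
  assumes \<alpha>: "0 < \<alpha>" "\<alpha> < real DIM('a)" and A: "A \<in> sets borel" and fin: "emeasure lborel A < \<infinity>" and pos: "0 < emeasure lborel A"
    and eq: "ennreal (sigma_const DIM('a) \<alpha> * measure lborel A powr ((real DIM('a) + \<alpha>) / real DIM('a))) \<le> riesz_energy \<alpha> A"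
  shows "\<exists>c r. 0 < r \<and> (AE x in lborel. x \<in> A \<longleftrightarrow> x \<in> ball c r)"
proof -
  obtain r where r: "0 \<le> r" "emeasure lborel A = emeasure lborel (ball (0::'a) r)" "measure lborel A = measure lborel (ball (0::'a) r)"
    using emeasure_eq_ball0[OF fin] .
  have "0 < r" using r pos by (cases "r = 0") auto
  moreover have "\<exists>c. AE x in lborel. x \<in> A \<longleftrightarrow> x \<in> ball c r"
    using eq unfolding r(3) riesz_energy_ball[OF \<alpha> r(1), symmetric] by (rule riesz_energy_eq_ball[OF \<alpha> A fin r(2)])
  ultimately show ?thesis by blast
qed

section \<open>A reverse Hoelder inequality on level sets\<close>

text \<open>The tangent line inequality for the convex function \<open>v \<mapsto> v\<^sup>1\<^sup>-\<^sup>q\<close> at \<open>v = 1\<close>.\<close>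
lemma young_scalar:
  fixes q v :: real
  assumes "1 < q" "0 < v"
  shows "q \<le> v powr (1 - q) + (q - 1) * v"
    and "v powr (1 - q) + (q - 1) * v = q \<Longrightarrow> v = 1"
proof -
  have 1: "1 + (1 - q) * ln v \<le> v powr (1 - q)"
    using assms exp_ge_add_one_self[of "(1 - q) * ln v"] by (simp add: powr_def mult.commute)
  have ln: "ln v \<le> v - 1" using assms by (intro ln_le_minus_one)
  have 2: "(q - 1) * ln v \<le> (q - 1) * (v - 1)"
    using assms ln by (intro mult_left_mono) auto
  show "q \<le> v powr (1 - q) + (q - 1) * v"
    using 1 2 by (simp add: algebra_simps)
  assume "v powr (1 - q) + (q - 1) * v = q"
  with 1 have "(q - 1) * (v - 1) \<le> (q - 1) * ln v" by (simp add: algebra_simps)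
  then have "v - 1 \<le> ln v" using assms by simp
  with ln have "ln v = v - 1" by simp
  then show "v = 1" using assms by (intro ln_eq_minus_one)
qed

text \<open>The previous inequality at \<open>v = u m / J\<close>.\<close>
lemma young_scaled:
  fixes q u m J :: real
  assumes q: "1 < q" and pos: "0 < u" "0 < m" "0 < J"
  shows "q * m powr (q - 1) \<le> J powr (q - 1) * u powr (1 - q) + (q - 1) * m powr q / J * u"
    and "J powr (q - 1) * u powr (1 - q) + (q - 1) * m powr q / J * u = q * m powr (q - 1) \<Longrightarrow> u = J / m"
proof -
  define v where "v = u * m / J"
  have v: "0 < v" using pos by (simp add: v_def)
  have "v powr (1 - q) * m powr (q - 1) = J powr (q - 1) * u powr (1 - q)"
  proof -
    have m1: "m powr (1 - q) * m powr (q - 1) = 1" using pos by (simp add: powr_add[symmetric])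
    have "inverse J powr (1 - q) = J powr (q - 1)"
      using pos by (simp add: powr_def ln_inverse algebra_simps)
    then have "v powr (1 - q) = u powr (1 - q) * m powr (1 - q) * J powr (q - 1)"
      using pos by (simp add: v_def divide_inverse powr_mult)
    then have "v powr (1 - q) * m powr (q - 1) = (m powr (1 - q) * m powr (q - 1)) * (J powr (q - 1) * u powr (1 - q))"
      by (simp only: mult_ac)
    then show ?thesis unfolding m1 by simp
  qed
  moreover have "(q - 1) * v * m powr (q - 1) = (q - 1) * m powr q / J * u"
  proof -
    have "m * m powr (q - 1) = m powr q" using pos powr_mult_base[of m "q - 1"] by simp
    then show ?thesis by (simp add: v_def flip: \<open>m * m powr (q - 1) = m powr q\<close>)
  qed
  ultimately have eq: "(v powr (1 - q) + (q - 1) * v) * m powr (q - 1) = J powr (q - 1) * u powr (1 - q) + (q - 1) * m powr q / J * u"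
    by (simp add: distrib_right)
  have mp: "0 < m powr (q - 1)" using pos by simp
  show "q * m powr (q - 1) \<le> J powr (q - 1) * u powr (1 - q) + (q - 1) * m powr q / J * u"
    unfolding eq[symmetric] using young_scalar(1)[OF q v] mp by (intro mult_right_mono) auto
  assume "J powr (q - 1) * u powr (1 - q) + (q - 1) * m powr q / J * u = q * m powr (q - 1)"
  then have "v powr (1 - q) + (q - 1) * v = q"
    unfolding eq[symmetric] using mp by simp
  then have "v = 1" by (rule young_scalar(2)[OF q v])
  then show "u = J / m" using pos by (simp add: v_def field_simps)
qed

lemma nn_integral_le_imp_AE_eq:
  assumes [measurable]: "g \<in> borel_measurable M" "h \<in> borel_measurable M"
    and le: "\<And>x. x \<in> space M \<Longrightarrow> g x \<le> h x" and int: "(\<integral>\<^sup>+x. h x \<partial>M) \<le> (\<integral>\<^sup>+x. g x \<partial>M)" and fin: "(\<integral>\<^sup>+x. g x \<partial>M) < \<infinity>"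
  shows "AE x in M. h x = g x"
proof -
  have "(\<integral>\<^sup>+x. h x \<partial>M) = (\<integral>\<^sup>+x. g x + (h x - g x) \<partial>M)"
    by (intro nn_integral_cong add_diff_inverse_ennreal[symmetric] le)
  also have "\<dots> = (\<integral>\<^sup>+x. g x \<partial>M) + (\<integral>\<^sup>+x. h x - g x \<partial>M)"
    by (rule nn_integral_add) measurable
  finally have "(\<integral>\<^sup>+x. g x \<partial>M) + (\<integral>\<^sup>+x. h x - g x \<partial>M) \<le> (\<integral>\<^sup>+x. g x \<partial>M) + 0" using int by simp
  then have "(\<integral>\<^sup>+x. h x - g x \<partial>M) \<le> 0" using fin unfolding ennreal_add_left_cancel_le by (elim disjE) simp_all
  then have "(\<integral>\<^sup>+x. h x - g x \<partial>M) = 0" by simp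
  then have "AE x in M. h x - g x = 0" by (subst (asm) nn_integral_0_iff_AE) auto
  then show ?thesis
    using AE_space
  proof eventually_elim
    case (elim x)
    have "h x = g x + (h x - g x)" by (rule add_diff_inverse_ennreal[OF le[OF elim(2)], symmetric])
    then show ?case unfolding elim(1) by simp
  qed
qed

text \<open>A reverse Hoelder inequality on a set \<open>A\<close> of measure \<open>m\<close> on which \<open>f\<close> is positive. It is the integral over \<open>A\<close> of
  the scaled tangent line inequality with \<open>u = |f|\<^sup>1\<^sup>/\<^sup>q\<close>, followed by the estimate of the integral of \<open>u\<close> over \<open>A\<close> by \<open>J\<close>. Equality in the
  second step makes \<open>f\<close> vanish outside \<open>A\<close>, equality in the first one makes it constant on \<open>A\<close>.\<close>
lemma reverse_Hoelder_level:
  fixes f :: "'b \<Rightarrow> real"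
  assumes [measurable]: "f \<in> borel_measurable M" "A \<in> sets M" and q: "1 < q" and f: "\<And>x. x \<in> A \<Longrightarrow> 0 < f x"
    and J: "0 < J" "(\<integral>\<^sup>+x. ennreal (\<bar>f x\<bar> powr (1 / q)) \<partial>M) = ennreal J"
    and A: "emeasure M A = ennreal m" "0 < m"
  defines "D \<equiv> (\<integral>\<^sup>+x. ennreal (J powr (q - 1) * f x powr (1 / q - 1)) * indicator A x \<partial>M)"
  shows "ennreal (m powr q) \<le> D" and "D \<le> ennreal (m powr q) \<Longrightarrow> AE x in M. \<bar>f x\<bar> = (J / m) powr q * indicator A x"
proof -
  let ?u = "\<lambda>x. \<bar>f x\<bar> powr (1 / q)"
  define b where "b = (q - 1) * m powr q / J"
  let ?h = "\<lambda>x. ennreal (J powr (q - 1) * f x powr (1 / q - 1)) * indicator A x + ennreal b * (ennreal (?u x) * indicator A x)"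
  let ?g = "\<lambda>x. ennreal (q * m powr (q - 1)) * indicator A x"
  have b: "0 \<le> b" using q J by (simp add: b_def)
  have upow: "?u x powr (1 - q) = f x powr (1 / q - 1)" "0 < ?u x" if "x \<in> A" for x
    using f[OF that] q by (simp_all add: powr_powr diff_divide_distrib)
  have h: "?h x = ennreal (J powr (q - 1) * ?u x powr (1 - q) + b * ?u x)" if "x \<in> A" for x
    using that b unfolding upow(1)[OF that] by (subst ennreal_plus) (auto simp: ennreal_mult)
  have gh: "?g x \<le> ?h x" for x
  proof (cases "x \<in> A")
    case True
    then show ?thesis unfolding h[OF True] using young_scaled(1)[OF q upow(2)[OF True] A(2) J(1), folded b_def] True by (simp add: ennreal_leI)
  qed simp
  have mq: "m powr (q - 1) * m = m powr q" using A(2) powr_mult_base[of m "q - 1"] by (simp add: mult.commute)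
  have intg: "(\<integral>\<^sup>+x. ?g x \<partial>M) = ennreal (m powr q) + ennreal ((q - 1) * m powr q)"
  proof -
    have "(\<integral>\<^sup>+x. ?g x \<partial>M) = ennreal (q * m powr (q - 1)) * ennreal m" by (simp add: nn_integral_cmult_indicator A)
    also have "\<dots> = ennreal (q * (m powr (q - 1) * m))" using q A(2) by (subst ennreal_mult[symmetric]) (auto simp: mult.assoc)
    also have "\<dots> = ennreal (m powr q + (q - 1) * m powr q)" unfolding mq by (simp add: algebra_simps)
    also have "\<dots> = ennreal (m powr q) + ennreal ((q - 1) * m powr q)" using q by (intro ennreal_plus) auto
    finally show ?thesis .
  qed
  define U where "U = (\<integral>\<^sup>+x. ennreal (?u x) * indicator A x \<partial>M)"
  have inth: "(\<integral>\<^sup>+x. ?h x \<partial>M) = D + ennreal b * U"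
    unfolding D_def U_def by (subst nn_integral_add) (auto simp: nn_integral_cmult)
  have UJ: "U + (\<integral>\<^sup>+x. ennreal (?u x) * indicator (space M - A) x \<partial>M) = ennreal J"
  proof -
    have "U + (\<integral>\<^sup>+x. ennreal (?u x) * indicator (space M - A) x \<partial>M) = (\<integral>\<^sup>+x. ennreal (?u x) * indicator A x + ennreal (?u x) * indicator (space M - A) x \<partial>M)"
      unfolding U_def by (rule nn_integral_add[symmetric]) measurable
    also have "\<dots> = (\<integral>\<^sup>+x. ennreal (?u x) \<partial>M)" by (intro nn_integral_cong) (simp add: indicator_def)
    finally show ?thesis using J by simp
  qed
  have UleJ: "U \<le> ennreal J" unfolding UJ[symmetric] by simp
  have bJ: "ennreal b * ennreal J = ennreal ((q - 1) * m powr q)"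
    using b J by (subst ennreal_mult[symmetric]) (auto simp: b_def)
  have bU: "ennreal b * U \<le> ennreal ((q - 1) * m powr q)"
    unfolding bJ[symmetric] using UleJ by (rule mult_left_mono) simp
  have main: "ennreal (m powr q) + ennreal ((q - 1) * m powr q) \<le> D + ennreal b * U"
    unfolding intg[symmetric] inth[symmetric] by (intro nn_integral_mono gh)
  also have "\<dots> \<le> D + ennreal ((q - 1) * m powr q)" using bU by (rule add_left_mono)
  finally have "ennreal ((q - 1) * m powr q) + ennreal (m powr q) \<le> ennreal ((q - 1) * m powr q) + D" by (simp only: add.commute)
  then show "ennreal (m powr q) \<le> D" unfolding ennreal_add_left_cancel_le by (elim disjE) simp_all
  assume Dle: "D \<le> ennreal (m powr q)"
  have "ennreal (m powr q) + ennreal ((q - 1) * m powr q) \<le> ennreal (m powr q) + ennreal b * U"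
    by (rule order_trans[OF main add_right_mono[OF Dle]])
  then have "ennreal b * ennreal J \<le> ennreal b * U" unfolding ennreal_add_left_cancel_le bJ by (elim disjE) simp_all
  moreover have "0 < b" unfolding b_def using q J A(2) by (intro divide_pos_pos mult_pos_pos) auto
  then have "ennreal b \<noteq> 0" by (simp add: ennreal_eq_0_iff)
  ultimately have "ennreal J \<le> U" by (subst (asm) ennreal_mult_le_mult_iff) simp_all
  then have "U + (\<integral>\<^sup>+x. ennreal (?u x) * indicator (space M - A) x \<partial>M) \<le> U + 0" using UJ by simp
  moreover have "U \<noteq> top" using UleJ by (auto simp: top_unique)
  ultimately have "(\<integral>\<^sup>+x. ennreal (?u x) * indicator (space M - A) x \<partial>M) \<le> 0" unfolding ennreal_add_left_cancel_le by (elim disjE) simp_all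
  then have "(\<integral>\<^sup>+x. ennreal (?u x) * indicator (space M - A) x \<partial>M) = 0" by simp
  then have out: "AE x in M. ennreal (?u x) * indicator (space M - A) x = 0"
    by (subst (asm) nn_integral_0_iff_AE) measurable
  have "AE x in M. ?h x = ?g x"
  proof (rule nn_integral_le_imp_AE_eq)
    show "(\<integral>\<^sup>+x. ?h x \<partial>M) \<le> (\<integral>\<^sup>+x. ?g x \<partial>M)" unfolding intg inth by (rule add_mono[OF Dle bU])
    show "(\<integral>\<^sup>+x. ?g x \<partial>M) < \<infinity>" unfolding intg by simp
    show "?g x \<le> ?h x" for x by (rule gh)
  qed measurable
  then show "AE x in M. \<bar>f x\<bar> = (J / m) powr q * indicator A x"
    using out AE_space
  proof eventually_elim
    case (elim x)
    show ?case
    proof (cases "x \<in> A")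
      case True
      have "ennreal (J powr (q - 1) * ?u x powr (1 - q) + b * ?u x) = ennreal (q * m powr (q - 1))"
        using elim(1) True unfolding h[OF True] by simp
      then have "J powr (q - 1) * ?u x powr (1 - q) + b * ?u x = q * m powr (q - 1)"
        using b q by (subst (asm) ennreal_inj) auto
      then have "?u x = J / m" by (rule young_scaled(2)[OF q upow(2)[OF True] A(2) J(1), folded b_def])
      then have "(J / m) powr q = (\<bar>f x\<bar> powr (1 / q)) powr q" by simp
      also have "\<dots> = \<bar>f x\<bar>" using q by (simp add: powr_powr)
      finally show ?thesis using True by simp
    next
      case False
      then have "ennreal (?u x) = 0" using elim(2,3) by simp
      then have "f x = 0" by (simp add: ennreal_eq_0_iff)
      then show ?thesis using False by simp
    qed
  qed
qed

section \<open>The sharp inequality for functions\<close>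

text \<open>The functional of the theorem, written with the Riesz kernel and without the completion of Lebesgue measure, on an arbitrary
  Euclidean space.\<close>
definition min_form :: "real \<Rightarrow> ('a::euclidean_space \<Rightarrow> real) \<Rightarrow> ennreal" where
  "min_form \<alpha> f = (\<integral>\<^sup>+y. \<integral>\<^sup>+x. ennreal (min (f x) (f y)) * riesz_kernel \<alpha> x y \<partial>lborel \<partial>lborel)"

lemma min_form_layer_cake:
  fixes f :: "'a::euclidean_space \<Rightarrow> real"
  assumes [measurable]: "f \<in> borel_measurable borel"
  shows "min_form \<alpha> f = (\<integral>\<^sup>+t. indicator {0<..} t * riesz_energy \<alpha> {x. t < f x} \<partial>lborel)"
proof -
  have layer: "ennreal m = (\<integral>\<^sup>+t. indicator {0<..} t * indicator {..<m} t \<partial>lborel)" for m :: real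
  proof -
    have "(\<integral>\<^sup>+t. indicator {0<..} t * indicator {..<m} t \<partial>lborel) = (\<integral>\<^sup>+t. indicator {0<..<m} t \<partial>lborel)"
      by (intro nn_integral_cong) (simp add: indicator_def)
    also have "\<dots> = emeasure lborel {0<..<m}" by (rule nn_integral_indicator) simp
    also have "\<dots> = ennreal m"
      by (cases "0 \<le> m") (simp_all add: ennreal_neg)
    finally show ?thesis ..
  qed
  have "min_form \<alpha> f = (\<integral>\<^sup>+y. \<integral>\<^sup>+x. \<integral>\<^sup>+t. indicator {0<..} t * indicator {..<min (f x) (f y)} t * riesz_kernel \<alpha> x y \<partial>lborel \<partial>lborel \<partial>lborel)"
    unfolding min_form_def by (subst nn_integral_multc) (auto simp: layer[symmetric])
  also have "\<dots> = (\<integral>\<^sup>+y. \<integral>\<^sup>+t. \<integral>\<^sup>+x. indicator {0<..} t * indicator {..<min (f x) (f y)} t * riesz_kernel \<alpha> x y \<partial>lborel \<partial>lborel \<partial>lborel)"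
    unfolding indicator_def greaterThan_iff lessThan_iff by (rule nn_integral_cong, rule lborel_pair.Fubini') measurable
  also have "\<dots> = (\<integral>\<^sup>+t. \<integral>\<^sup>+y. \<integral>\<^sup>+x. indicator {0<..} t * indicator {..<min (f x) (f y)} t * riesz_kernel \<alpha> x y \<partial>lborel \<partial>lborel \<partial>lborel)"
    unfolding indicator_def greaterThan_iff lessThan_iff by (rule lborel_pair.Fubini') measurable
  also have "\<dots> = (\<integral>\<^sup>+t. indicator {0<..} t * riesz_energy \<alpha> {x. t < f x} \<partial>lborel)"
  proof (rule nn_integral_cong)
    fix t :: real
    have "{x. t < f x} = {x \<in> space borel. t < f x}" by simp
    also have "\<dots> \<in> sets borel" by measurable
    finally have [measurable]: "{x. t < f x} \<in> sets borel" .
    have "(\<integral>\<^sup>+y. \<integral>\<^sup>+x. indicator {0<..} t * indicator {..<min (f x) (f y)} t * riesz_kernel \<alpha> x y \<partial>lborel \<partial>lborel)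
      = (\<integral>\<^sup>+y. \<integral>\<^sup>+x. indicator {0<..} t * (indicator {x. t < f x} x * indicator {x. t < f x} y * riesz_kernel \<alpha> x y) \<partial>lborel \<partial>lborel)"
      by (intro nn_integral_cong) (simp add: indicator_def)
    also have "\<dots> = indicator {0<..} t * riesz_energy \<alpha> {x. t < f x}"
      unfolding riesz_energy_def by (simp add: nn_integral_cmult)
    finally show "(\<integral>\<^sup>+y. \<integral>\<^sup>+x. indicator {0<..} t * indicator {..<min (f x) (f y)} t * riesz_kernel \<alpha> x y \<partial>lborel \<partial>lborel)
      = indicator {0<..} t * riesz_energy \<alpha> {x. t < f x}" .
  qed
  finally show ?thesis .
qed

lemma riesz_energy_level_measurable:
  fixes f :: "'a::euclidean_space \<Rightarrow> real"
  assumes [measurable]: "f \<in> borel_measurable borel"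
  shows "(\<lambda>t. riesz_energy \<alpha> {x. t < f x}) \<in> borel_measurable borel"
proof -
  have "(\<lambda>t. \<integral>\<^sup>+y. \<integral>\<^sup>+x. (if t < f x then 1 else 0) * (if t < f y then 1 else 0) * riesz_kernel \<alpha> x y \<partial>lborel \<partial>lborel) \<in> borel_measurable borel"
    by measurable
  then show ?thesis unfolding riesz_energy_def indicator_def mem_Collect_eq of_bool_def .
qed

text \<open>The inequality and its case of equality for Borel functions with \<open>J\<close>, the integral of \<open>f\<^sup>p\<close>, positive and finite. The function
  \<open>D\<close> is the upper bound for \<open>|A\<^sub>t|\<^sup>q\<close> from the reverse Hoelder inequality; \<open>\<sigma> D t\<close> dominates the energy
  of the level set at every level \<open>t > 0\<close>, and \<open>D\<close> integrates to \<open>J\<^sup>q\<close>.\<close>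
theorem min_form_inequality:
  fixes f :: "'a::euclidean_space \<Rightarrow> real" and \<alpha> J :: real
  defines "q \<equiv> (real DIM('a) + \<alpha>) / real DIM('a)"
  assumes \<alpha>: "0 < \<alpha>" "\<alpha> < real DIM('a)"
    and f[measurable]: "f \<in> borel_measurable borel" and f0: "\<And>x. 0 \<le> f x"
    and J: "0 < J" "(\<integral>\<^sup>+x. ennreal (\<bar>f x\<bar> powr (1 / q)) \<partial>lborel) = ennreal J"
  shows "min_form \<alpha> f \<le> ennreal (sigma_const DIM('a) \<alpha> * J powr q)"
    and "ennreal (sigma_const DIM('a) \<alpha> * J powr q) \<le> min_form \<alpha> f \<Longrightarrow>
      \<exists>c a r. 0 < r \<and> (AE x in lborel. f x = c * indicator (ball a r) x)"
proof -
  define \<sigma> where "\<sigma> = sigma_const DIM('a) \<alpha>"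
  have \<sigma>: "0 < \<sigma>" unfolding \<sigma>_def using \<alpha> by (intro sigma_const_pos) auto
  have q: "1 < q" using \<alpha> by (simp add: q_def)
  define A where "A t = {x. t < f x}" for t
  have A[measurable]: "A t \<in> sets borel" for t
  proof -
    have "A t = {x \<in> space borel. t < f x}" by (simp add: A_def)
    also have "\<dots> \<in> sets borel" by measurable
    finally show ?thesis .
  qed
  have Afin: "emeasure lborel (A t) < \<infinity>" if t: "0 < t" for t
  proof -
    have "ennreal (t powr (1 / q)) * emeasure lborel (A t) = (\<integral>\<^sup>+x. ennreal (t powr (1 / q)) * indicator (A t) x \<partial>lborel)"
      by (simp add: nn_integral_cmult_indicator)
    also have "\<dots> \<le> (\<integral>\<^sup>+x. ennreal (\<bar>f x\<bar> powr (1 / q)) \<partial>lborel)"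
    proof (rule nn_integral_mono)
      fix x
      have "t powr (1 / q) \<le> \<bar>f x\<bar> powr (1 / q)" if "t < f x"
        using that t q by (intro powr_mono2) auto
      then show "ennreal (t powr (1 / q)) * indicator (A t) x \<le> ennreal (\<bar>f x\<bar> powr (1 / q))"
        by (auto simp: A_def indicator_def intro!: ennreal_leI)
    qed
    finally have "ennreal (t powr (1 / q)) * emeasure lborel (A t) < \<infinity>" using J(2) by (simp add: le_less_trans)
    moreover have "ennreal (t powr (1 / q)) \<noteq> 0" using t by (simp add: ennreal_eq_0_iff)
    ultimately show ?thesis by (auto simp: ennreal_mult_less_top)
  qed
  define D where "D t = (\<integral>\<^sup>+x. ennreal (J powr (q - 1) * f x powr (1 / q - 1)) * indicator (A t) x \<partial>lborel)" for t
  have em: "emeasure lborel (A t) = ennreal (measure lborel (A t))" if "0 < t" for t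
    using Afin[OF that] by (intro emeasure_eq_ennreal_measure) simp
  have fpos: "0 < f x" if "0 < t" "x \<in> A t" for t x using that by (simp add: A_def)
  note rev = reverse_Hoelder_level[where M=lborel and f=f, OF _ _ q fpos J]
  have muD: "ennreal (measure lborel (A t) powr q) \<le> D t" if t: "0 < t" for t
  proof (cases "measure lborel (A t) = 0")
    case False
    then have "0 < measure lborel (A t)" using measure_nonneg[of lborel "A t"] by linarith
    then show ?thesis using rev(1)[OF _ _ t _ em[OF t]] by (simp add: D_def)
  qed simp
  have ED: "riesz_energy \<alpha> (A t) \<le> ennreal (\<sigma> * measure lborel (A t) powr q)" if t: "0 < t" for t
    unfolding \<sigma>_def q_def by (rule riesz_energy_isoperimetric[OF \<alpha> A Afin[OF t]])
  have D_meas [measurable]: "D \<in> borel_measurable borel"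
  proof -
    have "(\<lambda>t. \<integral>\<^sup>+x. ennreal (J powr (q - 1) * f x powr (1 / q - 1)) * (if t < f x then 1 else 0) \<partial>lborel) \<in> borel_measurable borel"
      by measurable
    then show ?thesis unfolding D_def[abs_def] A_def indicator_def mem_Collect_eq of_bool_def .
  qed
  have E_meas [measurable]: "(\<lambda>t. riesz_energy \<alpha> (A t)) \<in> borel_measurable borel"
    unfolding A_def by (rule riesz_energy_level_measurable) measurable
  have intD: "(\<integral>\<^sup>+t. indicator {0<..} t * (ennreal \<sigma> * D t) \<partial>lborel) = ennreal (\<sigma> * J powr q)"
  proof -
    have "(\<integral>\<^sup>+t. indicator {0<..} t * D t \<partial>lborel) = (\<integral>\<^sup>+t. \<integral>\<^sup>+x. indicator {0<..} t * (ennreal (J powr (q - 1) * f x powr (1 / q - 1)) * indicator {..<f x} t) \<partial>lborel \<partial>lborel)"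
      unfolding D_def A_def indicator_def mem_Collect_eq greaterThan_iff lessThan_iff
      by (intro nn_integral_cong nn_integral_cmult[symmetric]) measurable
    also have "\<dots> = (\<integral>\<^sup>+x. \<integral>\<^sup>+t. indicator {0<..} t * (ennreal (J powr (q - 1) * f x powr (1 / q - 1)) * indicator {..<f x} t) \<partial>lborel \<partial>lborel)"
      unfolding indicator_def greaterThan_iff lessThan_iff by (rule lborel_pair.Fubini') measurable
    also have "\<dots> = (\<integral>\<^sup>+x. ennreal (J powr (q - 1)) * ennreal (\<bar>f x\<bar> powr (1 / q)) \<partial>lborel)"
    proof (rule nn_integral_cong)
      fix x
      have "(\<integral>\<^sup>+t. indicator {0<..} t * (ennreal (J powr (q - 1) * f x powr (1 / q - 1)) * indicator {..<f x} t) \<partial>lborel)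
        = (\<integral>\<^sup>+t. ennreal (J powr (q - 1) * f x powr (1 / q - 1)) * indicator {0<..<f x} t \<partial>lborel)"
        by (intro nn_integral_cong) (auto simp: indicator_def)
      also have "\<dots> = ennreal (J powr (q - 1) * f x powr (1 / q - 1)) * ennreal (f x)"
        using f0[of x] by (subst nn_integral_cmult_indicator) auto
      also have "\<dots> = ennreal (J powr (q - 1) * (f x powr (1 / q - 1) * f x))"
        using f0[of x] by (subst ennreal_mult[symmetric]) (auto simp: mult.assoc)
      also have "f x powr (1 / q - 1) * f x = \<bar>f x\<bar> powr (1 / q)"
        using f0[of x] powr_mult_base[of "f x" "1 / q - 1"] by (simp add: mult.commute)
      finally show "(\<integral>\<^sup>+t. indicator {0<..} t * (ennreal (J powr (q - 1) * f x powr (1 / q - 1)) * indicator {..<f x} t) \<partial>lborel)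
        = ennreal (J powr (q - 1)) * ennreal (\<bar>f x\<bar> powr (1 / q))" by (simp add: ennreal_mult)
    qed
    also have "\<dots> = ennreal (J powr (q - 1)) * ennreal J"
      using J(2) by (simp add: nn_integral_cmult)
    also have "\<dots> = ennreal (J powr q)"
      using J(1) powr_mult_base[of J "q - 1"] by (simp add: ennreal_mult[symmetric] mult.commute)
    finally have "(\<integral>\<^sup>+t. indicator {0<..} t * D t \<partial>lborel) = ennreal (J powr q)" .
    moreover have "(\<integral>\<^sup>+t. indicator {0<..} t * (ennreal \<sigma> * D t) \<partial>lborel) = ennreal \<sigma> * (\<integral>\<^sup>+t. indicator {0<..} t * D t \<partial>lborel)"
      by (subst nn_integral_cmult[symmetric]) (auto simp: mult.left_commute)
    ultimately show ?thesis using \<sigma> by (simp add: ennreal_mult)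
  qed
  have point: "indicator {0<..} t * riesz_energy \<alpha> (A t) \<le> indicator {0<..} t * (ennreal \<sigma> * D t)" for t
  proof (cases "0 < t")
    case True
    have "riesz_energy \<alpha> (A t) \<le> ennreal \<sigma> * ennreal (measure lborel (A t) powr q)"
      using ED[OF True] \<sigma> by (simp add: ennreal_mult)
    also have "\<dots> \<le> ennreal \<sigma> * D t" by (intro mult_left_mono muD[OF True]) simp
    finally show ?thesis using True by simp
  qed simp
  note cake = min_form_layer_cake[OF f, of \<alpha>, folded A_def]
  show "min_form \<alpha> f \<le> ennreal (sigma_const DIM('a) \<alpha> * J powr q)"
    unfolding cake \<sigma>_def[symmetric] intD[symmetric] by (intro nn_integral_mono point)
  assume ge: "ennreal (sigma_const DIM('a) \<alpha> * J powr q) \<le> min_form \<alpha> f"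
  have int_le: "(\<integral>\<^sup>+t. indicator {0<..} t * (ennreal \<sigma> * D t) \<partial>lborel) \<le> (\<integral>\<^sup>+t. indicator {0<..} t * riesz_energy \<alpha> (A t) \<partial>lborel)"
    using ge unfolding cake \<sigma>_def[symmetric] intD .
  have "AE t in lborel. indicator {0<..} t * (ennreal \<sigma> * D t) = indicator {0<..} t * riesz_energy \<alpha> (A t)"
  proof (rule nn_integral_le_imp_AE_eq[OF _ _ point int_le])
    have "(\<integral>\<^sup>+t. indicator {0<..} t * riesz_energy \<alpha> (A t) \<partial>lborel) \<le> ennreal (\<sigma> * J powr q)"
      unfolding intD[symmetric] by (intro nn_integral_mono point)
    also have "\<dots> < \<infinity>" by simp
    finally show "(\<integral>\<^sup>+t. indicator {0<..} t * riesz_energy \<alpha> (A t) \<partial>lborel) < \<infinity>" .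
  qed measurable
  then have AEt: "AE t in lborel. 0 < t \<longrightarrow> ennreal \<sigma> * D t = riesz_energy \<alpha> (A t)"
    by eventually_elim (auto simp: indicator_def)
  have "\<exists>t0>0. 0 < emeasure lborel (A t0)"
  proof (rule ccontr)
    assume "\<not> ?thesis"
    then have "emeasure lborel (A t) = 0" if "0 < t" for t using that by (auto simp: zero_less_iff_neq_zero)
    then have "A (inverse (Suc k)) \<in> null_sets lborel" for k by (intro null_setsI) auto
    then have "AE x in lborel. x \<notin> A (inverse (Suc k))" for k by (rule AE_not_in)
    then have "AE x in lborel. \<forall>k. x \<notin> A (inverse (Suc k))" by (simp add: AE_all_countable)
    then have "AE x in lborel. ennreal (\<bar>f x\<bar> powr (1 / q)) = 0"
    proof eventually_elim
      case (elim x)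
      have "f x = 0"
      proof (rule ccontr)
        assume "f x \<noteq> 0"
        then have "0 < f x" using f0[of x] by simp
        then obtain k where "inverse (real (Suc k)) < f x" using reals_Archimedean by blast
        then show False using elim by (simp add: A_def)
      qed
      then show ?case by simp
    qed
    then have "(\<integral>\<^sup>+x. ennreal (\<bar>f x\<bar> powr (1 / q)) \<partial>lborel) = 0"
      by (subst nn_integral_0_iff_AE) auto
    then show False using J by simp
  qed
  then obtain t0 where t0: "0 < t0" "0 < emeasure lborel (A t0)" by blast
  \<comment> \<open>Equality holds at almost every level, so it holds at some level below \<open>t0\<close>, where the level set has positive measure.\<close>
  have "\<exists>t. 0 < t \<and> t < t0 \<and> ennreal \<sigma> * D t = riesz_energy \<alpha> (A t)"
  proof (rule ccontr)
    assume no: "\<not> ?thesis"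
    have "AE t in lborel. t \<notin> {0<..<t0}"
      using AEt
    proof eventually_elim
      case (elim t)
      then show ?case using no by auto
    qed
    then have "{0<..<t0} \<in> null_sets lborel" by (simp add: AE_iff_null_sets)
    then have "emeasure lborel {0<..<t0} = 0" by (rule null_setsD1)
    then show False using t0(1) by simp
  qed
  then obtain t where t: "0 < t" "t < t0" "ennreal \<sigma> * D t = riesz_energy \<alpha> (A t)" by blast
  have "emeasure lborel (A t0) \<le> emeasure lborel (A t)"
    using t(2) by (intro emeasure_mono) (auto simp: A_def)
  then have pos: "0 < emeasure lborel (A t)" using t0(2) by (rule less_le_trans[rotated])
  define m where "m = measure lborel (A t)"
  have m: "emeasure lborel (A t) = ennreal m" unfolding m_def by (rule em[OF t(1)])
  have m0: "0 < m" using pos unfolding m by simp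
  have Dle: "D t \<le> ennreal (m powr q)"
  proof -
    have "ennreal \<sigma> * D t \<le> ennreal \<sigma> * ennreal (m powr q)"
      using ED[OF t(1)] \<sigma> unfolding t(3) m_def by (simp add: ennreal_mult)
    then show ?thesis using \<sigma> by (subst (asm) ennreal_mult_le_mult_iff) (auto simp: ennreal_eq_0_iff)
  qed
  have AEf: "AE x in lborel. \<bar>f x\<bar> = (J / m) powr q * indicator (A t) x"
    by (rule rev(2)[OF _ _ t(1) _ m m0 Dle[unfolded D_def]]) simp_all
  have "ennreal (\<sigma> * m powr q) \<le> riesz_energy \<alpha> (A t)"
    using mult_left_mono[OF muD[OF t(1)], of "ennreal \<sigma>"] \<sigma> unfolding t(3) m_def by (simp add: ennreal_mult)
  then obtain a r where ball: "0 < r" "AE x in lborel. x \<in> A t \<longleftrightarrow> x \<in> ball a r"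
    using riesz_energy_isoperimetric_eq[OF \<alpha> A Afin[OF t(1)] pos] unfolding \<sigma>_def q_def m_def by blast
  have "AE x in lborel. f x = (J / m) powr q * indicator (ball a r) x"
    using AEf ball(2)
  proof eventually_elim
    case (elim x)
    then show ?case using f0[of x] by (simp add: indicator_def)
  qed
  then show "\<exists>c a r. 0 < r \<and> (AE x in lborel. f x = c * indicator (ball a r) x)" using ball(1) by blast
qed

lemma min_form_ball:
  fixes a :: "'a::euclidean_space"
  assumes \<alpha>: "0 < \<alpha>" "\<alpha> < real DIM('a)" and r: "0 < r" and c: "0 \<le> c"
  shows "min_form \<alpha> (\<lambda>x. c * indicator (ball a r) x)
    = ennreal (sigma_const DIM('a) \<alpha> * (c * measure lborel (ball a r) powr ((real DIM('a) + \<alpha>) / real DIM('a))))"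
proof -
  have [measurable]: "ball a r \<in> sets borel" by simp
  have "min_form \<alpha> (\<lambda>x. c * indicator (ball a r) x) = (\<integral>\<^sup>+y. \<integral>\<^sup>+x. ennreal c * (indicator (ball a r) x * indicator (ball a r) y * riesz_kernel \<alpha> x y) \<partial>lborel \<partial>lborel)"
    unfolding min_form_def using c by (intro nn_integral_cong) (simp add: indicator_def)
  also have "\<dots> = ennreal c * riesz_energy \<alpha> (ball a r)"
    unfolding riesz_energy_def by (simp add: nn_integral_cmult)
  also have "riesz_energy \<alpha> (ball a r) = riesz_energy \<alpha> {x. x + a \<in> ball a r}"
    by (rule riesz_energy_translate[symmetric]) simp
  also have "{x. x + a \<in> ball a r} = ball 0 r" by (auto simp: dist_norm)
  also have "riesz_energy \<alpha> (ball (0::'a) r) = ennreal (sigma_const DIM('a) \<alpha> * measure lborel (ball a r) powr ((real DIM('a) + \<alpha>) / real DIM('a)))"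
    using riesz_energy_ball[OF \<alpha>, of r] r by (simp add: content_ball)
  also have "ennreal c * \<dots> = ennreal (sigma_const DIM('a) \<alpha> * (c * measure lborel (ball a r) powr ((real DIM('a) + \<alpha>) / real DIM('a))))"
    using c sigma_const_pos[of \<alpha> "DIM('a)"] \<alpha> by (simp add: ennreal_mult[symmetric] mult_ac less_imp_le)
  finally show ?thesis .
qed

lemma min_energy_eq_min_form: "min_energy \<alpha> f = min_form \<alpha> f"
  unfolding min_energy_def min_form_def nn_integral_completion riesz_kernel_def
  by (intro nn_integral_cong) (simp add: ennreal_mult''[symmetric])

lemma min_form_cong_AE:
  fixes f g :: "'a::euclidean_space \<Rightarrow> real"
  assumes "AE x in lborel. f x = g x"
  shows "min_form \<alpha> f = min_form \<alpha> g"
  unfolding min_form_def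
proof (rule nn_integral_cong_AE, use assms in eventually_elim)
  fix y assume y: "f y = g y"
  show "(\<integral>\<^sup>+x. ennreal (min (f x) (f y)) * riesz_kernel \<alpha> x y \<partial>lborel) = (\<integral>\<^sup>+x. ennreal (min (g x) (g y)) * riesz_kernel \<alpha> x y \<partial>lborel)"
    by (rule nn_integral_cong_AE, use assms in eventually_elim) (simp add: y)
qed

lemma Lp_norm_cong_AE:
  assumes "AE x in lborel. f x = g x"
  shows "Lp_norm p f = Lp_norm p g"
proof -
  have "(\<integral>\<^sup>+x. ennreal (\<bar>f x\<bar> powr p) \<partial>lebesgue) = (\<integral>\<^sup>+x. ennreal (\<bar>g x\<bar> powr p) \<partial>lebesgue)"
    unfolding nn_integral_completion by (rule nn_integral_cong_AE, use assms in eventually_elim) simp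
  then show ?thesis unfolding Lp_norm_def by simp
qed

lemma Lp_norm_ball:
  assumes p: "0 < p"
  shows "Lp_norm p (\<lambda>x. c * indicator (ball a r) x) = ennreal (\<bar>c\<bar> * measure lborel (ball a r) powr (1 / p))"
proof -
  have [measurable]: "ball a r \<in> sets borel" by simp
  have "(\<integral>\<^sup>+x. ennreal (\<bar>c * indicator (ball a r) x\<bar> powr p) \<partial>lebesgue) = (\<integral>\<^sup>+x. ennreal (\<bar>c\<bar> powr p) * indicator (ball a r) x \<partial>lborel)"
    unfolding nn_integral_completion by (intro nn_integral_cong) (simp add: indicator_def)
  also have "\<dots> = ennreal (\<bar>c\<bar> powr p) * emeasure lborel (ball a r)"
    by (simp add: nn_integral_cmult_indicator)
  also have "emeasure lborel (ball a r) = ennreal (measure lborel (ball a r))"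
    using emeasure_bounded_finite[OF bounded_ball, of a r] by (intro emeasure_eq_ennreal_measure) simp
  also have "ennreal (\<bar>c\<bar> powr p) * ennreal (measure lborel (ball a r)) = ennreal (\<bar>c\<bar> powr p * measure lborel (ball a r))"
    by (rule ennreal_mult[symmetric]) auto
  finally have I: "(\<integral>\<^sup>+x. ennreal (\<bar>c * indicator (ball a r) x\<bar> powr p) \<partial>lebesgue) = ennreal (\<bar>c\<bar> powr p * measure lborel (ball a r))" .
  have "(\<bar>c\<bar> powr p * measure lborel (ball a r)) powr (1 / p) = \<bar>c\<bar> * measure lborel (ball a r) powr (1 / p)"
    using p by (simp add: powr_mult powr_powr)
  then show ?thesis unfolding Lp_norm_def I Let_def by simp
qed

theorem theoremA:
  fixes \<alpha> p :: real
  assumes "0 < \<alpha>" and "\<alpha> < real CARD('n::finite)"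
    and "p = real CARD('n) / (real CARD('n) + \<alpha>)"
  shows "(\<forall>f \<in> (Lp p :: (real ^ 'n \<Rightarrow> real) set). (AE x in lebesgue. 0 \<le> f x) \<longrightarrow>
            ennreal (sigma_const CARD('n) \<alpha>) * Lp_norm p f \<ge> min_energy \<alpha> f \<and>
            (ennreal (sigma_const CARD('n) \<alpha>) * Lp_norm p f = min_energy \<alpha> f \<longleftrightarrow>
               (\<exists>c a r. 0 < r \<and> (AE x in lebesgue. f x = c * indicat_real (ball a r) x)))) \<and>
         (\<forall>C::real. (\<forall>f \<in> (Lp p :: (real ^ 'n \<Rightarrow> real) set). (AE x in lebesgue. 0 \<le> f x) \<longrightarrow>
              ennreal C * Lp_norm p f \<ge> min_energy \<alpha> f) \<longrightarrow> sigma_const CARD('n) \<alpha> \<le> C)"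
proof -
  let ?\<sigma> = "sigma_const CARD('n) \<alpha>"
  have dim: "DIM(real ^ 'n) = CARD('n)" by simp
  have \<alpha>: "0 < \<alpha>" "\<alpha> < real DIM(real ^ 'n)" using assms by simp_all
  have \<sigma>: "0 < ?\<sigma>" using assms by (intro sigma_const_pos) auto
  have p: "0 < p" using assms by simp
  have q: "1 / p = (real DIM(real ^ 'n) + \<alpha>) / real DIM(real ^ 'n)" using assms by simp
  have p1q: "1 / (1 / p) = p" by simp
  \<comment> \<open>A negative \<open>c\<close> is impossible since \<open>f\<close> is non-negative almost everywhere; \<open>c = 0\<close> is allowed.\<close>
  have ball_eq: "ennreal ?\<sigma> * Lp_norm p f = min_energy \<alpha> f"
    if f: "AE x in lborel. f x = c * indicat_real (ball a r) x" and f0: "AE x in lborel. 0 \<le> f x" and r: "0 < r"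
    for f :: "real ^ 'n \<Rightarrow> real" and c a r
  proof -
    have "0 \<le> c"
    proof (rule ccontr)
      assume "\<not> 0 \<le> c"
      have "AE x in lborel. x \<notin> ball a r"
        using f f0
      proof eventually_elim
        case (elim x)
        then show ?case using \<open>\<not> 0 \<le> c\<close> by (auto simp: indicator_def split: if_splits)
      qed
      then have "ball a r \<in> null_sets lborel" by (simp add: AE_iff_null_sets)
      then have "measure lborel (ball a r) = 0" by (simp add: measure_def null_setsD1)
      then show False using r content_ball_gt_0_iff[of a r] by simp
    qed
    then show ?thesis
      using \<sigma> unfolding min_energy_eq_min_form min_form_cong_AE[OF f] Lp_norm_cong_AE[OF f]
        Lp_norm_ball[OF p] min_form_ball[OF \<alpha> r \<open>0 \<le> c\<close>] q dim
      by (simp add: ennreal_mult)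
  qed
  have main: "min_energy \<alpha> f \<le> ennreal ?\<sigma> * Lp_norm p f \<and>
      (ennreal ?\<sigma> * Lp_norm p f = min_energy \<alpha> f \<longrightarrow> (\<exists>c a r. 0 < r \<and> (AE x in lborel. f x = c * indicat_real (ball a r) x)))"
    if f: "f \<in> Lp p" and f0: "AE x in lborel. 0 \<le> f x" for f :: "real ^ 'n \<Rightarrow> real"
  proof -
    \<comment> \<open>A Lebesgue measurable \<open>f\<close> is replaced by a non-negative Borel function; both sides ignore null sets.\<close>
    obtain g0 where g0: "g0 \<in> borel_measurable lborel" "AE x in lborel. f x = g0 x"
      using f completion_ex_borel_measurable_real[of f lborel] by (auto simp: Lp_def)
    define g where "g x = max 0 (g0 x)" for x
    have g[measurable]: "g \<in> borel_measurable borel" using g0(1) unfolding g_def by simp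
    have gpos: "0 \<le> g x" for x by (simp add: g_def)
    have fg: "AE x in lborel. f x = g x"
      using g0(2) f0 by eventually_elim (simp add: g_def)
    have nf: "Lp_norm p f = Lp_norm p g" by (rule Lp_norm_cong_AE[OF fg])
    have ef: "min_energy \<alpha> f = min_form \<alpha> g" unfolding min_energy_eq_min_form by (rule min_form_cong_AE[OF fg])
    define I where "I = (\<integral>\<^sup>+x. ennreal (\<bar>g x\<bar> powr p) \<partial>lborel)"
    have ng: "Lp_norm p g = (if I = \<infinity> then \<infinity> else ennreal (enn2real I powr (1 / p)))"
      unfolding Lp_norm_def nn_integral_completion I_def Let_def ..
    have "Lp_norm p g < \<infinity>" using f nf by (simp add: Lp_def)
    then have Ifin: "I \<noteq> \<infinity>" using ng by auto
    define J where "J = enn2real I"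
    have IJ: "I = ennreal J" using Ifin by (simp add: J_def less_top)
    have ngJ: "Lp_norm p g = ennreal (J powr (1 / p))" using ng Ifin by (simp add: J_def)
    show ?thesis
    proof (cases "J = 0")
      case True
      then have "(\<integral>\<^sup>+x. ennreal (\<bar>g x\<bar> powr p) \<partial>lborel) = 0" using IJ by (simp add: I_def)
      then have "AE x in lborel. ennreal (\<bar>g x\<bar> powr p) = 0"
        by (subst (asm) nn_integral_0_iff_AE) auto
      then have "AE x in lborel. f x = 0 * indicat_real (ball 0 1) x"
        using fg by eventually_elim (simp add: ennreal_eq_0_iff)
      moreover from ball_eq[OF this f0] have "ennreal ?\<sigma> * Lp_norm p f = min_energy \<alpha> f" by simp
      ultimately show ?thesis by (intro conjI impI exI[of _ 0] exI[of _ "0 :: real ^ 'n"] exI[of _ 1]) auto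
    next
      case False
      then have J: "0 < J" using enn2real_nonneg[of I] unfolding J_def by linarith
      have IJ': "(\<integral>\<^sup>+x. ennreal (\<bar>g x\<bar> powr (1 / ((real DIM(real ^ 'n) + \<alpha>) / real DIM(real ^ 'n)))) \<partial>lborel) = ennreal J"
        unfolding q[symmetric] p1q using IJ by (simp add: I_def)
      have e: "ennreal (?\<sigma> * J powr (1 / p)) = ennreal ?\<sigma> * Lp_norm p f"
        unfolding nf ngJ using \<sigma> by (simp add: ennreal_mult)
      note ineq = min_form_inequality[OF \<alpha> g gpos J IJ', folded q, unfolded dim, unfolded e]
      show ?thesis
      proof (intro conjI impI)
        show "min_energy \<alpha> f \<le> ennreal ?\<sigma> * Lp_norm p f" unfolding ef by (rule ineq(1))
        assume "ennreal ?\<sigma> * Lp_norm p f = min_energy \<alpha> f"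
        then obtain c a r where r: "0 < r" and AEg: "AE x in lborel. g x = c * indicat_real (ball a r) x"
          using ineq(2) unfolding ef by auto
        have "AE x in lborel. f x = c * indicat_real (ball a r) x"
          using AEg fg by eventually_elim simp
        then show "\<exists>c a r. 0 < r \<and> (AE x in lborel. f x = c * indicat_real (ball a r) x)" using r by blast
      qed
    qed
  qed
  have AEc: "(AE x in lebesgue. P x) \<longleftrightarrow> (AE x in lborel. P x)" for P :: "real ^ 'n \<Rightarrow> bool"
    by (rule AE_completion_iff)
  show ?thesis
    unfolding AEc
  proof (intro conjI ballI allI impI)
    fix f :: "real ^ 'n \<Rightarrow> real" assume f: "f \<in> Lp p" "AE x in lborel. 0 \<le> f x"
    show "min_energy \<alpha> f \<le> ennreal ?\<sigma> * Lp_norm p f" using main[OF f] by blast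
    show "ennreal ?\<sigma> * Lp_norm p f = min_energy \<alpha> f \<longleftrightarrow> (\<exists>c a r. 0 < r \<and> (AE x in lborel. f x = c * indicat_real (ball a r) x))"
      using main[OF f] ball_eq[OF _ f(2)] by blast
  next
    fix C :: real
    assume C: "\<forall>f \<in> (Lp p :: (real ^ 'n \<Rightarrow> real) set). (AE x in lborel. 0 \<le> f x) \<longrightarrow> min_energy \<alpha> f \<le> ennreal C * Lp_norm p f"
    \<comment> \<open>The indicator of the unit ball has equality, so no smaller constant is possible.\<close>
    define f where "f = (\<lambda>x::real ^ 'n. 1 * indicat_real (ball 0 1) x)"
    define N where "N = measure lborel (ball (0 :: real ^ 'n) 1) powr (1 / p)"
    have nf: "Lp_norm p f = ennreal N" unfolding f_def N_def Lp_norm_ball[OF p] by simp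
    have "0 < measure lborel (ball (0 :: real ^ 'n) 1)" by simp
    then have N: "0 < N" unfolding N_def by simp
    have [measurable]: "ball (0 :: real ^ 'n) 1 \<in> sets borel" by simp
    have "f \<in> borel_measurable lborel" unfolding f_def by measurable
    then have "f \<in> borel_measurable lebesgue" by (rule measurable_completion)
    then have "f \<in> Lp p" by (simp add: Lp_def nf)
    moreover have f0: "AE x in lborel. 0 \<le> f x" by (simp add: f_def)
    ultimately have "min_energy \<alpha> f \<le> ennreal C * Lp_norm p f" using C by blast
    moreover have "ennreal ?\<sigma> * Lp_norm p f = min_energy \<alpha> f"
      by (rule ball_eq[OF _ f0, of 1 0 1]) (simp_all add: f_def)
    ultimately have "ennreal N * ennreal ?\<sigma> \<le> ennreal N * ennreal C" unfolding nf by (simp add: mult.commute)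
    then have "ennreal ?\<sigma> \<le> ennreal C" using N by (subst (asm) ennreal_mult_le_mult_iff) (auto simp: ennreal_eq_0_iff)
    then show "?\<sigma> \<le> C" using \<sigma> by (simp add: ennreal_le_iff2)
  qed
qed

end
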